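(* Let $N\ge 2$ and let $T, T'\in \mathrm{cv}_N$ be such that $\|g\|_T=\|g\|_{T'}$ for every $g\in \mathbf{U}_T$, where $\mathbf{U}_T\subseteq F_N$ is the set of almost simple curves for $T/F_N$. Then $T'=T$ in $\mathrm{cv}_N$.
   Context: $F_N$ denotes the free group of finite rank $N\ge 2$. The (unprojectivized) Culler--Vogtmann Outer space $\mathrm{cv}_N$ is the set of all minimal free discrete isometric actions of $F_N$ on $\mathbb{R}$-trees, where two such trees are considered equal in $\mathrm{cv}_N$ if there is an $F_N$-equivariant isometry between them. For $T\in \mathrm{cv}_N$ and $g\in F_N$ the translation length is $\|g\|_T=\min_{x\in T} d_T(x,gx)$; it depends only on the conjugacy class of $g$. For $T\in\mathrm{cv}_N$ the quotient $\Gamma=T/F_N$ is a finite connected metric graph (viewed as a 1-complex in which every vertex has degree $\ge 3$), and the action identifies $F_N$ with $\pi_1(\Gamma)$ via an isomorphism $\alpha:F_N\to\pi_1(\Gamma)$, so that conjugacy classes in $F_N$ correspond to free homotopy classes of closed curves in $\Gamma$. A topological edge is a closed 1-cell of $\Gamma$ (without orientation). The set $\mathbf{U}_T\subseteq F_N$ of almost simple curves for $T/F_N$ is the (finite) set of all elements of $F_N$ corresponding under $\alpha$ (one representative for each conjugacy class) to closed curves $\gamma$ in $\Gamma$ of one of the following types: (1) $\gamma$ is a nontrivial simple closed circuit in $\Gamma$; (2) (figure-eight curve) $\gamma=\gamma_1\gamma_2$ is a concatenation of two nontrivial simple closed circuits $\gamma_1,\gamma_2$, each beginning and ending at a common vertex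 $v$, such that $\gamma_1$ and $\gamma_2$ do not contain any common topological edges; (3) (barbell curve) $\gamma=\gamma_1\beta\gamma_2\beta^{-1}$, where $\gamma_i$ is a nontrivial simple closed circuit at a vertex $v_i$ of $\Gamma$ ($i=1,2$) with $v_1\ne v_2$, $\beta$ is a simple edge-path from $v_1$ to $v_2$ in $\Gamma$, and $\gamma_1,\beta,\gamma_2$ do not have any common topological edges (pairwise). *)

theory Defs
  imports
    "HOL-Analysis.Analysis"
    "HOL-Algebra.Group_Action"
    "HOL-Algebra.Generated_Groups"
    "Graph_Theory.Arc_Walk"
begin

section \<open>Free groups of finite rank\<close>

text \<open>A word is a list of letters; \<open>(x, True)\<close> stands for \<open>x\<close> and \<open>(x, False)\<close> for its inverse.\<close>

definition word_value :: "('g, 'm) monoid_scheme \<Rightarrow> ('g \<times> bool) list \<Rightarrow> 'g" where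
  "word_value G w =
     foldr (\<lambda>(x, b) a. (if b then x else inv\<^bsub>G\<^esub> x) \<otimes>\<^bsub>G\<^esub> a) w \<one>\<^bsub>G\<^esub>"

definition reduced_word :: "('g \<times> bool) list \<Rightarrow> bool" where
  "reduced_word w \<longleftrightarrow> successively (\<lambda>(x, b) (y, c). x = y \<longrightarrow> b = c) w"

definition free_basis :: "('g, 'm) monoid_scheme \<Rightarrow> 'g set \<Rightarrow> bool" where
  "free_basis G X \<longleftrightarrow>
     X \<subseteq> carrier G \<and> generate G X = carrier G \<and>
     (\<forall>w. fst ` set w \<subseteq> X \<and> reduced_word w \<and> w \<noteq> [] \<longrightarrow> word_value G w \<noteq> \<one>\<^bsub>G\<^esub>)"

definition free_group_of_rank :: "('g, 'm) monoid_scheme \<Rightarrow> nat \<Rightarrow> bool" where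
  "free_group_of_rank G N \<longleftrightarrow>
     group G \<and> (\<exists>X. finite X \<and> card X = N \<and> free_basis G X)"

section \<open>Real trees\<close>

definition geodesic_from_to :: "'a metric \<Rightarrow> (real \<Rightarrow> 'a) \<Rightarrow> 'a \<Rightarrow> 'a \<Rightarrow> bool" where
  "geodesic_from_to T \<gamma> x y \<longleftrightarrow>
     \<gamma> \<in> {0..mdist T x y} \<rightarrow> mspace T \<and> \<gamma> 0 = x \<and> \<gamma> (mdist T x y) = y \<and>
     (\<forall>s \<in> {0..mdist T x y}. \<forall>t \<in> {0..mdist T x y}. mdist T (\<gamma> s) (\<gamma> t) = \<bar>s - t\<bar>)"

definition arc_from_to :: "'a metric \<Rightarrow> (real \<Rightarrow> 'a) \<Rightarrow> 'a \<Rightarrow> 'a \<Rightarrow> bool" where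
  "arc_from_to T p x y \<longleftrightarrow>
     pathin (mtopology_of T) p \<and> inj_on p {0..1} \<and> p 0 = x \<and> p 1 = y"

text \<open>Any two points are joined by a unique topological arc (as a subset), and that arc is a
  geodesic segment.  For \<open>x \<noteq> y\<close> a geodesic is, after rescaling, itself an arc.\<close>

definition real_tree :: "'a metric \<Rightarrow> bool" where
  "real_tree T \<longleftrightarrow>
     mspace T \<noteq> {} \<and>
     (\<forall>x \<in> mspace T. \<forall>y \<in> mspace T.
        (\<exists>\<gamma>. geodesic_from_to T \<gamma> x y) \<and>
        (\<forall>p q. arc_from_to T p x y \<and> arc_from_to T q x y \<longrightarrow> p ` {0..1} = q ` {0..1}))"

section \<open>Outer space\<close>

definition isometric_action :: "('g, 'm) monoid_scheme \<Rightarrow> 'a metric \<Rightarrow> ('g \<Rightarrow> 'a \<Rightarrow> 'a) \<Rightarrow> bool" where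
  "isometric_action G T \<phi> \<longleftrightarrow>
     group_action G (mspace T) \<phi> \<and>
     (\<forall>g \<in> carrier G. \<forall>x \<in> mspace T. \<forall>y \<in> mspace T. mdist T (\<phi> g x) (\<phi> g y) = mdist T x y)"

definition free_action :: "('g, 'm) monoid_scheme \<Rightarrow> 'a metric \<Rightarrow> ('g \<Rightarrow> 'a \<Rightarrow> 'a) \<Rightarrow> bool" where
  "free_action G T \<phi> \<longleftrightarrow> (\<forall>x \<in> mspace T. stabilizer G \<phi> x = {\<one>\<^bsub>G\<^esub>})"

text \<open>A discrete action is one whose orbits are discrete subspaces; for a free isometric action
  this amounts to every point having a neighbourhood disjoint from its nontrivial translates.\<close>

definition discrete_action :: "('g, 'm) monoid_scheme \<Rightarrow> 'a metric \<Rightarrow> ('g \<Rightarrow> 'a \<Rightarrow> 'a) \<Rightarrow> bool" where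
  "discrete_action G T \<phi> \<longleftrightarrow>
     (\<forall>x \<in> mspace T.
        subtopology (mtopology_of T) (orbit G \<phi> x) = discrete_topology (orbit G \<phi> x))"

text \<open>The subtrees of a real tree are its nonempty connected subsets.\<close>

definition minimal_action :: "('g, 'm) monoid_scheme \<Rightarrow> 'a metric \<Rightarrow> ('g \<Rightarrow> 'a \<Rightarrow> 'a) \<Rightarrow> bool" where
  "minimal_action G T \<phi> \<longleftrightarrow>
     (\<forall>S. connectedin (mtopology_of T) S \<and> S \<noteq> {} \<and> (\<forall>g \<in> carrier G. \<phi> g ` S \<subseteq> S)
        \<longrightarrow> S = mspace T)"

definition outer_space_tree :: "('g, 'm) monoid_scheme \<Rightarrow> 'a metric \<Rightarrow> ('g \<Rightarrow> 'a \<Rightarrow> 'a) \<Rightarrow> bool" where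
  "outer_space_tree G T \<phi> \<longleftrightarrow>
     real_tree T \<and> isometric_action G T \<phi> \<and> minimal_action G T \<phi> \<and>
     free_action G T \<phi> \<and> discrete_action G T \<phi>"

definition equal_in_outer_space ::
  "('g, 'm) monoid_scheme \<Rightarrow> 'a metric \<Rightarrow> ('g \<Rightarrow> 'a \<Rightarrow> 'a) \<Rightarrow> 'b metric \<Rightarrow> ('g \<Rightarrow> 'b \<Rightarrow> 'b) \<Rightarrow> bool" where
  "equal_in_outer_space G T \<phi> T' \<phi>' \<longleftrightarrow>
     (\<exists>h. bij_betw h (mspace T) (mspace T') \<and>
          (\<forall>x \<in> mspace T. \<forall>y \<in> mspace T. mdist T' (h x) (h y) = mdist T x y) \<and>
          (\<forall>g \<in> carrier G. \<forall>x \<in> mspace T. h (\<phi> g x) = \<phi>' g (h x)))"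

text \<open>On a real tree the infimum is attained, so it is the minimal displacement.\<close>

definition translation_length :: "'a metric \<Rightarrow> ('g \<Rightarrow> 'a \<Rightarrow> 'a) \<Rightarrow> 'g \<Rightarrow> real" where
  "translation_length T \<phi> g = (INF x \<in> mspace T. mdist T x (\<phi> g x))"

section \<open>The quotient graph\<close>

text \<open>The vertices of the tree are its branch points, i.e. the points of degree at least 3.  As a
  free action is a covering, these are the lifts of the vertices of the quotient graph in the
  structure with all vertices of degree at least 3.\<close>

definition tree_vertices :: "'a metric \<Rightarrow> 'a set" where
  "tree_vertices T =
     {x \<in> mspace T. \<exists>\<C>. card \<C> = 3 \<and>
        \<C> \<subseteq> connected_components_of (subtopology (mtopology_of T) (mspace T - {x}))}"

text \<open>An oriented edge of the tree is given by its endpoints: two distinct vertices with no vertex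
  strictly between them.\<close>

definition tree_arcs :: "'a metric \<Rightarrow> ('a \<times> 'a) set" where
  "tree_arcs T =
     {(x, y). x \<in> tree_vertices T \<and> y \<in> tree_vertices T \<and> x \<noteq> y \<and>
        (\<forall>z \<in> tree_vertices T. mdist T x z + mdist T z y = mdist T x y \<longrightarrow> z = x \<or> z = y)}"

definition arc_orbit :: "('g, 'm) monoid_scheme \<Rightarrow> ('g \<Rightarrow> 'a \<Rightarrow> 'a) \<Rightarrow> 'a \<times> 'a \<Rightarrow> ('a \<times> 'a) set" where
  "arc_orbit G \<phi> e = (\<lambda>g. map_prod (\<phi> g) (\<phi> g) e) ` carrier G"

text \<open>The quotient graph has the orbits of vertices as vertices and the orbits of oriented edges as
  arcs.  The two orientations of a topological edge are the arcs \<open>a\<close> and \<open>a\<inverse>\<close> (relational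
  converse).  The tail of an arc, the set of first components of an orbit of pairs, is
  again an orbit of vertices; likewise for the head.\<close>

definition quotient_graph ::
  "('g, 'm) monoid_scheme \<Rightarrow> 'a metric \<Rightarrow> ('g \<Rightarrow> 'a \<Rightarrow> 'a) \<Rightarrow> ('a set, ('a \<times> 'a) set) pre_digraph" where
  "quotient_graph G T \<phi> =
     \<lparr>verts = orbit G \<phi> ` tree_vertices T,
      arcs = arc_orbit G \<phi> ` tree_arcs T,
      tail = (\<lambda>a. fst ` a),
      head = (\<lambda>a. snd ` a)\<rparr>"

definition topological_edge :: "('a \<times> 'a) set \<Rightarrow> ('a \<times> 'a) set set" where
  "topological_edge a = {a, a\<inverse>}"

definition topological_edges :: "('a \<times> 'a) set list \<Rightarrow> ('a \<times> 'a) set set set" where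
  "topological_edges p = topological_edge ` set p"

definition reverse_path :: "('a \<times> 'a) set list \<Rightarrow> ('a \<times> 'a) set list" where
  "reverse_path p = rev (map converse p)"

section \<open>Almost simple curves\<close>

text \<open>Without the requirement that no topological edge is repeated, the backtracking path
  \<open>[a, a\<inverse>]\<close> along a non-loop edge would count as a cycle of the directed graph.\<close>

definition simple_circuit_at ::
  "('a set, ('a \<times> 'a) set) pre_digraph \<Rightarrow> 'a set \<Rightarrow> ('a \<times> 'a) set list \<Rightarrow> bool" where
  "simple_circuit_at \<Gamma> v p \<longleftrightarrow>
     pre_digraph.awalk \<Gamma> v p v \<and> p \<noteq> [] \<and>
     distinct (tl (pre_digraph.awalk_verts \<Gamma> v p)) \<and> distinct (map topological_edge p)"

definition figure_eight_curve ::
  "('a set, ('a \<times> 'a) set) pre_digraph \<Rightarrow> ('a \<times> 'a) set list \<Rightarrow> bool" where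
  "figure_eight_curve \<Gamma> p \<longleftrightarrow>
     (\<exists>v p1 p2. p = p1 @ p2 \<and> simple_circuit_at \<Gamma> v p1 \<and> simple_circuit_at \<Gamma> v p2 \<and>
        topological_edges p1 \<inter> topological_edges p2 = {})"

definition barbell_curve ::
  "('a set, ('a \<times> 'a) set) pre_digraph \<Rightarrow> ('a \<times> 'a) set list \<Rightarrow> bool" where
  "barbell_curve \<Gamma> p \<longleftrightarrow>
     (\<exists>v1 v2 p1 b p2. p = p1 @ b @ p2 @ reverse_path b \<and> v1 \<noteq> v2 \<and>
        simple_circuit_at \<Gamma> v1 p1 \<and> simple_circuit_at \<Gamma> v2 p2 \<and>
        pre_digraph.apath \<Gamma> v1 b v2 \<and>
        topological_edges p1 \<inter> topological_edges b = {} \<and>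
        topological_edges b \<inter> topological_edges p2 = {} \<and>
        topological_edges p1 \<inter> topological_edges p2 = {})"

definition almost_simple_curve ::
  "('a set, ('a \<times> 'a) set) pre_digraph \<Rightarrow> ('a \<times> 'a) set list \<Rightarrow> bool" where
  "almost_simple_curve \<Gamma> p \<longleftrightarrow>
     (\<exists>v. simple_circuit_at \<Gamma> v p) \<or> figure_eight_curve \<Gamma> p \<or> barbell_curve \<Gamma> p"

text \<open>The identification of the group with the fundamental group of the quotient is the one of
  covering theory: the elements corresponding to (the free homotopy class of) a closed edge-path
  are those \<open>g\<close> for which some lift of the path to the tree runs from a vertex \<open>x\<close> to \<open>g x\<close>.
  A lift is given by the list \<open>xs\<close> of its successive vertices.\<close>

definition lift_of_path :: "('a \<times> 'a) set list \<Rightarrow> 'a list \<Rightarrow> bool" where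
  "lift_of_path p xs \<longleftrightarrow>
     length xs = Suc (length p) \<and> (\<forall>i < length p. (xs ! i, xs ! Suc i) \<in> p ! i)"

definition represented_by :: "('g \<Rightarrow> 'a \<Rightarrow> 'a) \<Rightarrow> 'g \<Rightarrow> ('a \<times> 'a) set list \<Rightarrow> bool" where
  "represented_by \<phi> g p \<longleftrightarrow> (\<exists>xs. lift_of_path p xs \<and> last xs = \<phi> g (hd xs))"

definition almost_simple_elements ::
  "('g, 'm) monoid_scheme \<Rightarrow> 'a metric \<Rightarrow> ('g \<Rightarrow> 'a \<Rightarrow> 'a) \<Rightarrow> 'g set" where
  "almost_simple_elements G T \<phi> =
     {g \<in> carrier G. \<exists>p. almost_simple_curve (quotient_graph G T \<phi>) p \<and> represented_by \<phi> g p}"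

definition conjugate_in :: "('g, 'm) monoid_scheme \<Rightarrow> 'g \<Rightarrow> 'g \<Rightarrow> bool" where
  "conjugate_in G g h \<longleftrightarrow> (\<exists>k \<in> carrier G. h = k \<otimes>\<^bsub>G\<^esub> g \<otimes>\<^bsub>G\<^esub> inv\<^bsub>G\<^esub> k)"

text \<open>The set of almost simple curves contains exactly one representative of each relevant conjugacy
  class.  As it depends on the choice of representatives, it is rendered as a predicate.\<close>

definition almost_simple_set ::
  "('g, 'm) monoid_scheme \<Rightarrow> 'a metric \<Rightarrow> ('g \<Rightarrow> 'a \<Rightarrow> 'a) \<Rightarrow> 'g set \<Rightarrow> bool" where
  "almost_simple_set G T \<phi> U \<longleftrightarrow>
     U \<subseteq> almost_simple_elements G T \<phi> \<and>
     (\<forall>g \<in> almost_simple_elements G T \<phi>. \<exists>!u. u \<in> U \<and> conjugate_in G g u)"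

end

(* The Lipschitz constant of an optimal equivariant map from T to T' is witnessed by an almost simple
   curve: among the maps of minimal stretch take one with the fewest orbits of maximally stretched
   edges. Relaxing images of vertices shows that these edges leave every vertex they meet in at least
   two directions of T', so one can walk along them without folding, and the walk closes up to an
   almost simple curve. As the curve has the same length in both trees, the map is 1-Lipschitz.
   A 1-Lipschitz map can neither shorten an edge nor fold a turn of an almost simple curve whose
   length it preserves. Every turn of T/G is crossed by an almost simple curve, hence the map is a
   local isometry on the vertices and so a global one; minimality extends it to T and makes it onto. *)

theory Submission
  imports Defs
begin

section \<open>Betweenness in trees\<close>

text \<open>Maps are recorded on branch points only, with the linear extension over the arcs
  understood. Vertices and arcs form finitely many orbits, so stretch is controlled by finitely many
  inequalities, and a map of minimal stretch arises as the limit of a minimising sequence. Such a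
  sequence cannot drift away: points that all generators move a bounded distance form a relatively
  compact set, because the group has trivial centre. This is one of the two uses of rank at least 2;
  the other is that the tree is not a line and so has branch points. The walk along stretched edges
  may close up illegally. What saves it is that "the images leave in a common direction" is an
  equivalence relation on the arcs at a vertex. Where a walk runs into a circuit away from its base,
  the two ways round lie in different classes, so one of them can be taken. A circuit that closes
  illegally has both its ends in one class, so an arc of another class continues it in either
  orientation; this is where figure eights and barbells come from.\<close>

locale rtree = Metric_space M d for M :: "'a set" and d +
  assumes nonempty: "M \<noteq> {}"
    and segment_point: "\<lbrakk>x \<in> M; y \<in> M; 0 \<le> t; t \<le> d x y\<rbrakk> \<Longrightarrow> \<exists>p \<in> M. d x p = t \<and> d p y = d x y - t"
    and segment_unique: "\<lbrakk>x \<in> M; y \<in> M; p \<in> M; q \<in> M; d x y = d x p + d p y; d x y = d x q + d q y; d x p = d x q\<rbrakk> \<Longrightarrow> p = q"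
    and tripod: "\<lbrakk>x \<in> M; y \<in> M; z \<in> M\<rbrakk> \<Longrightarrow>
      \<exists>p \<in> M. d x y = d x p + d p y \<and> d x z = d x p + d p z \<and> d y z = d y p + d p z"
begin

text \<open>Membership of \<open>y\<close> in the segment from \<open>x\<close> to \<open>z\<close>.
  The carrier conditions are built in so that one hypothesis also records that all three points lie
  in \<open>M\<close>.\<close>

definition btw :: "'a \<Rightarrow> 'a \<Rightarrow> 'a \<Rightarrow> bool" where
  "btw x y z \<longleftrightarrow> x \<in> M \<and> y \<in> M \<and> z \<in> M \<and> d x z = d x y + d y z"

lemma btw_in: "btw x y z \<Longrightarrow> x \<in> M" "btw x y z \<Longrightarrow> y \<in> M" "btw x y z \<Longrightarrow> z \<in> M"
  by (auto simp: btw_def)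

lemma btw_dist: "btw x y z \<Longrightarrow> d x z = d x y + d y z"
  by (auto simp: btw_def)

lemma btw_sym: "btw x y z \<Longrightarrow> btw z y x"
  by (auto simp: btw_def commute)

lemma btw_self [simp]: "x \<in> M \<Longrightarrow> y \<in> M \<Longrightarrow> btw x x y" "x \<in> M \<Longrightarrow> y \<in> M \<Longrightarrow> btw x y y"
  by (auto simp: btw_def)

lemma btw_same_ends: "btw x y x \<Longrightarrow> y = x"
proof -
  assume *: "btw x y x"
  then have "d x x = d x y + d y x" and xy: "x \<in> M" "y \<in> M" by (auto simp: btw_def)
  then have "d x y = 0" using commute[of x y] by simp
  with xy show "y = x" by simp
qed

lemma btw_antisym: "btw x y z \<Longrightarrow> btw x z y \<Longrightarrow> y = z"
  using nonneg[of y z] nonneg[of z y] zero[of y z] unfolding btw_def by (auto simp: commute)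

lemma btw_unique: "btw x p y \<Longrightarrow> btw x q y \<Longrightarrow> d x p = d x q \<Longrightarrow> p = q"
  unfolding btw_def using segment_unique by blast

lemma btw_point:
  assumes "x \<in> M" "y \<in> M" "0 \<le> t" "t \<le> d x y"
  obtains p where "btw x p y" "d x p = t" "d p y = d x y - t"
proof -
  obtain p where "p \<in> M" "d x p = t" "d p y = d x y - t" using segment_point[OF assms] by auto
  with that assms show thesis unfolding btw_def by auto
qed

lemma median:
  assumes "x \<in> M" "y \<in> M" "z \<in> M"
  obtains p where "btw x p y" "btw x p z" "btw y p z"
  using tripod[OF assms] assms unfolding btw_def by auto

lemma btw_inner1: "btw x p y \<Longrightarrow> btw x q p \<Longrightarrow> btw x q y"
  using triangle[of q p y] triangle[of x q y] unfolding btw_def by (auto simp: commute)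

lemma btw_inner2: "btw x p y \<Longrightarrow> btw x q p \<Longrightarrow> btw q p y"
  using triangle[of q p y] triangle[of x q y] unfolding btw_def by (auto simp: commute)

lemma btw_order: "btw x p y \<Longrightarrow> btw x q y \<Longrightarrow> d x p \<le> d x q \<Longrightarrow> btw x p q"
proof -
  assume a: "btw x p y" "btw x q y" "d x p \<le> d x q"
  then have in_M: "x \<in> M" "y \<in> M" "p \<in> M" "q \<in> M" by (auto simp: btw_def)
  obtain p' where p': "btw x p' q" "d x p' = d x p" "d p' q = d x q - d x p"
    using btw_point[OF in_M(1) in_M(4) nonneg a(3)] by metis
  have "btw x p' y" using btw_inner1[OF a(2) p'(1)] .
  then have "p' = p" using btw_unique a(1) p'(2) by blast
  with p' show ?thesis by simp
qed

lemma btw_total: "btw x p y \<Longrightarrow> btw x q y \<Longrightarrow> btw x p q \<or> btw x q p"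
  using btw_order linear by metis

text \<open>\<open>v\<close> and \<open>w\<close> lie on opposite sides of \<open>x\<close>, so
  \<open>z\<close> can share a side with at most one of them. The median of \<open>v\<close>,
  \<open>w\<close>, \<open>z\<close> decides: \<open>x\<close> comes before or after it on the
  segment.\<close>

lemma btw_split:
  assumes "btw v x w" "z \<in> M"
  shows "btw z x v \<or> btw z x w"
proof -
  have in_M: "v \<in> M" "w \<in> M" "x \<in> M" using assms by (auto simp: btw_def)
  obtain p where p: "btw v p w" "btw v p z" "btw w p z"
    using median[OF in_M(1,2) assms(2)] .
  from btw_total[OF assms(1) p(1)] show ?thesis
  proof
    assume "btw v x p"
    then have "btw v x z" using btw_inner1[OF p(2)] by blast
    then show ?thesis by (simp add: btw_sym)
  next
    assume "btw v p x"
    then have "btw w x p" using btw_inner2[OF assms(1)] btw_sym by blast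
    then have "btw w x z" using btw_inner1[OF p(3)] by blast
    then show ?thesis by (simp add: btw_sym)
  qed
qed

text \<open>Two segments that overlap in a nondegenerate piece join to a segment: by
  \<open>btw_split\<close> the only alternative would put \<open>c\<close> between \<open>a\<close>
  and \<open>b\<close>, forcing \<open>b = c\<close>. This is the local-to-global principle of the
  whole development.\<close>

lemma btw_overlap:
  assumes "btw a b c" "btw b c e" "b \<noteq> c"
  shows "btw a b e" "btw a c e"
proof -
  have in_M: "a \<in> M" "b \<in> M" "c \<in> M" "e \<in> M" using assms by (auto simp: btw_def)
  from btw_split[OF assms(2) in_M(1)] show *: "btw a c e"
  proof
    assume "btw a c b"
    with assms(1) have "b = c" using btw_antisym by blast
    with assms(3) show ?thesis by simp
  qed
  show "btw a b e" using btw_inner1[OF * assms(1)] .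
qed

text \<open>Both triangle inequalities bound \<open>d z x\<close> from below, and
  \<open>btw_split\<close> makes one of them sharp. Thus distances to a point of a segment depend
  only on distances to its ends, which later allows an isometry to be extended from vertices to all
  points.\<close>

lemma dist_to_segment_point:
  assumes "btw v x w" "z \<in> M"
  shows "d z x = max (d z v - d v x) (d z w - d x w)"
proof -
  have in_M: "v \<in> M" "w \<in> M" "x \<in> M" using assms by (auto simp: btw_def)
  have "d z v \<le> d z x + d v x" "d z w \<le> d z x + d x w"
    using triangle[of z x v] triangle[of z x w] in_M assms by (auto simp: commute)
  moreover have "d z v = d z x + d v x \<or> d z w = d z x + d x w"
    using btw_split[OF assms] unfolding btw_def by (auto simp: commute)
  ultimately show ?thesis by auto
qed

text \<open>A path from \<open>y\<close> to \<open>y'\<close> through \<open>x\<close> would be at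
  least as long as \<open>d y x\<close>; so a small ball about \<open>y\<close> lies entirely in one
  direction at \<open>x\<close>.\<close>

lemma btw_near:
  assumes "y \<in> M" "y' \<in> M" "d y y' < d y x"
  shows "btw a x y' = btw a x y"
proof -
  have *: "\<not> btw y x y'" using assms(3) nonneg[of x y'] btw_dist[of y x y'] by linarith
  show ?thesis
  proof
    assume "btw a x y'"
    from btw_split[OF this assms(1)] have "btw y x a" using * by simp
    then show "btw a x y" by (rule btw_sym)
  next
    assume "btw a x y"
    from btw_split[OF this assms(2)] have "btw y' x a" using * btw_sym[of y' x y] by metis
    then show "btw a x y'" by (rule btw_sym)
  qed
qed

text \<open>If \<open>v\<close> does not separate \<open>a\<close> from \<open>b\<close>, the two
  segments from \<open>v\<close> share an initial piece, and \<open>r\<close> is its length: the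
  distance from \<open>v\<close> to the median.\<close>

lemma not_btw_common:
  assumes "a \<in> M" "v \<in> M" "b \<in> M" "\<not> btw a v b"
  obtains r where "r > 0" "\<And>q t. btw v q a \<Longrightarrow> d v q \<le> r \<Longrightarrow> btw v q b"
proof -
  obtain p where p: "btw v p a" "btw v p b" "btw a p b"
    using median[OF assms(2,1,3)] .
  have "p \<noteq> v" using p(3) assms(4) by auto
  then have "d v p > 0" using p(1) assms(2) by (simp add: btw_def)
  moreover have "btw v q b" if "btw v q a" "d v q \<le> d v p" for q
    using btw_order[OF that(1) p(1) that(2)] btw_inner1[OF p(2)] by blast
  ultimately show thesis using that by blast
qed

text \<open>Leaving \<open>v\<close> in a common direction is transitive, by the contrapositive of
  \<open>btw_split\<close>. This becomes the transitivity of gates.\<close>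

lemma not_btw_trans:
  assumes "\<not> btw a v b" "\<not> btw b v c" "b \<in> M"
  shows "\<not> btw a v c"
  using btw_split[OF _ assms(3)] assms btw_sym by blast

text \<open>In a tree a local geodesic is a geodesic: the induction extends the segment from
  \<open>x 0\<close> by one step through \<open>btw_overlap\<close>, which is why the steps must be
  nondegenerate.\<close>

lemma chain_additive:
  assumes "\<And>i. btw (x i) (x (Suc i)) (x (Suc (Suc i)))" "\<And>i. x i \<noteq> x (Suc i)"
  shows "d (x 0) (x n) = (\<Sum>i<n. d (x i) (x (Suc i)))"
proof -
  have "btw (x 0) (x n) (x (Suc n))" for n
  proof (induction n)
    case 0
    then show ?case using assms(1)[of 0] by (auto simp: btw_def)
  next
    case (Suc n)
    show ?case using btw_overlap(2)[OF Suc.IH assms(1) assms(2)] .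
  qed
  then have "d (x 0) (x (Suc n)) = d (x 0) (x n) + d (x n) (x (Suc n))" for n
    by (simp add: btw_def)
  moreover have "x 0 \<in> M" using assms(1)[of 0] by (simp add: btw_def)
  ultimately show ?thesis by (induction n) auto
qed

lemma dist_chain_le:
  assumes "\<And>i. x i \<in> M"
  shows "d (x k) (x (k + n)) \<le> (\<Sum>i<n. d (x (k + i)) (x (Suc (k + i))))"
proof (induction n)
  case 0
  then show ?case using assms by simp
next
  case (Suc n)
  then show ?case using triangle[of "x k" "x (k + n)" "x (k + Suc n)"] assms by simp
qed

text \<open>Degree at least 3 in metric terms: three points in pairwise different directions at
  \<open>v\<close>. That this agrees with counting complementary components is
  \<open>tree_vertices_eq\<close>.\<close>

definition branch_points :: "'a set" where
  "branch_points = {v. \<exists>a b c. a \<noteq> v \<and> b \<noteq> v \<and> c \<noteq> v \<and> btw a v b \<and> btw a v c \<and> btw b v c}"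

lemma branch_pointsE:
  assumes "v \<in> branch_points"
  obtains a b c where "a \<noteq> v" "b \<noteq> v" "c \<noteq> v" "btw a v b" "btw a v c" "btw b v c"
proof -
  have "\<exists>a b c. a \<noteq> v \<and> b \<noteq> v \<and> c \<noteq> v \<and> btw a v b \<and> btw a v c \<and> btw b v c"
    using assms by (simp only: branch_points_def mem_Collect_eq)
  then show thesis using that by (elim exE conjE)
qed

lemma branch_points_in: "branch_points \<subseteq> M"
  unfolding branch_points_def by (auto simp: btw_def)

definition branch_arcs :: "('a \<times> 'a) set" where
  "branch_arcs = {(x, y). x \<in> branch_points \<and> y \<in> branch_points \<and> x \<noteq> y \<and>
     (\<forall>z \<in> branch_points. btw x z y \<longrightarrow> z = x \<or> z = y)}"

lemma branch_arcs_sym: "(x, y) \<in> branch_arcs \<Longrightarrow> (y, x) \<in> branch_arcs"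
  unfolding branch_arcs_def using btw_sym by auto

lemma branch_arcsD:
  assumes "(x, y) \<in> branch_arcs"
  shows "x \<in> branch_points" "y \<in> branch_points" "x \<noteq> y" "x \<in> M" "y \<in> M"
    "\<And>z. z \<in> branch_points \<Longrightarrow> btw x z y \<Longrightarrow> z = x \<or> z = y" "d x y > 0"
proof -
  show *: "x \<in> branch_points" "y \<in> branch_points" "x \<noteq> y"
    "\<And>z. z \<in> branch_points \<Longrightarrow> btw x z y \<Longrightarrow> z = x \<or> z = y"
    using assms unfolding branch_arcs_def by auto
  then show "x \<in> M" "y \<in> M" using branch_points_in by auto
  then show "d x y > 0" using * by simp
qed

lemma median_branch_point:
  assumes "btw a p b" "btw a p c" "btw b p c" "p \<noteq> a" "p \<noteq> b" "p \<noteq> c"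
  shows "p \<in> branch_points"
  unfolding branch_points_def using assms by (metis (mono_tags, lifting) mem_Collect_eq)

lemma median_unique:
  assumes "btw a p b" "btw a p c" "btw b p c" "btw a q b" "btw a q c" "btw b q c"
  shows "p = q"
  using btw_unique[OF assms(1) assms(4)] assms unfolding btw_def by (auto simp: commute)

text \<open>Two arcs at \<open>v\<close> cannot share an initial piece, since the point where they
  part would be a branch point in the interior of one of them, or an end of one in the interior of
  the other.\<close>

lemma arc_turn:
  assumes "(v, a) \<in> branch_arcs" "(v, b) \<in> branch_arcs" "a \<noteq> b"
  shows "btw a v b"
proof -
  note A = branch_arcsD[OF assms(1)] and B = branch_arcsD[OF assms(2)]
  obtain p where p: "btw v p a" "btw v p b" "btw a p b" using median A B by metis
  have "p = v \<or> p = a \<or> p = b"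
    using median_branch_point[OF p] A(6)[OF _ p(1)] by blast
  then consider "p = v" | "p = a" "p \<noteq> v" | "p = b" "p \<noteq> v" by blast
  then show ?thesis
  proof cases
    case 1 then show ?thesis using p by simp
  next
    case 2
    then show ?thesis using B(6)[OF A(2)] p assms A by auto
  next
    case 3
    then show ?thesis using A(6)[OF B(2)] p assms B by auto
  qed
qed

end

section \<open>From unique arcs to betweenness\<close>

lemma lipschitz_pathin:
  assumes "f \<in> {0..L} \<rightarrow> mspace T" "L \<ge> 0"
    and "\<And>s t. 0 \<le> s \<Longrightarrow> s \<le> t \<Longrightarrow> t \<le> L \<Longrightarrow> mdist T (f s) (f t) \<le> t - s"
  shows "pathin (mtopology_of T) (\<lambda>s. f (s * L))"
proof -
  have *: "0 \<le> s * L" "s * L \<le> L" if "s \<in> {0..1}" for s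
    using that assms(2) mult_right_mono[of s 1 L] by auto
  have le': "mdist T (f (s * L)) (f (t * L)) \<le> L * \<bar>s - t\<bar>"
    if "s \<in> {0..1}" "t \<in> {0..1}" "s \<le> t" for s t
  proof -
    have "s * L \<le> t * L" using that(3) assms(2) by (rule mult_right_mono)
    then have "mdist T (f (s * L)) (f (t * L)) \<le> t * L - s * L"
      by (rule assms(3)[OF *(1)[OF that(1)] _ *(2)[OF that(2)]])
    also have "\<dots> = L * \<bar>s - t\<bar>" using that(3) by (simp add: algebra_simps)
    finally show ?thesis .
  qed
  have le: "mdist T (f (s * L)) (f (t * L)) \<le> L * \<bar>s - t\<bar>"
    if "s \<in> {0..1}" "t \<in> {0..1}" for s t
  proof (cases "s \<le> t")
    case True
    with that show ?thesis by (rule le')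
  next
    case False
    then have "t \<le> s" by simp
    from le'[OF that(2,1) this] show ?thesis by (simp only: mdist_commute abs_minus_commute)
  qed
  have "f (s * L) \<in> mspace T" if "s \<in> {0..1}" for s
    using assms(1) *[OF that] by auto
  then have "Lipschitz_continuous_map (submetric euclidean_metric {0..1}) T (\<lambda>s. f (s * L))"
    unfolding Lipschitz_continuous_map_def
    using le by (intro conjI exI[of _ L] ballI funcsetI) (simp_all add: dist_real_def)
  then have "continuous_map (mtopology_of (submetric euclidean_metric {0..1})) (mtopology_of T)
      (\<lambda>s. f (s * L))"
    by (rule Lipschitz_continuous_imp_continuous_map)
  then show ?thesis
    unfolding pathin_def by (simp add: mtopology_of_submetric)
qed

lemma geodesic_from_toD:
  assumes "geodesic_from_to T \<gamma> x y"
  shows "\<And>t. 0 \<le> t \<Longrightarrow> t \<le> mdist T x y \<Longrightarrow> \<gamma> t \<in> mspace T" "\<gamma> 0 = x" "\<gamma> (mdist T x y) = y"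
    "\<And>s t. 0 \<le> s \<Longrightarrow> s \<le> t \<Longrightarrow> t \<le> mdist T x y \<Longrightarrow> mdist T (\<gamma> s) (\<gamma> t) = t - s"
    "\<And>t. 0 \<le> t \<Longrightarrow> t \<le> mdist T x y \<Longrightarrow> mdist T x (\<gamma> t) = t"
    "\<And>t. 0 \<le> t \<Longrightarrow> t \<le> mdist T x y \<Longrightarrow> mdist T (\<gamma> t) y = mdist T x y - t"
proof -
  note * = assms[unfolded geodesic_from_to_def]
  show "\<gamma> t \<in> mspace T" if "0 \<le> t" "t \<le> mdist T x y" for t using * that by auto
  show ends: "\<gamma> 0 = x" "\<gamma> (mdist T x y) = y" using * by auto
  show iso: "mdist T (\<gamma> s) (\<gamma> t) = t - s" if "0 \<le> s" "s \<le> t" "t \<le> mdist T x y" for s t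
    using * that by auto
  show "mdist T x (\<gamma> t) = t" if "0 \<le> t" "t \<le> mdist T x y" for t
    using iso[of 0 t] that ends by simp
  show "mdist T (\<gamma> t) y = mdist T x y - t" if "0 \<le> t" "t \<le> mdist T x y" for t
    using iso[of t "mdist T x y"] that ends by simp
qed

text \<open>Unique arcs are postulated for topological arcs over the unit interval; rescaling makes
  every injective 1-Lipschitz path eligible.\<close>

lemma lipschitz_arc:
  assumes "f \<in> {0..L} \<rightarrow> mspace T" "L > 0" "inj_on f {0..L}" "f 0 = x" "f L = y"
    and "\<And>s t. 0 \<le> s \<Longrightarrow> s \<le> t \<Longrightarrow> t \<le> L \<Longrightarrow> mdist T (f s) (f t) \<le> t - s"
  shows "arc_from_to T (\<lambda>s. f (s * L)) x y" "(\<lambda>s. f (s * L)) ` {0..1} = f ` {0..L}"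
proof -
  have "inj_on (\<lambda>s. f (s * L)) {0..1}"
  proof (rule inj_onI)
    fix s t assume st: "s \<in> {0..1}" "t \<in> {0..1}" "f (s * L) = f (t * L)"
    then have "s * L \<in> {0..L}" "t * L \<in> {0..L}"
      using assms(2) by (simp_all add: mult_left_le_one_le)
    then have "s * L = t * L" using assms(3) st(3) by (meson inj_onD)
    then show "s = t" using assms(2) by simp
  qed
  then show "arc_from_to T (\<lambda>s. f (s * L)) x y"
    unfolding arc_from_to_def using lipschitz_pathin[of f L T] assms by auto
  have "(\<lambda>s. s * L) ` {0..1} = {0..L}"
  proof
    show "(\<lambda>s. s * L) ` {0..1} \<subseteq> {0..L}"
      using assms(2) by (auto simp: mult_left_le_one_le)
    show "{0..L} \<subseteq> (\<lambda>s. s * L) ` {0..1}"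
    proof
      fix t assume "t \<in> {0..L}"
      then show "t \<in> (\<lambda>s. s * L) ` {0..1}"
        using assms(2) by (intro image_eqI[of _ _ "t / L"]) auto
    qed
  qed
  then show "(\<lambda>s. f (s * L)) ` {0..1} = f ` {0..L}"
    by (metis image_image)
qed

context
  fixes T :: "'a metric"
  assumes tree: "real_tree T"
begin

lemma ex_geodesic:
  assumes "x \<in> mspace T" "y \<in> mspace T"
  obtains \<gamma> where "geodesic_from_to T \<gamma> x y"
  using tree assms unfolding real_tree_def by blast

text \<open>The geodesic, rescaled, is itself an arc with the same ends, so uniqueness identifies
  the images. The point is that \<open>f\<close> need only be injective and 1-Lipschitz, not
  length-minimising.\<close>

lemma lipschitz_arc_through_geodesic:
  assumes "geodesic_from_to T \<gamma> x y" "x \<in> mspace T" "y \<in> mspace T" "x \<noteq> y"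
    and "f \<in> {0..L} \<rightarrow> mspace T" "L > 0" "inj_on f {0..L}" "f 0 = x" "f L = y"
    and "\<And>s t. 0 \<le> s \<Longrightarrow> s \<le> t \<Longrightarrow> t \<le> L \<Longrightarrow> mdist T (f s) (f t) \<le> t - s"
  shows "f ` {0..L} = \<gamma> ` {0..mdist T x y}"
proof -
  note g = geodesic_from_toD[OF assms(1)]
  have pos: "mdist T x y > 0"
    using assms(2-4) by (metis mdist_nonneg mdist_zero order_le_less)
  have "inj_on \<gamma> {0..mdist T x y}"
    by (rule inj_onI) (metis atLeastAtMost_iff g(5))
  then have "arc_from_to T (\<lambda>s. \<gamma> (s * mdist T x y)) x y"
    "(\<lambda>s. \<gamma> (s * mdist T x y)) ` {0..1} = \<gamma> ` {0..mdist T x y}"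
    using lipschitz_arc[of \<gamma> "mdist T x y" T x y] g pos by auto
  moreover note lipschitz_arc[OF assms(5-10)]
  ultimately show ?thesis
    using tree assms(2,3) unfolding real_tree_def by metis
qed

lemma geodesic_point_unique:
  assumes "geodesic_from_to T \<gamma> x y" "geodesic_from_to T \<delta> x y" "x \<in> mspace T" "y \<in> mspace T"
    and "0 \<le> t" "t \<le> mdist T x y"
  shows "\<gamma> t = \<delta> t"
proof (cases "x = y")
  case True
  then show ?thesis using assms geodesic_from_toD(2)[OF assms(1)] geodesic_from_toD(2)[OF assms(2)]
    by (metis mdist_zero order_antisym)
next
  case False
  note g = geodesic_from_toD[OF assms(1)] and h = geodesic_from_toD[OF assms(2)]
  have pos: "mdist T x y > 0"
    using assms(3,4) False by (metis mdist_nonneg mdist_zero order_le_less)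
  have "inj_on \<gamma> {0..mdist T x y}"
    by (rule inj_onI) (metis atLeastAtMost_iff g(5))
  then have "\<gamma> ` {0..mdist T x y} = \<delta> ` {0..mdist T x y}"
    using lipschitz_arc_through_geodesic[OF assms(2,3,4) False, of \<gamma> "mdist T x y"] g pos by auto
  then obtain s where s: "s \<in> {0..mdist T x y}" "\<gamma> t = \<delta> s"
    using assms(5,6) by (metis atLeastAtMost_iff imageE imageI)
  then have "t = s" using g(5)[OF assms(5,6)] h(5)[of s] by simp
  then show ?thesis using s by simp
qed

lemma geodesic_through_point:
  assumes "x \<in> mspace T" "y \<in> mspace T" "p \<in> mspace T" "mdist T x y = mdist T x p + mdist T p y"
  obtains \<gamma> where "geodesic_from_to T \<gamma> x y" "\<gamma> (mdist T x p) = p"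
proof -
  obtain \<alpha> where \<alpha>: "geodesic_from_to T \<alpha> x p" using ex_geodesic assms by blast
  obtain \<beta> where \<beta>: "geodesic_from_to T \<beta> p y" using ex_geodesic assms by blast
  note A = geodesic_from_toD[OF \<alpha>] and B = geodesic_from_toD[OF \<beta>]
  define \<gamma> where "\<gamma> t = (if t \<le> mdist T x p then \<alpha> t else \<beta> (t - mdist T x p))" for t
  let ?a = "mdist T x p" and ?L = "mdist T x y"
  have in_M: "\<gamma> t \<in> mspace T" if "0 \<le> t" "t \<le> ?L" for t
    unfolding \<gamma>_def using A(1)[of t] B(1)[of "t - ?a"] that assms(4) by auto
  have iso: "mdist T (\<gamma> s) (\<gamma> t) = t - s" if st: "0 \<le> s" "s \<le> t" "t \<le> ?L" for s t
  proof -
    consider "t \<le> ?a" | "s > ?a" | "s \<le> ?a" "t > ?a" by linarith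
    then show ?thesis
    proof cases
      case 1 then show ?thesis unfolding \<gamma>_def using A(4)[of s t] st by auto
    next
      case 2
      then show ?thesis unfolding \<gamma>_def using B(4)[of "s - ?a" "t - ?a"] st assms(4) by auto
    next
      case 3
      have in_M': "\<alpha> s \<in> mspace T" "\<beta> (t - ?a) \<in> mspace T"
        using A(1)[of s] B(1)[of "t - ?a"] 3 st assms(4) by auto
      have "mdist T (\<alpha> s) (\<beta> (t - ?a)) \<le> mdist T (\<alpha> s) p + mdist T p (\<beta> (t - ?a))"
        by (rule mdist_triangle[OF in_M'(1) assms(3) in_M'(2)])
      moreover have "mdist T (\<alpha> s) p = ?a - s" "mdist T p (\<beta> (t - ?a)) = t - ?a"
        using A(6)[of s] B(5)[of "t - ?a"] 3 st assms(4) by auto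
      \<comment> \<open>The detour from \<open>x\<close> to \<open>y\<close> through the two chosen
        points takes at least \<open>?L\<close>, which rules out a shortcut past
        \<open>p\<close>.\<close>
      moreover have "?L \<le> mdist T x (\<alpha> s) + (mdist T (\<alpha> s) (\<beta> (t - ?a)) + mdist T (\<beta> (t - ?a)) y)"
        using mdist_triangle[OF assms(1) in_M'(1) assms(2)]
          mdist_triangle[OF in_M'(1) in_M'(2) assms(2)] by linarith
      moreover have "mdist T x (\<alpha> s) = s" "mdist T (\<beta> (t - ?a)) y = ?L - t"
        using A(5)[of s] B(6)[of "t - ?a"] 3 st assms(4) by auto
      ultimately show ?thesis unfolding \<gamma>_def using 3 by auto
    qed
  qed
  have "\<gamma> 0 = x" "\<gamma> ?a = p" unfolding \<gamma>_def using A(2,3) by auto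
  \<comment> \<open>If \<open>p = y\<close>, the parameter \<open>?L\<close> still falls into the
    first branch of \<open>\<gamma>\<close>, hence the case distinction.\<close>
  moreover have "\<gamma> ?L = y"
  proof (cases "mdist T p y = 0")
    case True
    then show ?thesis using assms A(3) unfolding \<gamma>_def by simp
  next
    case False
    then have "mdist T p y > 0" using mdist_nonneg[of T p y] by linarith
    then show ?thesis using assms(4) B(3) unfolding \<gamma>_def by simp
  qed
  moreover have "mdist T (\<gamma> s) (\<gamma> t) = \<bar>s - t\<bar>" if "s \<in> {0..?L}" "t \<in> {0..?L}" for s t
  proof (cases "s \<le> t")
    case True
    then show ?thesis using iso[of s t] that by simp
  next
    case False
    then have "mdist T (\<gamma> t) (\<gamma> s) = s - t" using iso[of t s] that by simp
    then show ?thesis using False mdist_commute[of T "\<gamma> s" "\<gamma> t"] by linarith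
  qed
  ultimately have "geodesic_from_to T \<gamma> x y" unfolding geodesic_from_to_def using in_M by simp
  from this \<open>\<gamma> ?a = p\<close> show thesis by (rule that)
qed

text \<open>The centre is the last common point of the geodesics from \<open>x\<close> to
  \<open>y\<close> and to \<open>z\<close>. Beyond it they are disjoint, so going back from
  \<open>y\<close> to the centre and on to \<open>z\<close> is injective, and uniqueness of arcs
  places the centre on the geodesic from \<open>y\<close> to \<open>z\<close>.\<close>

lemma geodesic_tripod:
  assumes "x \<in> mspace T" "y \<in> mspace T" "z \<in> mspace T"
  shows "\<exists>p \<in> mspace T. mdist T x y = mdist T x p + mdist T p y \<and>
    mdist T x z = mdist T x p + mdist T p z \<and> mdist T y z = mdist T y p + mdist T p z"
proof (cases "y = z")
  case True
  then show ?thesis using assms by (intro bexI[of _ y]) auto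
next
  case False
  obtain \<gamma> where \<gamma>: "geodesic_from_to T \<gamma> x y" using ex_geodesic assms by blast
  obtain \<delta> where \<delta>: "geodesic_from_to T \<delta> x z" using ex_geodesic assms by blast
  obtain \<eta> where \<eta>: "geodesic_from_to T \<eta> y z" using ex_geodesic assms by blast
  note G = geodesic_from_toD[OF \<gamma>] and D = geodesic_from_toD[OF \<delta>] and E = geodesic_from_toD[OF \<eta>]
  let ?a = "mdist T x y" and ?b = "mdist T x z"
  define S where "S = {t. 0 \<le> t \<and> t \<le> ?a \<and> t \<le> ?b \<and> \<gamma> t = \<delta> t}"
  define m where "m = Sup S"
  have S: "0 \<in> S" "bdd_above S" unfolding S_def using G(2) D(2) by (auto intro!: bdd_aboveI)
  have le_m: "t \<le> m" if "t \<in> S" for t unfolding m_def using S(2) that by (rule cSup_upper[rotated])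
  have m: "0 \<le> m" "m \<le> ?a" "m \<le> ?b"
    using le_m[OF S(1)] S(1) by (auto simp: m_def S_def intro!: cSup_least)
  have m_in: "\<gamma> m \<in> mspace T" "\<delta> m \<in> mspace T" using G(1) D(1) m by auto
  \<comment> \<open>The supremum is attained: the geodesics agree at parameters arbitrarily close to
    \<open>m\<close>, and both are continuous.\<close>
  have "mdist T (\<gamma> m) (\<delta> m) \<le> e" if "e > 0" for e
  proof -
    obtain t where t: "t \<in> S" "m - e / 2 < t"
      using less_cSup_iff[of S "m - e/2"] S \<open>e > 0\<close> unfolding m_def by force
    then have t': "0 \<le> t" "t \<le> m" "t \<le> ?a" "t \<le> ?b" "\<gamma> t = \<delta> t"
      using le_m by (auto simp: S_def)
    have "mdist T (\<gamma> m) (\<delta> m) \<le> mdist T (\<gamma> m) (\<gamma> t) + mdist T (\<delta> t) (\<delta> m)"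
      using mdist_triangle[of "\<gamma> m" T "\<gamma> t" "\<delta> m"] m_in G(1)[of t] t' by auto
    also have "\<dots> = (m - t) + (m - t)"
      using G(4)[of t m] D(4)[of t m] t' m by (simp add: mdist_commute)
    finally show ?thesis using t by simp
  qed
  then have "mdist T (\<gamma> m) (\<delta> m) \<le> 0" by (rule field_le_epsilon[where y=0, simplified])
  then have p: "\<gamma> m = \<delta> m" using m_in mdist_zero mdist_nonneg by (metis order_antisym)
  \<comment> \<open>On both geodesics the parameter is the distance from \<open>x\<close>, so they
    can only meet at equal parameters.\<close>
  have meet: "s = t \<and> s \<le> m" if "\<gamma> s = \<delta> t" "0 \<le> s" "s \<le> ?a" "0 \<le> t" "t \<le> ?b" for s t
  proof -
    have "s = t" using G(5)[of s] D(5)[of t] that by simp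
    then show ?thesis using le_m[of s] that by (auto simp: S_def)
  qed
  define L where "L = (?a - m) + (?b - m)"
  \<comment> \<open>Backwards along \<open>\<gamma>\<close> until time \<open>?a - m\<close>, then
    along \<open>\<delta>\<close>; the shift by \<open>2 * m - ?a\<close> makes the second piece
    start at parameter \<open>m\<close>.\<close>
  define f where "f t = (if t \<le> ?a - m then \<gamma> (?a - t) else \<delta> (t - ?a + 2 * m))" for t
  have f_in: "f t \<in> mspace T" if "0 \<le> t" "t \<le> L" for t
    using that G(1)[of "?a - t"] D(1)[of "t - ?a + 2 * m"] m unfolding f_def L_def by auto
  have lip: "mdist T (f s) (f t) \<le> t - s" if st: "0 \<le> s" "s \<le> t" "t \<le> L" for s t
  proof -
    consider "t \<le> ?a - m" | "s > ?a - m" | "s \<le> ?a - m" "t > ?a - m" by linarith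
    then show ?thesis
    proof cases
      case 1 then show ?thesis
        using G(4)[of "?a - t" "?a - s"] st m unfolding f_def by (auto simp: mdist_commute)
    next
      case 2 then show ?thesis
        using D(4)[of "s - ?a + 2 * m" "t - ?a + 2 * m"] st m unfolding f_def L_def by auto
    next
      case 3
      have "mdist T (f s) (f t) \<le> mdist T (\<gamma> (?a - s)) (\<gamma> m) + mdist T (\<delta> m) (\<delta> (t - ?a + 2 * m))"
        using mdist_triangle[of "f s" T "\<gamma> m" "f t"] f_in[of s] f_in[of t] m_in(1) 3 st p
        unfolding f_def by auto
      also have "\<dots> = t - s"
        using G(4)[of m "?a - s"] D(4)[of m "t - ?a + 2 * m"] 3 st m
        by (auto simp: L_def mdist_commute)
      finally show ?thesis .
    qed
  qed
  have inj: "inj_on f {0..L}"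
  proof (rule linorder_inj_onI)
    fix s t assume st: "s < t" "s \<in> {0..L}" "t \<in> {0..L}"
    show "f s \<noteq> f t"
    proof
      assume eq: "f s = f t"
      consider "t \<le> ?a - m" | "s > ?a - m" | "s \<le> ?a - m" "t > ?a - m" by linarith
      then show False
      proof cases
        case 1 then show ?thesis
          using G(5)[of "?a - t"] G(5)[of "?a - s"] st m eq unfolding f_def by auto
      next
        case 2 then show ?thesis
          using D(5)[of "s - ?a + 2 * m"] D(5)[of "t - ?a + 2 * m"] st m eq unfolding f_def L_def by auto
      next
        case 3 then show ?thesis
          using meet[of "?a - s" "t - ?a + 2 * m"] st m eq unfolding f_def L_def by auto
      qed
    qed
  qed auto
  have ends: "f 0 = y" using G(3) m by (simp add: f_def)
  have endz: "f L = z"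
  proof (cases "?b = m")
    case True
    then show ?thesis unfolding f_def L_def using p D(3) by simp
  next
    case False
    then show ?thesis unfolding f_def L_def using D(3) m by auto
  qed
  have "mdist T y z > 0" using False assms by (metis mdist_nonneg mdist_zero order_le_less)
  moreover have "0 \<le> L" using m by (simp add: L_def)
  then have "mdist T y z \<le> L" using lip[of 0 L] ends endz by simp
  ultimately have "f ` {0..L} = \<eta> ` {0..mdist T y z}"
    using lipschitz_arc_through_geodesic[OF \<eta> assms(2,3) False _ _ inj ends endz lip] f_in
    by auto
  moreover have "\<gamma> m \<in> f ` {0..L}"
    by (rule image_eqI[of _ _ "?a - m"]) (use m in \<open>auto simp: f_def L_def\<close>)
  ultimately obtain u where u: "0 \<le> u" "u \<le> mdist T y z" "\<gamma> m = \<eta> u" by auto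
  show ?thesis
    using E(5)[of u] E(6)[of u] u G(5)[of m] G(6)[of m] D(5)[of m] D(6)[of m] m m_in p
    by (intro bexI[of _ "\<gamma> m"]) auto
qed

text \<open>After this, topology enters only where branch points, discreteness and minimality are
  translated; everything else is metric betweenness.\<close>

lemma rtree_of_real_tree: "rtree (mspace T) (mdist T)"
proof -
  interpret Metric_space "mspace T" "mdist T" by simp
  show ?thesis
  proof
    show "mspace T \<noteq> {}" using tree by (simp add: real_tree_def)
  next
    fix x y t assume *: "x \<in> mspace T" "y \<in> mspace T" "0 \<le> t" "t \<le> mdist T x y"
    obtain \<gamma> where "geodesic_from_to T \<gamma> x y" using ex_geodesic * by blast
    from geodesic_from_toD[OF this] *
    show "\<exists>p\<in>mspace T. mdist T x p = t \<and> mdist T p y = mdist T x y - t" by blast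
  next
    fix x y p q
    assume *: "x \<in> mspace T" "y \<in> mspace T" "p \<in> mspace T" "q \<in> mspace T"
      "mdist T x y = mdist T x p + mdist T p y" "mdist T x y = mdist T x q + mdist T q y"
      "mdist T x p = mdist T x q"
    obtain \<gamma> where \<gamma>: "geodesic_from_to T \<gamma> x y" "\<gamma> (mdist T x p) = p"
      using geodesic_through_point[OF *(1,2,3,5)] .
    obtain \<delta> where \<delta>: "geodesic_from_to T \<delta> x y" "\<delta> (mdist T x q) = q"
      using geodesic_through_point[OF *(1,2,4,6)] .
    have "mdist T x p \<le> mdist T x y" using *(5) mdist_nonneg[of T p y] by linarith
    then have "\<gamma> (mdist T x p) = \<delta> (mdist T x p)"
      by (rule geodesic_point_unique[OF \<gamma>(1) \<delta>(1) *(1,2) mdist_nonneg])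
    then show "p = q" using \<gamma>(2) \<delta>(2) *(7) by metis
  qed (fact geodesic_tripod)
qed

end

section \<open>Vertices of the tree in terms of betweenness\<close>

context
  fixes T :: "'a metric"
  assumes tree: "real_tree T"
begin

interpretation rtree "mspace T" "mdist T" by (rule rtree_of_real_tree[OF tree])

lemma segment_connected:
  assumes "x \<in> mspace T" "y \<in> mspace T"
  shows "connectedin (mtopology_of T) {p. btw x p y}"
proof -
  obtain \<gamma> where \<gamma>: "geodesic_from_to T \<gamma> x y" using ex_geodesic[OF tree assms] .
  note G = geodesic_from_toD[OF \<gamma>]
  have "pathin (mtopology_of T) (\<lambda>s. \<gamma> (s * mdist T x y))"
    using G by (intro lipschitz_pathin) auto
  then have "connectedin (mtopology_of T) ((\<lambda>s. \<gamma> (s * mdist T x y)) ` {0..1})"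
    by (rule connectedin_path_image)
  moreover have "(\<lambda>s. \<gamma> (s * mdist T x y)) ` {0..1} = {p. btw x p y}"
  proof (intro equalityI subsetI)
    fix p assume "p \<in> (\<lambda>s. \<gamma> (s * mdist T x y)) ` {0..1}"
    then obtain s where s: "0 \<le> s" "s \<le> 1" "p = \<gamma> (s * mdist T x y)" by auto
    then have "0 \<le> s * mdist T x y" "s * mdist T x y \<le> mdist T x y"
      by (auto simp: mult_left_le_one_le)
    then show "p \<in> {p. btw x p y}" using G assms s by (auto simp: btw_def)
  next
    fix p assume "p \<in> {p. btw x p y}"
    then have p: "btw x p y" by simp
    then have le: "mdist T x p \<le> mdist T x y" by (simp add: btw_def)
    have "btw x (\<gamma> (mdist T x p)) y"
      using G(1)[OF _ le] G(5)[OF _ le] G(6)[OF _ le] assms by (simp add: btw_def)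
    then have eq: "p = \<gamma> (mdist T x p)" using btw_unique[OF p] G(5)[OF _ le] by simp
    show "p \<in> (\<lambda>s. \<gamma> (s * mdist T x y)) ` {0..1}"
    proof (cases "mdist T x y = 0")
      case True
      then have "mdist T x p = 0" using le mdist_nonneg[of T x p] by simp
      then show ?thesis using eq True by (intro image_eqI[of _ _ 0]) auto
    next
      case False
      then have "mdist T x y > 0" using mdist_nonneg[of T x y] by linarith
      then show ?thesis using eq le by (intro image_eqI[of _ _ "mdist T x p / mdist T x y"]) auto
    qed
  qed
  ultimately show ?thesis by simp
qed

text \<open>By \<open>btw_near\<close> the ball about \<open>y\<close> that just misses
  \<open>x\<close> stays on the side of \<open>y\<close>. So the side of \<open>x\<close> containing
  \<open>a\<close> and the rest of the complement are both open, hence a separation.\<close>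

lemma direction_open:
  assumes "a \<in> mspace T" "x \<in> mspace T"
  shows "openin mtopology {y \<in> mspace T - {x}. \<not> btw a x y}"
    "openin mtopology {y \<in> mspace T - {x}. btw a x y}"
proof -
  have key: "btw a x y' = btw a x y"
    if "y \<in> mspace T" "y' \<in> mspace T" "mdist T y y' < mdist T y x" for y y'
    by (rule btw_near) (use that in auto)
  have ball: "mball y (mdist T y x) \<subseteq> {y' \<in> mspace T - {x}. btw a x y' = btw a x y}"
    "mdist T y x > 0"
    if "y \<in> mspace T - {x}" for y
  proof -
    show "mdist T y x > 0" using that assms(2) mdist_pos_less by auto
    show "mball y (mdist T y x) \<subseteq> {y' \<in> mspace T - {x}. btw a x y' = btw a x y}"
    proof
      fix y' assume "y' \<in> mball y (mdist T y x)"
      then have y': "y' \<in> mspace T" "mdist T y y' < mdist T y x" by simp_all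
      then have "y' \<noteq> x" by auto
      moreover have "btw a x y' = btw a x y" using key[of y y'] y' that by blast
      ultimately show "y' \<in> {y' \<in> mspace T - {x}. btw a x y' = btw a x y}" using y' by simp
    qed
  qed
  show "openin mtopology {y \<in> mspace T - {x}. \<not> btw a x y}"
    unfolding openin_mtopology
  proof (intro conjI allI impI)
    fix y assume "y \<in> {y \<in> mspace T - {x}. \<not> btw a x y}"
    then have y: "y \<in> mspace T - {x}" "\<not> btw a x y" by simp_all
    show "\<exists>r>0. mball y r \<subseteq> {y \<in> mspace T - {x}. \<not> btw a x y}"
      using ball[OF y(1)] y(2) by (intro exI[of _ "mdist T y x"] conjI) auto
  qed auto
  show "openin mtopology {y \<in> mspace T - {x}. btw a x y}"
    unfolding openin_mtopology
  proof (intro conjI allI impI)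
    fix y assume "y \<in> {y \<in> mspace T - {x}. btw a x y}"
    then have y: "y \<in> mspace T - {x}" "btw a x y" by simp_all
    show "\<exists>r>0. mball y r \<subseteq> {y \<in> mspace T - {x}. btw a x y}"
      using ball[OF y(1)] y(2) by (intro exI[of _ "mdist T y x"] conjI) auto
  qed auto
qed

lemma tree_vertices_eq: "tree_vertices T = branch_points"
proof (intro equalityI subsetI)
  fix x assume "x \<in> tree_vertices T"
  then obtain \<C> where x: "x \<in> mspace T" and "card \<C> = 3"
    and sub: "\<C> \<subseteq> connected_components_of (subtopology (mtopology_of T) (mspace T - {x}))"
    unfolding tree_vertices_def by blast
  let ?X = "subtopology (mtopology_of T) (mspace T - {x})"
  have top: "topspace ?X = mspace T - {x}" by auto
  obtain A B C where ABC: "A \<in> \<C>" "B \<in> \<C>" "C \<in> \<C>" "A \<noteq> B" "A \<noteq> C" "B \<noteq> C"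
    using \<open>card \<C> = 3\<close> by (auto simp: card_3_iff)
  then have comp: "A \<in> connected_components_of ?X" "B \<in> connected_components_of ?X"
    "C \<in> connected_components_of ?X" using sub by auto
  then obtain a b c where abc: "a \<in> A" "b \<in> B" "c \<in> C"
    using nonempty_connected_components_of by fastforce
  then have abc_in: "a \<in> mspace T - {x}" "b \<in> mspace T - {x}" "c \<in> mspace T - {x}"
    using connected_components_of_subset[OF comp(1)] connected_components_of_subset[OF comp(2)]
      connected_components_of_subset[OF comp(3)] top by auto
  \<comment> \<open>A segment that misses \<open>x\<close> is connected and would merge the two
    components.\<close>
  have between: "btw u x v"
    if "u \<in> P" "v \<in> Q" "P \<in> connected_components_of ?X" "Q \<in> connected_components_of ?X" "P \<noteq> Q"
      "u \<in> mspace T - {x}" "v \<in> mspace T - {x}" for u v P Q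
  proof (rule ccontr)
    assume "\<not> btw u x v"
    then have "connectedin ?X {p. btw u p v}"
      using segment_connected[of u v] that(6,7) by (auto simp: connectedin_subtopology btw_def)
    moreover have "u \<in> {p. btw u p v}" "v \<in> {p. btw u p v}" using that(6,7) by auto
    ultimately have "connected_component_of ?X u v"
      unfolding connected_component_of_def by blast
    then have "connected_component_of_set ?X u = connected_component_of_set ?X v"
      using connected_component_of_equiv[of ?X u v] by simp
    moreover have comp: "R = connected_component_of_set ?X w"
      if R: "R \<in> connected_components_of ?X" "w \<in> R" for R w
    proof -
      obtain r where "R = connected_component_of_set ?X r"
        using R(1) by (auto simp: connected_components_of_def)
      then show ?thesis using R(2) connected_component_of_equiv[of ?X r w] by simp
    qed
    ultimately have "P = Q" using comp[OF that(3,1)] comp[OF that(4,2)] by simp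
    then show False using that(5) by simp
  qed
  show "x \<in> branch_points"
    by (rule median_branch_point[of a x b c]) (use between abc abc_in comp ABC in blast)+
next
  fix x assume "x \<in> branch_points"
  then obtain a b c where abc: "a \<noteq> x" "b \<noteq> x" "c \<noteq> x" "btw a x b" "btw a x c" "btw b x c"
    by (rule branch_pointsE)
  then have in_M: "x \<in> mspace T" "a \<in> mspace T" "b \<in> mspace T" "c \<in> mspace T"
    by (auto simp: btw_def)
  let ?X = "subtopology (mtopology_of T) (mspace T - {x})"
  have top: "topspace ?X = mspace T - {x}" by auto
  \<comment> \<open>Conversely, the two open sides of \<open>x\<close> as seen from \<open>u\<close>
    would disconnect a connected set containing \<open>u\<close> and \<open>v\<close>.\<close>
  have sep: "\<not> connected_component_of ?X u v"
    if "btw u x v" "u \<noteq> x" "v \<noteq> x" for u v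
  proof
    assume "connected_component_of ?X u v"
    then obtain S where S: "connectedin ?X S" "u \<in> S" "v \<in> S"
      by (auto simp: connected_component_of_def)
    have uv: "u \<in> mspace T" "v \<in> mspace T" using that by (auto simp: btw_def)
    define D where "D = {y \<in> mspace T - {x}. \<not> btw u x y}"
    define E where "E = {y \<in> mspace T - {x}. btw u x y}"
    have "openin (mtopology_of T) D" "openin (mtopology_of T) E"
      unfolding D_def E_def mtopology_of_def by (rule direction_open[OF uv(1) in_M(1)])+
    moreover have sub: "D \<subseteq> mspace T - {x}" "E \<subseteq> mspace T - {x}" by (auto simp: D_def E_def)
    ultimately have opens: "openin ?X D" "openin ?X E"
      using openin_subtopology_Int2[of "mtopology_of T" D "mspace T - {x}"]
        openin_subtopology_Int2[of "mtopology_of T" E "mspace T - {x}"] by (simp_all add: Int_absorb1)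
    have "S \<subseteq> mspace T - {x}" using connectedin_subset_topspace[OF S(1)] unfolding top .
    moreover have "mspace T - {x} \<subseteq> D \<union> E" by (auto simp: D_def E_def)
    ultimately have cover: "S \<subseteq> D \<union> E" by (rule subset_trans)
    have disj: "D \<inter> E \<inter> S = {}" by (auto simp: D_def E_def)
    have "\<not> btw u x u"
    proof
      assume "btw u x u"
      then have "x = u" by (rule btw_same_ends)
      with that(2) show False by simp
    qed
    then have "u \<in> D" unfolding D_def using uv(1) that(2) by simp
    moreover have "v \<in> E" unfolding E_def using uv(2) that by simp
    ultimately have "D \<inter> S \<noteq> {}" "E \<inter> S \<noteq> {}" using S(2,3) by auto
    with opens cover disj show False
      using S(1)[unfolded connectedin, THEN conjunct2] by (metis (no_types, lifting))
  qed
  let ?c = "connected_component_of_set ?X"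
  have ne: "?c u \<noteq> ?c v" if "btw u x v" "u \<noteq> x" "v \<noteq> x" for u v
  proof -
    have "v \<in> mspace T" using that by (auto simp: btw_def)
    then have "v \<in> ?c v" using that top connected_component_of_refl by fastforce
    then show ?thesis using sep[OF that] by blast
  qed
  have "card {?c a, ?c b, ?c c} = 3" using ne abc by (simp add: card_3_iff)
  moreover have "{?c a, ?c b, ?c c} \<subseteq> connected_components_of ?X"
    using in_M abc top unfolding connected_components_of_def by auto
  ultimately show "x \<in> tree_vertices T" unfolding tree_vertices_def using in_M by blast
qed

lemma tree_arcs_eq: "tree_arcs T = branch_arcs"
proof -
  have "mdist T x z + mdist T z y = mdist T x y \<longleftrightarrow> btw x z y"
    if "x \<in> branch_points" "y \<in> branch_points" "z \<in> branch_points" for x y z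
    using that branch_points_in by (auto simp: btw_def)
  then show ?thesis
    unfolding tree_arcs_def branch_arcs_def tree_vertices_eq by auto
qed

end

section \<open>Free discrete minimal actions on trees\<close>

text \<open>\<open>act_discrete\<close> is discreteness of the orbit combined with freeness.
  \<open>orbit_hull\<close> carries all of minimality that is used: the segments from
  \<open>x\<close> to its translates form an invariant subtree, hence fill the tree.\<close>

locale tree_action = rtree M d + group G
  for M :: "'a set" and d and G :: "('g, 'm) monoid_scheme" (structure) +
  fixes \<phi> :: "'g \<Rightarrow> 'a \<Rightarrow> 'a"
  assumes act_in: "\<lbrakk>g \<in> carrier G; x \<in> M\<rbrakk> \<Longrightarrow> \<phi> g x \<in> M"
    and act_mult: "\<lbrakk>g \<in> carrier G; h \<in> carrier G; x \<in> M\<rbrakk> \<Longrightarrow> \<phi> (g \<otimes> h) x = \<phi> g (\<phi> h x)"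
    and act_one: "x \<in> M \<Longrightarrow> \<phi> \<one> x = x"
    and act_dist: "\<lbrakk>g \<in> carrier G; x \<in> M; y \<in> M\<rbrakk> \<Longrightarrow> d (\<phi> g x) (\<phi> g y) = d x y"
    and act_free: "\<lbrakk>g \<in> carrier G; x \<in> M; \<phi> g x = x\<rbrakk> \<Longrightarrow> g = \<one>"
    and act_discrete: "x \<in> M \<Longrightarrow> \<exists>e>0. \<forall>g \<in> carrier G. d x (\<phi> g x) < e \<longrightarrow> g = \<one>"
    and orbit_hull: "\<lbrakk>x \<in> M; y \<in> M\<rbrakk> \<Longrightarrow> \<exists>g \<in> carrier G. btw x y (\<phi> g x)"
begin

lemma act_inv [simp]: "\<lbrakk>g \<in> carrier G; x \<in> M\<rbrakk> \<Longrightarrow> \<phi> (inv g) (\<phi> g x) = x"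
  "\<lbrakk>g \<in> carrier G; x \<in> M\<rbrakk> \<Longrightarrow> \<phi> g (\<phi> (inv g) x) = x"
  using act_mult[of "inv g" g x] act_mult[of g "inv g" x] act_one by simp_all

lemma act_inj: "\<lbrakk>g \<in> carrier G; x \<in> M; y \<in> M; \<phi> g x = \<phi> g y\<rbrakk> \<Longrightarrow> x = y"
  using act_inv(1) by metis

lemma act_eq:
  assumes "g \<in> carrier G" "h \<in> carrier G" "x \<in> M" "\<phi> g x = \<phi> h x"
  shows "g = h"
proof -
  have "\<phi> (inv h \<otimes> g) x = x" using assms act_mult[of "inv h" g x] by simp
  then have "inv h \<otimes> g = \<one>" using act_free assms by simp
  then show ?thesis using assms by (metis inv_equality inv_inv inv_closed)
qed

lemma act_btw: "btw x y z \<Longrightarrow> g \<in> carrier G \<Longrightarrow> btw (\<phi> g x) (\<phi> g y) (\<phi> g z)"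
  unfolding btw_def by (simp add: act_in act_dist)

lemma act_btw_iff:
  assumes "x \<in> M" "y \<in> M" "z \<in> M" "g \<in> carrier G"
  shows "btw (\<phi> g x) (\<phi> g y) (\<phi> g z) = btw x y z"
  using assms unfolding btw_def by (simp add: act_in act_dist)

lemma act_branch_point:
  assumes "v \<in> branch_points" "g \<in> carrier G"
  shows "\<phi> g v \<in> branch_points"
proof -
  obtain a b c where abc: "a \<noteq> v" "b \<noteq> v" "c \<noteq> v" "btw a v b" "btw a v c" "btw b v c"
    by (rule branch_pointsE[OF assms(1)])
  then have in_M: "a \<in> M" "b \<in> M" "c \<in> M" "v \<in> M" by (auto dest: btw_in)
  show ?thesis
    by (rule median_branch_point[of "\<phi> g a" _ "\<phi> g b" "\<phi> g c"])
      (use abc act_btw assms(2) act_inj[OF assms(2)] in_M in metis)+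
qed

lemma act_branch_arc:
  assumes "(v, w) \<in> branch_arcs" "g \<in> carrier G"
  shows "(\<phi> g v, \<phi> g w) \<in> branch_arcs"
proof -
  note A = branch_arcsD[OF assms(1)]
  have "z = \<phi> g v \<or> z = \<phi> g w" if z: "z \<in> branch_points" "btw (\<phi> g v) z (\<phi> g w)" for z
  proof -
    have "z \<in> M" using z branch_points_in by auto
    have "\<phi> (inv g) z \<in> branch_points" using z act_branch_point assms by simp
    moreover have "btw v (\<phi> (inv g) z) w"
      using act_btw[OF z(2), of "inv g"] assms A by simp
    ultimately have "\<phi> (inv g) z = v \<or> \<phi> (inv g) z = w" using A(6) by blast
    then show ?thesis using act_inv(2)[OF assms(2) \<open>z \<in> M\<close>] by auto
  qed
  moreover have "\<phi> g v \<noteq> \<phi> g w" using A act_inj[OF assms(2)] by blast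
  ultimately show ?thesis
    unfolding branch_arcs_def using A act_branch_point assms(2) by auto
qed

lemma dist_triangle4:
  assumes "a \<in> M" "b \<in> M" "c \<in> M" "e \<in> M"
  shows "d a e \<le> d a b + d b c + d c e"
  using triangle[of a b e] triangle[of b c e] assms by simp

definition tl_length :: "'g \<Rightarrow> real" where
  "tl_length g = (INF x \<in> M. d x (\<phi> g x))"

lemma tl_length_le: "x \<in> M \<Longrightarrow> tl_length g \<le> d x (\<phi> g x)"
  unfolding tl_length_def by (rule cINF_lower) (auto intro!: bdd_belowI[of _ 0])

lemma tl_length_ge: "(\<And>x. x \<in> M \<Longrightarrow> c \<le> d x (\<phi> g x)) \<Longrightarrow> c \<le> tl_length g"
  unfolding tl_length_def by (rule cINF_greatest[OF nonempty])

lemma tl_length_conj: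
  assumes "g \<in> carrier G" "k \<in> carrier G"
  shows "tl_length (k \<otimes> g \<otimes> inv k) = tl_length g"
proof -
  have eq: "d (\<phi> k x) (\<phi> (k \<otimes> g \<otimes> inv k) (\<phi> k x)) = d x (\<phi> g x)" if "x \<in> M" for x
    using that assms by (simp add: act_mult act_in act_dist)
  show ?thesis
  proof (rule antisym)
    show "tl_length (k \<otimes> g \<otimes> inv k) \<le> tl_length g"
      using tl_length_le[of "\<phi> k x" "k \<otimes> g \<otimes> inv k" for x] eq assms
      by (intro tl_length_ge) (metis act_in)
    show "tl_length g \<le> tl_length (k \<otimes> g \<otimes> inv k)"
    proof (rule tl_length_ge)
      fix x assume "x \<in> M"
      then have "\<phi> (inv k) x \<in> M" "\<phi> k (\<phi> (inv k) x) = x" using assms act_in by simp_all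
      then show "tl_length g \<le> d x (\<phi> (k \<otimes> g \<otimes> inv k) x)"
        using tl_length_le[of "\<phi> (inv k) x" g] eq[of "\<phi> (inv k) x"] by simp
    qed
  qed
qed

text \<open>Compare the linear growth of the displacements of \<open>y\<close> and of any other point under powers of \<open>g\<close>.\<close>

lemma tl_length_axis:
  assumes "g \<in> carrier G" "y \<in> M" "btw y (\<phi> g y) (\<phi> g (\<phi> g y))" "\<phi> g y \<noteq> y"
  shows "tl_length g = d y (\<phi> g y)"
proof (rule antisym)
  show "tl_length g \<le> d y (\<phi> g y)" using tl_length_le assms by blast
  define x where "x n = (\<phi> g ^^ n) y" for n
  have x_in: "x n \<in> M" for n unfolding x_def by (induction n) (use assms act_in in auto)
  have xS: "x (Suc n) = \<phi> g (x n)" for n by (simp add: x_def)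
  have step: "btw (x n) (x (Suc n)) (x (Suc (Suc n))) \<and> x n \<noteq> x (Suc n) \<and>
      d (x n) (x (Suc n)) = d y (\<phi> g y)" for n
  proof (induction n)
    case 0
    show ?case using assms(3,4) by (auto simp: x_def)
  next
    case (Suc n)
    then have IH: "btw (x n) (x (Suc n)) (x (Suc (Suc n)))" "x n \<noteq> x (Suc n)"
      "d (x n) (x (Suc n)) = d y (\<phi> g y)" by simp_all
    show ?case
    proof (intro conjI)
      show "btw (x (Suc n)) (x (Suc (Suc n))) (x (Suc (Suc (Suc n))))"
        using act_btw[OF IH(1) assms(1)] by (simp only: xS)
      show "x (Suc n) \<noteq> x (Suc (Suc n))"
      proof
        assume "x (Suc n) = x (Suc (Suc n))"
        then have "\<phi> g (x n) = \<phi> g (x (Suc n))" by (simp only: xS)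
        then show False using act_inj[OF assms(1) x_in x_in] IH(2) by blast
      qed
      show "d (x (Suc n)) (x (Suc (Suc n))) = d y (\<phi> g y)"
        using act_dist[OF assms(1) x_in x_in, of n "Suc n"] IH(3) by (simp only: xS)
    qed
  qed
  have "d (x 0) (x n) = (\<Sum>i<n. d (x i) (x (Suc i)))" for n
    by (rule chain_additive) (use step in auto)
  then have dist_n: "d y (x n) = real n * d y (\<phi> g y)" for n
    using step by (simp add: x_def)
  show "d y (\<phi> g y) \<le> tl_length g"
  proof (rule tl_length_ge)
    fix z assume z: "z \<in> M"
    define w where "w n = (\<phi> g ^^ n) z" for n
    have w_in: "w n \<in> M" for n unfolding w_def by (induction n) (use z assms act_in in auto)
    have wS: "w (Suc n) = \<phi> g (w n)" for n by (simp add: w_def)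
    have wd: "d z (w n) \<le> real n * d z (\<phi> g z)" "d (w n) (x n) = d z y" for n
    proof (induction n)
      case 0
      case 1 show ?case using z by (simp add: w_def)
      case 2 show ?case by (simp add: w_def x_def)
    next
      case (Suc n)
      have "d (w n) (w (Suc n)) = d z (\<phi> g z)"
      proof (induction n)
        case 0 show ?case by (simp add: w_def)
      next
        case (Suc n) then show ?case
          using act_dist[OF assms(1) w_in w_in, of n "Suc n"] by (simp add: wS)
      qed
      then show "d z (w (Suc n)) \<le> real (Suc n) * d z (\<phi> g z)"
        using Suc triangle[OF z w_in[of n] w_in[of "Suc n"]] by (simp add: algebra_simps)
      show "d (w (Suc n)) (x (Suc n)) = d z y"
        using Suc act_dist[OF assms(1) w_in x_in] by (simp add: wS xS)
    qed
    have *: "real n * (d y (\<phi> g y) - d z (\<phi> g z)) \<le> 2 * d z y" for n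
    proof -
      have "d y (x n) \<le> d y z + d z (w n) + d (w n) (x n)"
        using dist_triangle4[OF assms(2) z w_in x_in] by simp
      then show ?thesis using wd[of n] dist_n[of n] commute[of y z] by (simp add: algebra_simps)
    qed
    show "d y (\<phi> g y) \<le> d z (\<phi> g z)"
    proof (rule ccontr)
      assume "\<not> ?thesis"
      then have "0 < d y (\<phi> g y) - d z (\<phi> g z)" by simp
      from reals_Archimedean3[OF this] obtain n where
        "2 * d z y < real n * (d y (\<phi> g y) - d z (\<phi> g z))" by blast
      with *[of n] show False by simp
    qed
  qed
qed

text \<open>Conversely a point of minimal displacement lies on the axis: otherwise moving it towards the
  axis decreases the displacement.\<close>

lemma min_displacement_axis:
  assumes "g \<in> carrier G" "y \<in> M" "tl_length g = d y (\<phi> g y)"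
  shows "btw y (\<phi> g y) (\<phi> g (\<phi> g y))"
proof (rule ccontr)
  assume not: "\<not> ?thesis"
  let ?y1 = "\<phi> g y" and ?y2 = "\<phi> g (\<phi> g y)"
  have in_M: "?y1 \<in> M" "?y2 \<in> M" using assms act_in by auto
  obtain r where r: "r > 0" "\<And>q. btw ?y1 q y \<Longrightarrow> d ?y1 q \<le> r \<Longrightarrow> btw ?y1 q ?y2"
    using not_btw_common[OF assms(2) in_M not] by metis
  have "y \<noteq> ?y1" using not in_M assms(2) by auto
  then have pos: "d y ?y1 > 0" using in_M assms(2) by simp
  \<comment> \<open>\<open>t \<le> r\<close> keeps \<open>q\<close> on the piece common to the
    segments from \<open>?y1\<close> to \<open>y\<close> and to \<open>?y2\<close>; at most half the
    length keeps \<open>p\<close> before \<open>q\<close>.\<close>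
  define t where "t = min r (d y ?y1 / 2)"
  have t: "0 < t" "t \<le> r" "t \<le> d y ?y1 / 2" using r pos by (auto simp: t_def)
  obtain q where q: "btw ?y1 q y" "d ?y1 q = t"
    using btw_point[OF in_M(1) assms(2), of t] t pos by (auto simp: commute)
  obtain p where p: "btw y p ?y1" "d y p = t"
    using btw_point[OF assms(2) in_M(1), of t] t pos by auto
  have "btw ?y1 (\<phi> g p) ?y2" using act_btw[OF p(1) assms(1)] .
  moreover have "btw ?y1 q ?y2" using r(2)[OF q(1)] q(2) t by simp
  moreover have "d ?y1 (\<phi> g p) = t" using p act_dist[OF assms(1,2)] btw_in(2)[OF p(1)] by simp
  \<comment> \<open>Both points lie on the segment from \<open>?y1\<close> to \<open>?y2\<close> at
    distance \<open>t\<close> from \<open>?y1\<close>. Hence \<open>g\<close> displaces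
    \<open>p\<close> by \<open>2 * t\<close> less than \<open>y\<close>.\<close>
  ultimately have gp: "\<phi> g p = q" using btw_unique q(2) by metis
  have q': "btw y q ?y1" using q(1) by (rule btw_sym)
  have dq: "d y q = d y ?y1 - t" using q' q(2) by (simp add: btw_def commute)
  have "btw y p q" by (rule btw_order[OF p(1) q']) (use dq p(2) t in linarith)
  then have "d p q = d y ?y1 - 2 * t" using dq p(2) by (simp add: btw_def)
  then have "d p (\<phi> g p) < d y ?y1" using gp t by simp
  then show False using tl_length_le[of p g] p assms(3) by (auto dest: btw_in)
qed

end

lemma tree_action_of_outer_space_tree:
  assumes "outer_space_tree G T \<phi>" "group G"
  shows "tree_action (mspace T) (mdist T) G \<phi>"
proof -
  note O = assms(1)[unfolded outer_space_tree_def]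
  have tree: "real_tree T" using O by simp
  interpret rtree "mspace T" "mdist T" by (rule rtree_of_real_tree[OF tree])
  interpret group G by (fact assms(2))
  interpret group_action G "mspace T" \<phi> using O by (simp add: isometric_action_def)
  have dist: "mdist T (\<phi> g x) (\<phi> g y) = mdist T x y"
    if "g \<in> carrier G" "x \<in> mspace T" "y \<in> mspace T" for g x y
    using O that by (simp add: isometric_action_def)
  have free: "g = \<one>\<^bsub>G\<^esub>" if "g \<in> carrier G" "x \<in> mspace T" "\<phi> g x = x" for g x
  proof -
    have "g \<in> stabilizer G \<phi> x" using that by (simp add: stabilizer_def)
    then show ?thesis using O that(2) by (simp add: free_action_def)
  qed
  have in_M: "\<phi> g x \<in> mspace T" if "g \<in> carrier G" "x \<in> mspace T" for g x
    using element_image[OF that] by simp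
  show ?thesis
  proof
    show "\<phi> g x \<in> mspace T" if "g \<in> carrier G" "x \<in> mspace T" for g x by (rule in_M[OF that])
    show "\<phi> (g \<otimes>\<^bsub>G\<^esub> h) x = \<phi> g (\<phi> h x)"
      if "g \<in> carrier G" "h \<in> carrier G" "x \<in> mspace T" for g h x
      using composition_rule that by simp
    show "\<phi> \<one>\<^bsub>G\<^esub> x = x" if "x \<in> mspace T" for x
      using id_eq_one that by (metis restrict_apply)
    show "mdist T (\<phi> g x) (\<phi> g y) = mdist T x y"
      if "g \<in> carrier G" "x \<in> mspace T" "y \<in> mspace T" for g x y by (rule dist[OF that])
    show "g = \<one>\<^bsub>G\<^esub>" if "g \<in> carrier G" "x \<in> mspace T" "\<phi> g x = x" for g x
      by (rule free[OF that])
  next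
    fix x assume x: "x \<in> mspace T"
    let ?O = "orbit G \<phi> x"
    have "subtopology (mtopology_of T) ?O = discrete_topology ?O"
      using O x by (simp add: discrete_action_def)
    moreover have "x \<in> ?O" using x by (rule orbit_refl)
    ultimately have "openin (subtopology (mtopology_of T) ?O) {x}" by simp
    then obtain U where U: "openin (mtopology_of T) U" "{x} = U \<inter> ?O"
      by (auto simp: openin_subtopology)
    then have "x \<in> U" by blast
    with U(1) obtain e where e: "e > 0" "mball x e \<subseteq> U"
      unfolding mtopology_of_def openin_mtopology by blast
    have "g = \<one>\<^bsub>G\<^esub>" if g: "g \<in> carrier G" "mdist T x (\<phi> g x) < e" for g
    proof -
      have "\<phi> g x \<in> U" using e(2) g x in_M by auto
      moreover have "\<phi> g x \<in> ?O" using g by (auto simp: orbit_def)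
      ultimately have "\<phi> g x = x" using U(2) by blast
      then show ?thesis using free g x by blast
    qed
    then show "\<exists>e>0. \<forall>g\<in>carrier G. mdist T x (\<phi> g x) < e \<longrightarrow> g = \<one>\<^bsub>G\<^esub>" using e(1) by blast
  next
    fix x y assume xy: "x \<in> mspace T" "y \<in> mspace T"
    \<comment> \<open>The hull of the orbit of \<open>x\<close>. It is connected because all its
      segments start at \<open>x\<close>.\<close>
    define S where "S = (\<Union>g \<in> carrier G. {p. btw x p (\<phi> g x)})"
    have "connectedin (mtopology_of T) S"
      unfolding S_def
    proof (rule connectedin_Union)
      show "connectedin (mtopology_of T) P" if "P \<in> (\<lambda>g. {p. btw x p (\<phi> g x)}) ` carrier G" for P
        using that segment_connected[OF tree xy(1)] in_M xy(1) by auto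
      have "x \<in> \<Inter> ((\<lambda>g. {p. btw x p (\<phi> g x)}) ` carrier G)" using in_M xy(1) by auto
      then show "\<Inter> ((\<lambda>g. {p. btw x p (\<phi> g x)}) ` carrier G) \<noteq> {}" by blast
    qed
    moreover have "x \<in> S" unfolding S_def using xy in_M by (auto intro!: bexI[of _ "\<one>\<^bsub>G\<^esub>"])
    moreover have "\<phi> h ` S \<subseteq> S" if h: "h \<in> carrier G" for h
    proof
      fix z assume "z \<in> \<phi> h ` S"
      then obtain g p where gp: "g \<in> carrier G" "btw x p (\<phi> g x)" "z = \<phi> h p"
        by (auto simp: S_def)
      have p_in: "p \<in> mspace T" "\<phi> g x \<in> mspace T" using btw_in[OF gp(2)] by auto
      have "btw (\<phi> h x) z (\<phi> h (\<phi> g x))"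
        using gp(2,3) dist[OF h] in_M[OF h] xy(1) p_in by (simp add: btw_def)
      \<comment> \<open>A translated segment need not start at \<open>x\<close>, but each of its
        points lies on the segment from \<open>x\<close> to one of its two ends, so the hull is
        invariant.\<close>
      from btw_split[OF this xy(1)]
      have "btw x z (\<phi> h x) \<or> btw x z (\<phi> (h \<otimes>\<^bsub>G\<^esub> g) x)"
        using composition_rule[OF xy(1) h gp(1)] by simp
      then show "z \<in> S" unfolding S_def using h gp(1) by auto
    qed
    ultimately have "S = mspace T"
      using O unfolding minimal_action_def by blast
    then show "\<exists>g\<in>carrier G. btw x y (\<phi> g x)" using xy(2) unfolding S_def by blast
  qed
qed

section \<open>Nets and compactness of segments\<close>

context rtree
begin

lemma btw_dist_diff:
  assumes "btw a p b" "btw a q b"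
  shows "d p q = \<bar>d a p - d a q\<bar>"
proof (cases "d a p \<le> d a q")
  case True
  then show ?thesis using btw_dist[OF btw_order[OF assms]] by simp
next
  case False
  then show ?thesis using btw_dist[OF btw_order[OF assms(2,1)]] commute[of p q] by simp
qed

lemma segment_net:
  assumes "a \<in> M" "b \<in> M" "e > 0"
  shows "\<exists>F. finite F \<and> F \<subseteq> M \<and> (\<forall>p. btw a p b \<longrightarrow> (\<exists>q \<in> F. d p q \<le> e))"
proof -
  define N where "N = nat \<lfloor>d a b / e\<rfloor>"
  define q where "q i = (SOME q. btw a q b \<and> d a q = real i * e)" for i :: nat
  have q: "btw a (q i) b \<and> d a (q i) = real i * e" if "real i * e \<le> d a b" for i
  proof -
    have "\<exists>q. btw a q b \<and> d a q = real i * e"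
      using btw_point[OF assms(1,2) _ that] assms(3) by auto
    then show ?thesis unfolding q_def by (rule someI_ex)
  qed
  have "\<exists>r \<in> q ` {i. i \<le> N \<and> real i * e \<le> d a b}. d p r \<le> e" if p: "btw a p b" for p
  proof -
    have le: "d a p \<le> d a b" using btw_dist[OF p] nonneg[of p b] by linarith
    define i where "i = nat \<lfloor>d a p / e\<rfloor>"
    have div0: "0 \<le> d a p / e" using assms(3) by simp
    have i: "real i \<le> d a p / e" "d a p / e < real i + 1"
      using div0 unfolding i_def by linarith+
    have i1: "real i * e \<le> d a p" using i(1) assms(3) by (simp add: pos_le_divide_eq)
    have i2: "d a p < (real i + 1) * e" using i(2) assms(3) by (simp add: pos_divide_less_eq)
    have i3: "real i * e \<le> d a b" using i1 le by linarith
    have "i \<le> N" unfolding i_def N_def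
      using le assms(3) by (intro nat_mono floor_mono divide_right_mono) auto
    moreover have "d p (q i) \<le> e"
      using btw_dist_diff[OF p, of "q i"] q[OF i3] i1 i2 by (simp add: algebra_simps)
    ultimately show ?thesis using i3 by blast
  qed
  moreover have "q ` {i. i \<le> N \<and> real i * e \<le> d a b} \<subseteq> M" using q by (auto dest: btw_in)
  moreover have "finite (q ` {i. i \<le> N \<and> real i * e \<le> d a b})" by simp
  ultimately show ?thesis by blast
qed

lemma segment_seq_compact:
  fixes p :: "nat \<Rightarrow> 'a"
  assumes "\<And>n. btw a (p n) b"
  obtains q r where "btw a q b" "strict_mono r" "(\<lambda>n. d (p (r n)) q) \<longlonglongrightarrow> 0"
proof -
  have ab: "a \<in> M" "b \<in> M" using btw_in[OF assms[of 0]] by auto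
  have "d a (p n) \<in> {0..d a b}" for n
  proof -
    show "d a (p n) \<in> {0..d a b}" using btw_dist[OF assms[of n]] nonneg[of "p n" b] by simp
  qed
  then obtain t r where t: "t \<in> {0..d a b}" and r: "strict_mono r" "((\<lambda>n. d a (p n)) \<circ> r) \<longlonglongrightarrow> t"
    using compact_imp_seq_compact[OF compact_Icc] by (metis seq_compactE)
  obtain q where q: "btw a q b" "d a q = t"
    using btw_point[OF ab, of t] t by auto
  have "d (p (r n)) q = \<bar>d a (p (r n)) - t\<bar>" for n
    using btw_dist_diff[OF assms q(1)] q(2) by simp
  moreover have "(\<lambda>n. \<bar>d a (p (r n)) - t\<bar>) \<longlonglongrightarrow> 0"
    using r(2) unfolding comp_def by (intro tendsto_rabs_zero) (simp add: LIM_zero)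
  ultimately have "(\<lambda>n. d (p (r n)) q) \<longlonglongrightarrow> 0" by simp
  with q(1) r(1) show thesis by (rule that)
qed

end

section \<open>Cocompactness and properness of the action\<close>

locale fg_tree_action = tree_action +
  fixes X and x0
  assumes finite_gens: "finite X" and gens_in: "X \<subseteq> carrier G" and gens: "generate G X = carrier G"
    and gens_nonempty: "X \<noteq> {}" and base_in: "x0 \<in> M"
begin

text \<open>A compact star of finitely many segments whose translates cover the tree
  (\<open>cover\<close>); it serves as a coarse fundamental domain.\<close>

definition K where "K = {p. \<exists>s \<in> X. btw x0 p (\<phi> s x0)}"

lemma K_in: "K \<subseteq> M" unfolding K_def by (auto dest: btw_in)

lemma base_in_K: "x0 \<in> K"
proof -
  obtain s where "s \<in> X" using gens_nonempty by blast
  then have "btw x0 x0 (\<phi> s x0)" using gens_in base_in act_in by auto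
  with \<open>s \<in> X\<close> show ?thesis unfolding K_def by blast
qed

text \<open>For a product, the segment from \<open>x0\<close> to
  \<open>\<phi> (h1 \<otimes> h2) x0\<close> is covered by the one to \<open>\<phi> h1 x0\<close>
  and the translate by \<open>h1\<close> of the one to \<open>\<phi> h2 x0\<close>.\<close>

lemma cover_segment:
  assumes "h \<in> generate G X"
  shows "\<forall>y. btw x0 y (\<phi> h x0) \<longrightarrow> (\<exists>g \<in> carrier G. \<exists>k \<in> K. y = \<phi> g k)"
  using assms
proof (induction rule: generate.induct)
  case one
  show ?case
  proof (intro allI impI)
    fix y assume "btw x0 y (\<phi> \<one> x0)"
    then have "y = x0" using btw_same_ends act_one base_in by auto
    then show "\<exists>g \<in> carrier G. \<exists>k \<in> K. y = \<phi> g k"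
      using act_one base_in base_in_K by (intro bexI[of _ "\<one>"] bexI[of _ x0]) auto
  qed
next
  case (incl h)
  show ?case
  proof (intro allI impI)
    fix y assume y: "btw x0 y (\<phi> h x0)"
    then have "y \<in> K" using incl unfolding K_def by auto
    then show "\<exists>g \<in> carrier G. \<exists>k \<in> K. y = \<phi> g k"
      using act_one K_in by (intro bexI[of _ "\<one>"] bexI[of _ y]) auto
  qed
next
  case (inv h)
  have h: "h \<in> carrier G" using inv gens_in by auto
  show ?case
  proof (intro allI impI)
    fix y assume y: "btw x0 y (\<phi> (inv h) x0)"
    have y_in: "y \<in> M" using btw_in[OF y] by auto
    have "btw (\<phi> h x0) (\<phi> h y) x0"
      using act_btw[OF y h] h base_in by simp
    from btw_sym[OF this] have "\<phi> h y \<in> K" unfolding K_def using inv by auto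
    then show "\<exists>g \<in> carrier G. \<exists>k \<in> K. y = \<phi> g k"
      using h y_in by (intro bexI[of _ "inv h"] bexI[of _ "\<phi> h y"]) auto
  qed
next
  case (eng h1 h2)
  have h: "h1 \<in> carrier G" "h2 \<in> carrier G"
    using eng generate_in_carrier[OF gens_in] by auto
  show ?case
  proof (intro allI impI)
    fix y assume y: "btw x0 y (\<phi> (h1 \<otimes> h2) x0)"
    have y_in: "y \<in> M" using btw_in[OF y] by auto
    have "\<phi> h1 x0 \<in> M" using h base_in act_in by auto
    from btw_split[OF y this] show "\<exists>g \<in> carrier G. \<exists>k \<in> K. y = \<phi> g k"
    proof
      assume "btw (\<phi> h1 x0) y x0"
      from eng.IH(1)[rule_format, OF btw_sym[OF this]] show ?thesis .
    next
      assume "btw (\<phi> h1 x0) y (\<phi> (h1 \<otimes> h2) x0)"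
      from act_btw[OF this, of "inv h1"]
      have "btw x0 (\<phi> (inv h1) y) (\<phi> h2 x0)"
        using h base_in act_in by (simp add: act_mult)
      from eng.IH(2)[rule_format, OF this]
      obtain g k where gk: "g \<in> carrier G" "k \<in> K" "\<phi> (inv h1) y = \<phi> g k"
        by (elim bexE)
      have "y = \<phi> h1 (\<phi> (inv h1) y)" using h y_in by simp
      also have "\<dots> = \<phi> (h1 \<otimes> g) k" using gk h K_in by (simp add: act_mult subset_iff)
      finally show ?thesis using gk(1,2) h m_closed by (intro bexI[of _ "h1 \<otimes> g"] bexI[of _ k])
    qed
  qed
qed

lemma cover:
  assumes "y \<in> M"
  obtains g k where "g \<in> carrier G" "k \<in> K" "y = \<phi> g k"
proof -
  obtain h where "h \<in> carrier G" "btw x0 y (\<phi> h x0)" using orbit_hull[OF base_in assms] by auto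
  then have "\<exists>g \<in> carrier G. \<exists>k \<in> K. y = \<phi> g k"
    using cover_segment[of h] gens by simp
  then show thesis using that by (elim bexE)
qed

lemma K_net:
  assumes "e > 0"
  obtains F where "finite F" "F \<subseteq> M" "\<And>p. p \<in> K \<Longrightarrow> \<exists>q \<in> F. d p q \<le> e"
proof -
  have "\<exists>F. finite F \<and> F \<subseteq> M \<and> (\<forall>p. btw x0 p (\<phi> s x0) \<longrightarrow> (\<exists>q \<in> F. d p q \<le> e))" if "s \<in> X" for s
  proof -
    have "\<phi> s x0 \<in> M" using that gens_in act_in base_in by auto
    from segment_net[OF base_in this assms] show ?thesis .
  qed
  then obtain F where F: "\<And>s. s \<in> X \<Longrightarrow> finite (F s) \<and> F s \<subseteq> M \<and>
    (\<forall>p. btw x0 p (\<phi> s x0) \<longrightarrow> (\<exists>q \<in> F s. d p q \<le> e))" by metis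
  show thesis
  proof (rule that[of "\<Union> (F ` X)"])
    show "finite (\<Union> (F ` X))" using F finite_gens by auto
    show "\<Union> (F ` X) \<subseteq> M" using F by auto
    show "\<exists>q \<in> \<Union> (F ` X). d p q \<le> e" if "p \<in> K" for p
      using that F unfolding K_def by blast
  qed
qed

lemma K_seq_compact:
  fixes p :: "nat \<Rightarrow> 'a"
  assumes "\<And>n. p n \<in> K"
  obtains q r where "q \<in> K" "strict_mono r" "(\<lambda>n. d (p (r n)) q) \<longlonglongrightarrow> 0"
proof -
  have "\<forall>n. \<exists>s \<in> X. btw x0 (p n) (\<phi> s x0)" using assms by (auto simp: K_def)
  then obtain s where s: "\<And>n. s n \<in> X" "\<And>n. btw x0 (p n) (\<phi> (s n) x0)" by metis
  have "finite (s ` UNIV)" using s(1) finite_gens by (auto intro: finite_subset)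
  then obtain n0 where "infinite {n. s n = s n0}"
    using pigeonhole_infinite[of UNIV s] by auto
  then obtain r1 :: "nat \<Rightarrow> nat" where r1: "strict_mono r1" "\<And>n. r1 n \<in> {n. s n = s n0}"
    using infinite_enumerate by blast
  have "btw x0 (p (r1 n)) (\<phi> (s n0) x0)" for n
    using s(2)[of "r1 n"] r1(2)[of n] by simp
  from segment_seq_compact[of x0 "\<lambda>n. p (r1 n)", OF this]
  obtain q r2 where q: "btw x0 q (\<phi> (s n0) x0)" "strict_mono r2" "(\<lambda>n. d (p (r1 (r2 n))) q) \<longlonglongrightarrow> 0" .
  show thesis
  proof (rule that[of q "r1 \<circ> r2"])
    show "q \<in> K" using q(1) s(1) by (auto simp: K_def)
    show "strict_mono (r1 \<circ> r2)" using r1(1) q(2) by (rule strict_mono_o)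
    show "(\<lambda>n. d (p ((r1 \<circ> r2) n)) q) \<longlonglongrightarrow> 0" using q(3) by simp
  qed
qed

text \<open>Discreteness bounds displacements from below at each point; compactness of
  \<open>K\<close> makes the bound uniform. Otherwise points of \<open>K\<close> displaced less and
  less accumulate at a point that violates its own bound.\<close>

lemma uniformly_free:
  obtains e where "e > 0" "\<And>y g. y \<in> M \<Longrightarrow> g \<in> carrier G \<Longrightarrow> d y (\<phi> g y) < e \<Longrightarrow> g = \<one>"
proof (rule ccontr)
  assume no: "\<not> thesis"
  have "\<exists>k g. k \<in> K \<and> g \<in> carrier G \<and> g \<noteq> \<one> \<and> d k (\<phi> g k) < inverse (real (Suc n))" for n
  proof (rule ccontr)
    assume a: "\<not> ?thesis"
    have "g = \<one>" if y: "y \<in> M" and g: "g \<in> carrier G" and "d y (\<phi> g y) < inverse (real (Suc n))" for y g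
    proof -
      \<comment> \<open>Displacements are invariant under conjugation, so the point may be moved
        into \<open>K\<close>.\<close>
      obtain h k where hk: "h \<in> carrier G" "k \<in> K" "y = \<phi> h k" using cover[OF y] .
      then have k: "k \<in> M" using K_in by auto
      let ?g = "inv h \<otimes> g \<otimes> h"
      have "d k (\<phi> ?g k) = d (\<phi> h k) (\<phi> h (\<phi> ?g k))" using hk k g act_in act_dist by simp
      also have "\<phi> h (\<phi> ?g k) = \<phi> (h \<otimes> ?g) k" using hk k g by (simp add: act_mult)
      also have "h \<otimes> ?g = g \<otimes> h" using hk(1) g by (simp add: m_assoc[symmetric])
      also have "\<phi> (g \<otimes> h) k = \<phi> g y" using hk k g by (simp add: act_mult)
      finally have "d k (\<phi> ?g k) < inverse (real (Suc n))" using that(3) hk(3) by simp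
      moreover have "?g \<in> carrier G" using hk(1) g by simp
      ultimately have "?g = \<one>" using a hk(2) by blast
      then have "\<phi> ?g k = k" using act_one k by simp
      then have "\<phi> g y = y"
        using \<open>\<phi> h (\<phi> ?g k) = \<phi> (h \<otimes> ?g) k\<close> \<open>h \<otimes> ?g = g \<otimes> h\<close> \<open>\<phi> (g \<otimes> h) k = \<phi> g y\<close> hk(3) by simp
      then show ?thesis using act_free g y by blast
    qed
    then show False using no that[of "inverse (real (Suc n))"] by (metis inverse_positive_iff_positive of_nat_0_less_iff zero_less_Suc)
  qed
  then obtain k g where kg: "\<And>n. k n \<in> K" "\<And>n. g n \<in> carrier G" "\<And>n. g n \<noteq> \<one>"
    "\<And>n. d (k n) (\<phi> (g n) (k n)) < inverse (real (Suc n))" by metis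
  obtain q r where q: "q \<in> K" "strict_mono r" "(\<lambda>n. d (k (r n)) q) \<longlonglongrightarrow> 0"
    using K_seq_compact[of k, OF kg(1)] .
  have q_in: "q \<in> M" using q K_in by auto
  obtain e where e: "e > 0" "\<And>h. h \<in> carrier G \<Longrightarrow> d q (\<phi> h q) < e \<Longrightarrow> h = \<one>"
    using act_discrete[OF q_in] by blast
  have "(\<lambda>n. inverse (real (Suc (r n)))) \<longlonglongrightarrow> 0"
    using LIMSEQ_subseq_LIMSEQ[OF LIMSEQ_inverse_real_of_nat q(2)] by (simp add: comp_def)
  then have "(\<lambda>n. 2 * d (k (r n)) q + inverse (real (Suc (r n)))) \<longlonglongrightarrow> 2 * 0 + 0"
    using q(3) by (intro tendsto_intros)
  then have "\<forall>\<^sub>F n in sequentially. 2 * d (k (r n)) q + inverse (real (Suc (r n))) < e"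
    using e(1) by (intro order_tendstoD(2)) auto
  then obtain n where n: "2 * d (k (r n)) q + inverse (real (Suc (r n))) < e"
    by (auto simp: eventually_sequentially)
  let ?k = "k (r n)" and ?g = "g (r n)"
  have k_in: "?k \<in> M" using kg(1) K_in by blast
  have in_M: "?k \<in> M" "\<phi> ?g ?k \<in> M" "\<phi> ?g q \<in> M"
    using k_in act_in[OF kg(2) k_in] act_in[OF kg(2) q_in] by blast+
  have "d q (\<phi> ?g q) \<le> d q ?k + d ?k (\<phi> ?g ?k) + d (\<phi> ?g ?k) (\<phi> ?g q)"
    using dist_triangle4[OF q_in in_M] .
  also have "d (\<phi> ?g ?k) (\<phi> ?g q) = d ?k q" using act_dist kg(2) in_M(1) q_in by blast
  finally have "d q (\<phi> ?g q) < e" using n kg(4)[of "r n"] commute[of q ?k] by linarith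
  then show False using e(2) kg(2,3) by blast
qed

definition near where
  "near C = {g \<in> carrier G. \<exists>k \<in> K. \<exists>k' \<in> K. d k (\<phi> g k') \<le> C}"

lemma nearI: "g \<in> carrier G \<Longrightarrow> k \<in> K \<Longrightarrow> k' \<in> K \<Longrightarrow> d k (\<phi> g k') \<le> C \<Longrightarrow> g \<in> near C"
  by (auto simp: near_def)

lemma near_mono: "C \<le> C' \<Longrightarrow> near C \<subseteq> near C'"
proof
  fix g assume "C \<le> C'" "g \<in> near C"
  moreover from this obtain k k' where "g \<in> carrier G" "k \<in> K" "k' \<in> K" "d k (\<phi> g k') \<le> C"
    by (auto simp: near_def)
  ultimately show "g \<in> near C'" using nearI[of g k k' C'] by simp
qed

text \<open>A pigeonhole argument on a finite net of \<open>K\<close>: two elements that carry the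
  same net point close to the same net point differ by an element of tiny displacement, hence
  coincide.\<close>

lemma finite_near_small: obtains e where "e > 0" "finite (near e)"
proof -
  obtain D where D: "D > 0" "\<And>y g. y \<in> M \<Longrightarrow> g \<in> carrier G \<Longrightarrow> d y (\<phi> g y) < D \<Longrightarrow> g = \<one>"
    using uniformly_free by blast
  \<comment> \<open>Passing to net points costs \<open>e\<close> at either end, giving
    \<open>3 * e\<close> for one element and \<open>6 * e < D\<close> for the comparison of
    two.\<close>
  define e where "e = D / 8"
  have e: "e > 0" using D by (simp add: e_def)
  obtain F where F: "finite F" "F \<subseteq> M" "\<And>p. p \<in> K \<Longrightarrow> \<exists>q \<in> F. d p q \<le> e"
    using K_net[OF e] by blast
  have "\<exists>ab. ab \<in> F \<times> F \<and> d (fst ab) (\<phi> g (snd ab)) \<le> 3 * e" if g: "g \<in> near e" for g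
  proof -
    obtain k k' where k: "g \<in> carrier G" "k \<in> K" "k' \<in> K" "d k (\<phi> g k') \<le> e"
      using g by (auto simp: near_def)
    obtain a b where ab: "a \<in> F" "d k a \<le> e" "b \<in> F" "d k' b \<le> e" using F(3) k by meson
    have in_M: "a \<in> M" "b \<in> M" "k \<in> M" "k' \<in> M" using ab F(2) k K_in by auto
    have "d a (\<phi> g b) \<le> d a k + d k (\<phi> g k') + d (\<phi> g k') (\<phi> g b)"
      by (rule dist_triangle4) (use in_M k act_in in auto)
    then have "d a (\<phi> g b) \<le> 3 * e"
      using ab k act_dist[OF k(1) in_M(4,2)] commute[of a k] by linarith
    then show ?thesis using ab by (intro exI[of _ "(a, b)"]) auto
  qed
  then obtain f where f: "\<And>g. g \<in> near e \<Longrightarrow> f g \<in> F \<times> F \<and> d (fst (f g)) (\<phi> g (snd (f g))) \<le> 3 * e"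
    by metis
  have "inj_on f (near e)"
  proof (rule inj_onI)
    fix g h assume gh: "g \<in> near e" "h \<in> near e" "f g = f h"
    obtain a b where ab: "f g = (a, b)" by fastforce
    have in_G: "g \<in> carrier G" "h \<in> carrier G" using gh by (auto simp: near_def)
    have in_M: "a \<in> M" "b \<in> M" using f[OF gh(1)] ab F(2) by auto
    then have gb: "\<phi> g b \<in> M" "\<phi> h b \<in> M" using act_in in_G by auto
    have "d a (\<phi> g b) \<le> 3 * e" "d a (\<phi> h b) \<le> 3 * e" using f[OF gh(1)] f[OF gh(2)] gh(3) ab by auto
    then have "d (\<phi> g b) (\<phi> h b) \<le> 6 * e"
      using triangle[OF gb(1) in_M(1) gb(2)] commute[of a "\<phi> g b"] by linarith
    also have "d (\<phi> g b) (\<phi> h b) = d b (\<phi> (inv g \<otimes> h) b)"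
      using act_dist[of "inv g" "\<phi> g b" "\<phi> h b"] in_G in_M gb by (simp add: act_mult)
    finally have "d b (\<phi> (inv g \<otimes> h) b) < D" using D(1) by (simp add: e_def)
    then have "inv g \<otimes> h = \<one>" using D(2) in_M in_G by simp
    then show "g = h" using in_G by (metis inv_equality inv_inv inv_closed)
  qed
  moreover have "f ` near e \<subseteq> F \<times> F" using f by blast
  ultimately have "finite (near e)" using F(1) by (meson finite_SigmaI finite_imageD finite_subset)
  with e show thesis by (rule that)
qed

text \<open>Properness at every scale follows from the small scale: cut the segment from
  \<open>k\<close> to \<open>\<phi> g k'\<close> near its far end. The cut lies in some translate of
  \<open>K\<close> by \<open>h\<close>, and \<open>g\<close> is the product of \<open>h\<close> and
  \<open>inv h \<otimes> g\<close>, which are near at smaller scales.\<close>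

lemma finite_near: "finite (near C)"
proof -
  obtain e where e: "e > 0" "finite (near e)" using finite_near_small .
  have fin: "finite (near (real n * e))" for n
  proof (induction n)
    case 0
    have "near (real 0 * e) \<subseteq> near e" using e by (intro near_mono) simp
    then show ?case using e finite_subset by blast
  next
    case (Suc n)
    have "near (real (Suc n) * e) \<subseteq> (\<lambda>(g, h). g \<otimes> h) ` (near (real n * e) \<times> near e)"
    proof
      fix g assume "g \<in> near (real (Suc n) * e)"
      then obtain k k' where k: "g \<in> carrier G" "k \<in> K" "k' \<in> K" "d k (\<phi> g k') \<le> real (Suc n) * e"
        by (auto simp: near_def)
      have in_M: "k \<in> M" "\<phi> g k' \<in> M" "k' \<in> M" using k K_in act_in by auto
      \<comment> \<open>The minimum covers segments shorter than \<open>real n * e\<close>, which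
        are cut at their far end.\<close>
      define t where "t = min (real n * e) (d k (\<phi> g k'))"
      have t: "0 \<le> t" "t \<le> d k (\<phi> g k')" "t \<le> real n * e" using e by (auto simp: t_def)
      obtain p where p: "btw k p (\<phi> g k')" "d k p = t" "d p (\<phi> g k') = d k (\<phi> g k') - t"
        using btw_point[OF in_M(1,2) t(1,2)] .
      have le_e: "d p (\<phi> g k') \<le> e"
      proof (cases "real n * e \<le> d k (\<phi> g k')")
        case True
        then have "t = real n * e" by (simp add: t_def)
        then show ?thesis using p(3) k(4) by (simp add: algebra_simps)
      next
        case False
        then have "t = d k (\<phi> g k')" by (simp add: t_def)
        then show ?thesis using p(3) e by linarith
      qed
      have "p \<in> M" using btw_in[OF p(1)] by simp
      then obtain h l where hl: "h \<in> carrier G" "l \<in> K" "p = \<phi> h l" using cover by blast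
      have "h \<in> near (real n * e)" using nearI[OF hl(1) k(2) hl(2)] p(2) t(3) hl(3) by simp
      moreover have "inv h \<otimes> g \<in> near e"
      proof (rule nearI[OF _ hl(2) k(3)])
        show "inv h \<otimes> g \<in> carrier G" using hl k by simp
        have "d l (\<phi> (inv h \<otimes> g) k') = d p (\<phi> g k')"
          using act_dist[of "inv h" p "\<phi> g k'"] hl k in_M K_in \<open>p \<in> M\<close>
          by (simp add: act_mult subset_iff)
        then show "d l (\<phi> (inv h \<otimes> g) k') \<le> e" using le_e by simp
      qed
      moreover have "g = h \<otimes> (inv h \<otimes> g)" using hl(1) k(1) by (simp add: m_assoc[symmetric])
      ultimately show "g \<in> (\<lambda>(g, h). g \<otimes> h) ` (near (real n * e) \<times> near e)" by force
    qed
    then show ?case using Suc e(2) by (meson finite_SigmaI finite_imageI finite_subset)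
  qed
  obtain n where "C < real n * e" using reals_Archimedean3[OF e(1)] by blast
  then have "near C \<subseteq> near (real n * e)" by (intro near_mono) simp
  then show ?thesis using fin finite_subset by blast
qed

lemma finite_near_point:
  assumes "y \<in> M"
  shows "finite {g \<in> carrier G. \<exists>k \<in> K. d y (\<phi> g k) \<le> C}"
proof -
  obtain h l where hl: "h \<in> carrier G" "l \<in> K" "y = \<phi> h l" using cover[OF assms] .
  have "{g \<in> carrier G. \<exists>k \<in> K. d y (\<phi> g k) \<le> C} \<subseteq> (\<lambda>g. h \<otimes> g) ` near C"
  proof
    fix g assume "g \<in> {g \<in> carrier G. \<exists>k \<in> K. d y (\<phi> g k) \<le> C}"
    then obtain k where k: "g \<in> carrier G" "k \<in> K" "d y (\<phi> g k) \<le> C" by auto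
    have "l \<in> M" "k \<in> M" using hl k K_in by auto
    then have "d l (\<phi> (inv h \<otimes> g) k) = d y (\<phi> g k)"
      using act_dist[of "inv h" y "\<phi> g k"] hl k act_in by (simp add: act_mult)
    then have "inv h \<otimes> g \<in> near C" using nearI[of "inv h \<otimes> g" l k C] hl k by simp
    moreover have "g = h \<otimes> (inv h \<otimes> g)" using hl k by (simp add: m_assoc[symmetric])
    ultimately show "g \<in> (\<lambda>g. h \<otimes> g) ` near C" by blast
  qed
  then show ?thesis using finite_near finite_subset by blast
qed

end

section \<open>Local finiteness and the arcs of the tree\<close>

context fg_tree_action
begin

text \<open>The ends of the segments in those translates of \<open>K\<close> that come within
  distance 1 of \<open>K\<close>; the value 1 is arbitrary.\<close>

definition ends where
  "ends = (\<lambda>(g, y). \<phi> g y) ` (near 1 \<times> insert x0 ((\<lambda>s. \<phi> s x0) ` X))"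

lemma finite_ends: "finite ends"
  unfolding ends_def using finite_near finite_gens by (intro finite_imageI finite_SigmaI) auto

text \<open>Since \<^term>\<open>ends\<close> is finite, this yields the local finiteness of the tree.\<close>

lemma direction_end:
  assumes "v \<in> K" "a \<in> M" "a \<noteq> v"
  obtains f a' where "f \<in> ends" "a' \<noteq> v" "btw v a' a" "btw v a' f"
proof -
  have v: "v \<in> M" using assms K_in by auto
  have pos: "d v a > 0" using v assms by simp
  \<comment> \<open>Staying within distance 1 ensures that the translate of \<open>K\<close> through
    \<open>a'\<close> is counted by \<open>near 1\<close>.\<close>
  obtain a' where a': "btw v a' a" "d v a' = min 1 (d v a)"
    using btw_point[OF v assms(2), of "min 1 (d v a)"] pos by auto
  have "d v a' > 0" using a'(2) pos by simp
  then have ne: "a' \<noteq> v" using v by auto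
  have "a' \<in> M" using btw_in[OF a'(1)] by simp
  then obtain g k where gk: "g \<in> carrier G" "k \<in> K" "a' = \<phi> g k" using cover by blast
  have "g \<in> near 1" using nearI[OF gk(1) assms(1) gk(2)] a'(2) gk(3) by simp
  obtain s where s: "s \<in> X" "btw x0 k (\<phi> s x0)" using gk(2) by (auto simp: K_def)
  have "btw (\<phi> g x0) a' (\<phi> g (\<phi> s x0))" using act_btw[OF s(2) gk(1)] gk(3) by simp
  \<comment> \<open>\<open>a'\<close> lies inside a translated segment of \<open>K\<close>; seen
    from \<open>v\<close>, one of its two ends lies beyond \<open>a'\<close>.\<close>
  from btw_split[OF this v] show thesis
  proof
    assume "btw v a' (\<phi> g x0)"
    moreover have "\<phi> g x0 \<in> ends" unfolding ends_def using \<open>g \<in> near 1\<close> by force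
    ultimately show thesis using that ne a'(1) by metis
  next
    assume "btw v a' (\<phi> g (\<phi> s x0))"
    moreover have "\<phi> g (\<phi> s x0) \<in> ends" unfolding ends_def using \<open>g \<in> near 1\<close> s(1) by force
    ultimately show thesis using that ne a'(1) by metis
  qed
qed

text \<open>Only the direction at \<open>v\<close> matters: \<open>a\<close> and \<open>f\<close>
  share the nondegenerate initial piece up to \<open>a'\<close>, so one may replace the
  other.\<close>

lemma btw_replace_end:
  assumes "btw a v b" "btw v a' a" "a' \<noteq> v" "btw v a' f"
  shows "btw f v b"
proof -
  have "btw a a' v" using assms(2) by (rule btw_sym)
  with assms(1) have "btw a' v b" using btw_inner2 btw_sym by meson
  moreover have "btw f a' v" using assms(4) by (rule btw_sym)
  ultimately show ?thesis using btw_overlap(2) assms(3) by metis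
qed

text \<open>The three directions at a branch point can be represented by elements of
  \<open>ends\<close>. The branch point is then their median, and a triple has only one
  median.\<close>

lemma finite_branch_K: "finite (branch_points \<inter> K)"
proof -
  define m where "m = (\<lambda>(a, b, c). {v. btw a v b \<and> btw a v c \<and> btw b v c})"
  have fin: "finite (m t)" for t
  proof -
    obtain a b c where t: "t = (a, b, c)" by (cases t)
    have "v = w" if "v \<in> m t" "w \<in> m t" for v w
      using median_unique[of a v b c w] that unfolding m_def t by simp
    then have "m t = {} \<or> (\<exists>v. m t = {v})" by blast
    then show ?thesis by auto
  qed
  have "branch_points \<inter> K \<subseteq> (\<Union>t \<in> ends \<times> ends \<times> ends. m t)"
  proof
    fix v assume v: "v \<in> branch_points \<inter> K"
    then obtain a b c where abc: "a \<noteq> v" "b \<noteq> v" "c \<noteq> v" "btw a v b" "btw a v c" "btw b v c"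
      using branch_pointsE[of v] by blast
    have in_M: "a \<in> M" "b \<in> M" "c \<in> M" using abc by (auto dest: btw_in)
    have vK: "v \<in> K" using v by simp
    obtain fa a' where fa: "fa \<in> ends" "a' \<noteq> v" "btw v a' a" "btw v a' fa"
      using direction_end[OF vK in_M(1) abc(1)] .
    obtain fb b' where fb: "fb \<in> ends" "b' \<noteq> v" "btw v b' b" "btw v b' fb"
      using direction_end[OF vK in_M(2) abc(2)] .
    obtain fc c' where fc: "fc \<in> ends" "c' \<noteq> v" "btw v c' c" "btw v c' fc"
      using direction_end[OF vK in_M(3) abc(3)] .
    have 1: "btw fa v b" "btw fa v c" "btw fb v c"
      using btw_replace_end[OF abc(4) fa(3,2,4)] btw_replace_end[OF abc(5) fa(3,2,4)]
        btw_replace_end[OF abc(6) fb(3,2,4)] by auto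
    have 2: "btw fb v fa" "btw fc v fa" "btw fc v fb"
      using btw_replace_end[OF btw_sym[OF 1(1)] fb(3,2,4)]
        btw_replace_end[OF btw_sym[OF 1(2)] fc(3,2,4)]
        btw_replace_end[OF btw_sym[OF 1(3)] fc(3,2,4)] by auto
    have "v \<in> m (fa, fb, fc)" unfolding m_def using 2[THEN btw_sym] by simp
    then show "v \<in> (\<Union>t \<in> ends \<times> ends \<times> ends. m t)" using fa(1) fb(1) fc(1) by blast
  qed
  moreover have "finite (\<Union>t \<in> ends \<times> ends \<times> ends. m t)" using finite_ends fin by auto
  ultimately show ?thesis by (rule finite_subset)
qed

lemma branch_orbit_K:
  assumes "v \<in> branch_points"
  obtains g k where "g \<in> carrier G" "k \<in> branch_points \<inter> K" "v = \<phi> g k"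
proof -
  have "v \<in> M" using assms branch_points_in by auto
  then obtain g k where gk: "g \<in> carrier G" "k \<in> K" "v = \<phi> g k" using cover by blast
  have "k \<in> M" using gk K_in by auto
  then have "k \<in> branch_points" using act_branch_point[OF assms, of "inv g"] gk by simp
  then show thesis using that gk by blast
qed

text \<open>Distinct arcs at \<open>v\<close> leave in distinct directions by
  \<open>arc_turn\<close>, and so lead to distinct elements of the finite set
  \<open>ends\<close>.\<close>

lemma finite_arcs_at_K:
  assumes "v \<in> K"
  shows "finite {w. (v, w) \<in> branch_arcs}"
proof -
  have "\<exists>f a'. f \<in> ends \<and> a' \<noteq> v \<and> btw v a' w \<and> btw v a' f" if "(v, w) \<in> branch_arcs" for w
  proof -
    note A = branch_arcsD[OF that]
    show ?thesis using direction_end[OF assms A(5)] A(3) by metis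
  qed
  then obtain f a' where f: "\<And>w. (v, w) \<in> branch_arcs \<Longrightarrow>
      f w \<in> ends \<and> a' w \<noteq> v \<and> btw v (a' w) w \<and> btw v (a' w) (f w)" by metis
  have "inj_on f {w. (v, w) \<in> branch_arcs}"
  proof (rule inj_onI, rule ccontr)
    fix w w' assume w: "w \<in> {w. (v, w) \<in> branch_arcs}" "w' \<in> {w. (v, w) \<in> branch_arcs}"
      "f w = f w'" "w \<noteq> w'"
    then have fw: "a' w \<noteq> v" "btw v (a' w) w" "btw v (a' w) (f w)"
      "a' w' \<noteq> v" "btw v (a' w') w'" "btw v (a' w') (f w)" using f[of w] f[of w'] by auto
    have "btw w v w'" using arc_turn[of v w w'] w by simp
    from btw_replace_end[OF this fw(2,1,3)] have "btw w' v (f w)" by (rule btw_sym)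
    from btw_replace_end[OF this fw(5,4,6)] have "v = f w" by (rule btw_same_ends)
    then have "a' w = v" using fw(3) btw_same_ends by auto
    with fw(1) show False by simp
  qed
  moreover have "f ` {w. (v, w) \<in> branch_arcs} \<subseteq> ends" using f by auto
  ultimately show ?thesis using finite_ends by (meson finite_imageD finite_subset)
qed

lemma finite_arcs_at:
  assumes "v \<in> branch_points"
  shows "finite {w. (v, w) \<in> branch_arcs}"
proof -
  obtain g k where gk: "g \<in> carrier G" "k \<in> branch_points \<inter> K" "v = \<phi> g k"
    using branch_orbit_K[OF assms] .
  have k: "k \<in> M" using gk K_in by auto
  have "{w. (v, w) \<in> branch_arcs} \<subseteq> \<phi> g ` {w. (k, w) \<in> branch_arcs}"
  proof
    fix w assume "w \<in> {w. (v, w) \<in> branch_arcs}"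
    then have w: "(v, w) \<in> branch_arcs" by simp
    then have "(k, \<phi> (inv g) w) \<in> branch_arcs"
      using act_branch_arc[OF w, of "inv g"] gk k by simp
    moreover have "w = \<phi> g (\<phi> (inv g) w)" using branch_arcsD[OF w] gk by simp
    ultimately show "w \<in> \<phi> g ` {w. (k, w) \<in> branch_arcs}" by blast
  qed
  then show ?thesis using finite_arcs_at_K gk finite_subset by blast
qed

lemma finite_branch_orbits: "finite (orbit G \<phi> ` branch_points)"
proof -
  have "orbit G \<phi> ` branch_points \<subseteq> orbit G \<phi> ` (branch_points \<inter> K)"
  proof
    fix O' assume "O' \<in> orbit G \<phi> ` branch_points"
    then obtain v where v: "v \<in> branch_points" "O' = orbit G \<phi> v" by blast
    obtain g k where gk: "g \<in> carrier G" "k \<in> branch_points \<inter> K" "v = \<phi> g k"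
      using branch_orbit_K[OF v(1)] .
    have k: "k \<in> M" using gk K_in by auto
    have "orbit G \<phi> v = orbit G \<phi> k"
    proof (intro equalityI subsetI)
      fix y assume "y \<in> orbit G \<phi> v"
      then obtain h where "h \<in> carrier G" "y = \<phi> h v" by (auto simp: orbit_def)
      then show "y \<in> orbit G \<phi> k"
        unfolding orbit_def using gk k by (auto simp: act_mult intro!: exI[of _ "h \<otimes> g"])
    next
      fix y assume "y \<in> orbit G \<phi> k"
      then obtain h where h: "h \<in> carrier G" "y = \<phi> h k" by (auto simp: orbit_def)
      then have "y = \<phi> (h \<otimes> inv g) v" using gk k act_in by (simp add: act_mult)
      then show "y \<in> orbit G \<phi> v"
        unfolding orbit_def using gk h by (auto intro!: exI[of _ "h \<otimes> inv g"])
    qed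
    with v gk show "O' \<in> orbit G \<phi> ` (branch_points \<inter> K)" by blast
  qed
  then show ?thesis using finite_branch_K by (meson finite_imageI finite_subset)
qed

lemma finite_arc_representatives: "finite {(v, w). v \<in> K \<and> (v, w) \<in> branch_arcs}"
proof -
  have "{(v, w). v \<in> K \<and> (v, w) \<in> branch_arcs} =
      (SIGMA v : branch_points \<inter> K. {w. (v, w) \<in> branch_arcs})"
    using branch_arcsD(1) by auto
  then show ?thesis using finite_branch_K finite_arcs_at_K by auto
qed

lemma arc_representative:
  assumes "(v, w) \<in> branch_arcs"
  obtains g a b where "g \<in> carrier G" "a \<in> K" "(a, b) \<in> branch_arcs" "v = \<phi> g a" "w = \<phi> g b"
proof -
  note A = branch_arcsD[OF assms]
  obtain g k where gk: "g \<in> carrier G" "k \<in> branch_points \<inter> K" "v = \<phi> g k"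
    using branch_orbit_K[OF A(1)] .
  have k: "k \<in> M" using gk K_in by auto
  have "(k, \<phi> (inv g) w) \<in> branch_arcs"
    using act_branch_arc[OF assms, of "inv g"] gk k by simp
  then show thesis using that[of g k "\<phi> (inv g) w"] gk A by simp
qed

text \<open>By properness only finitely many translates of \<open>K\<close> reach the ball about
  \<open>v\<close> whose radius is the length of the segment, and \<open>K\<close> contains finitely
  many branch points.\<close>

lemma finite_branch_segment:
  assumes "v \<in> M" "w \<in> M"
  shows "finite {z \<in> branch_points. btw v z w}"
proof -
  have "{z \<in> branch_points. btw v z w} \<subseteq> (\<lambda>(g, k). \<phi> g k) `
      ({g \<in> carrier G. \<exists>k \<in> K. d v (\<phi> g k) \<le> d v w} \<times> (branch_points \<inter> K))"
  proof
    fix z assume "z \<in> {z \<in> branch_points. btw v z w}"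
    then have z: "z \<in> branch_points" "btw v z w" by auto
    obtain g k where gk: "g \<in> carrier G" "k \<in> branch_points \<inter> K" "z = \<phi> g k"
      using branch_orbit_K[OF z(1)] .
    have "d v (\<phi> g k) \<le> d v w" using btw_dist[OF z(2)] gk(3) nonneg[of z w] by simp
    then have "(g, k) \<in> {g \<in> carrier G. \<exists>k \<in> K. d v (\<phi> g k) \<le> d v w} \<times> (branch_points \<inter> K)"
      using gk by blast
    then show "z \<in> (\<lambda>(g, k). \<phi> g k) `
      ({g \<in> carrier G. \<exists>k \<in> K. d v (\<phi> g k) \<le> d v w} \<times> (branch_points \<inter> K))"
      using gk(3) by (intro image_eqI[of _ _ "(g, k)"]) simp_all
  qed
  then show ?thesis
    using finite_near_point[OF assms(1)] finite_branch_K
    by (meson finite_SigmaI finite_imageI finite_subset)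
qed

text \<open>Finiteness provides a nearest branch point to \<open>v\<close> on the way to
  \<open>w\<close>; nearest means that no branch point lies in between.\<close>

lemma first_arc:
  assumes "v \<in> branch_points" "w \<in> branch_points" "v \<noteq> w"
  obtains u where "(v, u) \<in> branch_arcs" "btw v u w"
proof -
  let ?S = "{z \<in> branch_points. btw v z w} - {v}"
  have in_M: "v \<in> M" "w \<in> M" using assms branch_points_in by auto
  have S: "finite ?S" "?S \<noteq> {}" using finite_branch_segment[OF in_M] assms in_M by auto
  obtain u where u: "u \<in> ?S" "\<And>z. z \<in> ?S \<Longrightarrow> d v u \<le> d v z"
    by (rule that[OF arg_min_if_finite(1)[OF S, of "d v"] arg_min_least[OF S, of _ "d v"]])
  have "z = v \<or> z = u" if z: "z \<in> branch_points" "btw v z u" for z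
  proof (rule disjCI)
    assume "z \<noteq> u"
    show "z = v"
    proof (rule ccontr)
      assume "z \<noteq> v"
      have "btw v z w" using btw_inner1[OF _ z(2)] u(1) by auto
      then have "d v u \<le> d v z" using u(2) z(1) \<open>z \<noteq> v\<close> by auto
      then have "d z u = 0" using btw_dist[OF z(2)] nonneg[of z u] by linarith
      then show False using \<open>z \<noteq> u\<close> btw_in[OF z(2)] by simp
    qed
  qed
  then have "(v, u) \<in> branch_arcs" unfolding branch_arcs_def using u(1) assms(1) by auto
  then show thesis using that u(1) by auto
qed

text \<open>There are no dead ends. Some direction at \<open>v\<close> points away from
  \<open>u\<close>, and \<open>orbit_hull\<close> prolongs it to a translate of \<open>v\<close>.
  This is again a branch point, so \<open>first_arc\<close> yields an arc in that direction.\<close>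

lemma arc_continue:
  assumes "(u, v) \<in> branch_arcs"
  obtains w where "(v, w) \<in> branch_arcs" "w \<noteq> u"
proof -
  note A = branch_arcsD[OF assms]
  obtain a b c where abc: "a \<noteq> v" "b \<noteq> v" "c \<noteq> v" "btw a v b" "btw a v c" "btw b v c"
    by (rule branch_pointsE[OF A(2)])
  from btw_split[OF abc(4) A(4)] have "\<exists>a. a \<in> M \<and> a \<noteq> v \<and> btw u v a"
  proof
    assume "btw u v a"
    then show ?thesis using btw_in(3) abc(1) by (intro exI[of _ a] conjI)
  next
    assume "btw u v b"
    then show ?thesis using btw_in(3) abc(2) by (intro exI[of _ b] conjI)
  qed
  then obtain a where a: "a \<in> M" "a \<noteq> v" "btw u v a" by (elim exE conjE)
  obtain g where g: "g \<in> carrier G" "btw v a (\<phi> g v)" using orbit_hull[OF A(5) a(1)] by blast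
  have far: "btw u v (\<phi> g v)" using btw_overlap(1)[OF a(3) g(2)] a(2) by blast
  have "\<phi> g v \<noteq> v" using g(2) a(2) btw_same_ends by auto
  then obtain w where w: "(v, w) \<in> branch_arcs" "btw v w (\<phi> g v)"
    using first_arc[OF A(2) act_branch_point[OF A(2) g(1)]] by metis
  have "w \<noteq> u"
  proof
    assume "w = u"
    with w(2) have "btw (\<phi> g v) u v" by (simp add: btw_sym)
    moreover have "btw (\<phi> g v) v u" using far by (rule btw_sym)
    ultimately have "u = v" by (rule btw_antisym)
    then show False using A(3) by simp
  qed
  with w(1) show thesis by (rule that)
qed

end

section \<open>Actions on trees without branch points\<close>

context tree_action
begin

text \<open>Without branch points the tree embeds isometrically into the real line, and a fixed-point free
  isometric action on a convex part of the line is by translations.\<close>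

lemma commute_if_no_branch_points:
  assumes nb: "branch_points = {}" and gh: "g \<in> carrier G" "h \<in> carrier G"
  shows "g \<otimes> h = h \<otimes> g"
proof -
  obtain x where x: "x \<in> M" using nonempty by blast
  show ?thesis
  proof (cases "\<forall>y \<in> M. y = x")
    case True
    then have "\<phi> g x = x" "\<phi> h x = x" using act_in[OF gh(1) x] act_in[OF gh(2) x] by blast+
    then have "g = \<one>" "h = \<one>" using act_free[OF gh(1) x] act_free[OF gh(2) x] by blast+
    then show ?thesis by simp
  next
    case False
    then obtain p where p: "p \<in> M" "p \<noteq> x" by blast
    \<comment> \<open>The median of three points is not a branch point, so it must be one of the
      three.\<close>
    have lin: "btw b a c \<or> btw a b c \<or> btw a c b" if abc: "a \<in> M" "b \<in> M" "c \<in> M" for a b c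
    proof -
      obtain q where q: "btw a q b" "btw a q c" "btw b q c" using median[OF abc] .
      have "q \<notin> branch_points" using nb by simp
      then have "q = a \<or> q = b \<or> q = c" using median_branch_point[OF q] by metis
      then show ?thesis using q by auto
    qed
    \<comment> \<open>The signed distance from \<open>x\<close>, positive on the side of
      \<open>p\<close>.\<close>
    define \<iota> where "\<iota> y = (if btw p x y then - d x y else d x y)" for y
    have iso: "d y z = \<bar>\<iota> y - \<iota> z\<bar>" if y: "y \<in> M" and z: "z \<in> M" for y z
    proof -
      have same: "d y z = \<bar>d x y - d x z\<bar>" if not: "\<not> btw y x z"
      proof -
        have "btw x y z \<or> btw x z y" using lin[OF x y z] not by blast
        then show ?thesis
        proof
          assume "btw x y z"
          then show ?thesis using btw_dist[of x y z] nonneg[of y z] by linarith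
        next
          assume "btw x z y"
          then show ?thesis using btw_dist[of x z y] nonneg[of z y] commute[of z y] by linarith
        qed
      qed
      consider (both) "btw p x y" "btw p x z" | (none) "\<not> btw p x y" "\<not> btw p x z"
        | (left) "btw p x y" "\<not> btw p x z" | (right) "\<not> btw p x y" "btw p x z" by blast
      then show ?thesis
      proof cases
        case both
        show ?thesis
        proof (cases "y = x \<or> z = x")
          case True
          then show ?thesis
          proof
            assume "y = x" then show ?thesis using both x z by (simp add: \<iota>_def)
          next
            assume "z = x" then show ?thesis using both x y commute[of x y] by (simp add: \<iota>_def)
          qed
        next
          case False
          have "\<not> btw y x z"
          proof
            assume "btw y x z"
            then have "x \<in> branch_points"
              using median_branch_point[OF both] p(2) False by metis
            then show False using nb by simp
          qed
          then show ?thesis using same both by (simp add: \<iota>_def)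
        qed
      next
        case none
        have "\<not> btw y x z" using btw_split[of y x z p] none p(1) by blast
        then show ?thesis using same none by (simp add: \<iota>_def)
      next
        case left
        have "\<not> btw z x p" using left(2) btw_sym[of z x p] by metis
        then have "btw z x y" using btw_split[OF left(1) z] by metis
        then have "d z y = d z x + d x y" by (rule btw_dist)
        moreover have "\<iota> y = - d x y" "\<iota> z = d x z" using left by (simp_all add: \<iota>_def)
        ultimately show ?thesis
          using commute[of z y] commute[of z x] nonneg[of z x] nonneg[of x y] by linarith
      next
        case right
        have "\<not> btw y x p" using right(1) btw_sym[of y x p] by metis
        then have "btw y x z" using btw_split[OF right(2) y] by metis
        then have "d y z = d y x + d x z" by (rule btw_dist)
        moreover have "\<iota> z = - d x z" "\<iota> y = d x y" using right by (simp_all add: \<iota>_def)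
        ultimately show ?thesis
          using commute[of y x] nonneg[of y x] nonneg[of x z] by linarith
      qed
    qed
    have \<iota>x: "\<iota> x = 0" using x p by (simp add: \<iota>_def)
    \<comment> \<open>An isometry of a part of the line that is not a translation is a reflection.
      It then fixes the midpoint \<open>m\<close> of \<open>x\<close> and \<open>\<phi> k x\<close>,
      which belongs to the tree; freeness makes \<open>k\<close> trivial, a contradiction.\<close>
    have transl: "\<iota> (\<phi> k y) = \<iota> y + \<iota> (\<phi> k x)" if k: "k \<in> carrier G" and y: "y \<in> M" for k y
    proof (rule ccontr)
      assume not: "\<not> ?thesis"
      let ?c = "\<iota> (\<phi> k x)"
      have iso': "\<bar>\<iota> (\<phi> k u) - \<iota> (\<phi> k v)\<bar> = \<bar>\<iota> u - \<iota> v\<bar>" if uv: "u \<in> M" "v \<in> M" for u v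
        using iso[OF act_in[OF k uv(1)] act_in[OF k uv(2)]] iso[OF uv] act_dist[OF k uv] by simp
      have y': "\<iota> (\<phi> k y) = ?c - \<iota> y" "\<iota> y \<noteq> 0"
        using iso'[OF y x] \<iota>x not by linarith+
      have refl: "\<iota> (\<phi> k w) = ?c - \<iota> w" if w: "w \<in> M" for w
        using iso'[OF w x] iso'[OF w y] y' \<iota>x by linarith
      have kx: "\<phi> k x \<in> M" using act_in k x .
      obtain m where m: "btw x m (\<phi> k x)" "d x m = d x (\<phi> k x) / 2"
        "d m (\<phi> k x) = d x (\<phi> k x) - d x (\<phi> k x) / 2"
        using btw_point[OF x kx, of "d x (\<phi> k x) / 2"] by auto
      have m_in: "m \<in> M" using btw_in[OF m(1)] by simp
      have "\<iota> m = ?c / 2"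
        using m(2,3) iso[OF x kx] iso[OF x m_in] iso[OF m_in kx] \<iota>x by linarith
      then have "d (\<phi> k m) m = 0" using iso[OF act_in[OF k m_in] m_in] refl[OF m_in] by simp
      then have "\<phi> k m = m" using act_in[OF k m_in] m_in by simp
      then have "k = \<one>" using act_free[OF k m_in] by simp
      then show False using not act_one x y \<iota>x by simp
    qed
    have in_M: "\<phi> g x \<in> M" "\<phi> h x \<in> M" using act_in gh x by auto
    have "\<iota> (\<phi> g (\<phi> h x)) = \<iota> (\<phi> h (\<phi> g x))"
      using transl[OF gh(1) in_M(2)] transl[OF gh(2) in_M(1)] by simp
    then have "d (\<phi> g (\<phi> h x)) (\<phi> h (\<phi> g x)) = 0"
      using iso act_in gh in_M by simp
    then have "\<phi> g (\<phi> h x) = \<phi> h (\<phi> g x)" using act_in gh in_M by simp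
    then have "\<phi> (g \<otimes> h) x = \<phi> (h \<otimes> g) x" using act_mult gh x by simp
    then show ?thesis using act_eq gh x m_closed by metis
  qed
qed

end

section \<open>The centre of a free group\<close>

context group
begin

lemma word_value_Cons:
  "word_value G ((x, b) # w) = (if b then x else inv x) \<otimes> word_value G w"
  by (simp add: word_value_def)

lemma word_value_Nil [simp]: "word_value G [] = \<one>"
  by (simp add: word_value_def)

lemma word_value_closed: "fst ` set w \<subseteq> carrier G \<Longrightarrow> word_value G w \<in> carrier G"
proof (induction w)
  case (Cons a w)
  obtain x b where "a = (x, b)" by (cases a)
  with Cons show ?case by (simp add: word_value_Cons)
qed simp

lemma word_value_append:
  "fst ` set u \<subseteq> carrier G \<Longrightarrow> fst ` set v \<subseteq> carrier G \<Longrightarrow>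
    word_value G (u @ v) = word_value G u \<otimes> word_value G v"
proof (induction u)
  case Nil
  then show ?case by (simp add: word_value_closed)
next
  case (Cons a u)
  obtain x b where "a = (x, b)" by (cases a)
  with Cons show ?case by (simp add: word_value_Cons word_value_closed m_assoc)
qed

definition inverse_word :: "('a \<times> bool) list \<Rightarrow> ('a \<times> bool) list" where
  "inverse_word w = rev (map (\<lambda>(x, b). (x, \<not> b)) w)"

lemma inverse_word_letters: "fst ` set (inverse_word w) = fst ` set w"
  by (force simp: inverse_word_def)

lemma word_value_inverse:
  "fst ` set w \<subseteq> carrier G \<Longrightarrow> word_value G (inverse_word w) = inv (word_value G w)"
proof (induction w)
  case Nil
  then show ?case by (simp add: inverse_word_def)
next
  case (Cons a w)
  obtain x b where a: "a = (x, b)" by (cases a)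
  have x: "x \<in> carrier G" and w: "fst ` set w \<subseteq> carrier G" using Cons.prems a by auto
  have "inverse_word (a # w) = inverse_word w @ [(x, \<not> b)]" by (simp add: inverse_word_def a)
  then have "word_value G (inverse_word (a # w)) = inv (word_value G w) \<otimes> word_value G [(x, \<not> b)]"
    using Cons.IH[OF w] x w inverse_word_letters[of w] by (simp add: word_value_append)
  also have "\<dots> = inv (word_value G (a # w))"
    using x word_value_closed[OF w] by (simp add: a word_value_Cons inv_mult_group)
  finally show ?case .
qed

lemma reduced_inverse_word: "reduced_word w \<Longrightarrow> reduced_word (inverse_word w)"
  unfolding reduced_word_def inverse_word_def
  by (simp add: successively_map case_prod_unfold successively_mono)

lemma not_successively_split:
  "\<not> successively P w \<Longrightarrow> \<exists>u a b v. w = u @ [a, b] @ v \<and> \<not> P a b"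
proof (induction w rule: induct_list012)
  case (3 a b w)
  show ?case
  proof (cases "P a b")
    case True
    then have "\<not> successively P (b # w)" using 3 by simp
    then obtain u c e v where "b # w = u @ [c, e] @ v" "\<not> P c e" using 3 by blast
    then show ?thesis by (intro exI[of _ "a # u"] exI[of _ c] exI[of _ e] exI[of _ v]) simp
  next
    case False
    then show ?thesis by (intro exI[of _ "[]"] exI[of _ a] exI[of _ b] exI[of _ w]) simp
  qed
qed auto

lemma ex_word:
  assumes "X \<subseteq> carrier G" "g \<in> generate G X"
  shows "\<exists>w. fst ` set w \<subseteq> X \<and> word_value G w = g"
  using assms(2)
proof (induction rule: generate.induct)
  case one
  show ?case by (intro exI[of _ "[]"]) simp
next
  case (incl h)
  then show ?case using assms(1) by (intro exI[of _ "[(h, True)]"]) (auto simp: word_value_Cons)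
next
  case (inv h)
  then show ?case using assms(1) by (intro exI[of _ "[(h, False)]"]) (auto simp: word_value_Cons)
next
  case (eng h1 h2)
  then obtain w1 w2 where w: "fst ` set w1 \<subseteq> X" "word_value G w1 = h1"
    "fst ` set w2 \<subseteq> X" "word_value G w2 = h2" by auto
  then have "word_value G (w1 @ w2) = h1 \<otimes> h2"
    using word_value_append[of w1 w2] assms(1) by auto
  then show ?case using w by (intro exI[of _ "w1 @ w2"]) (auto simp: image_Un)
qed

text \<open>A shortest word is reduced, since two adjacent inverse letters could be
  cancelled.\<close>

lemma ex_reduced_word:
  assumes "X \<subseteq> carrier G" "g \<in> generate G X"
  shows "\<exists>w. fst ` set w \<subseteq> X \<and> word_value G w = g \<and> reduced_word w"
proof -
  define P where "P w \<longleftrightarrow> fst ` set w \<subseteq> X \<and> word_value G w = g" for w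
  have "\<exists>w. P w" using ex_word[OF assms] by (simp add: P_def)
  then obtain w where w: "P w" "\<And>w'. P w' \<Longrightarrow> length w \<le> length w'"
    using ex_has_least_nat[of P _ length] by blast
  have "reduced_word w"
  proof (rule ccontr)
    assume "\<not> reduced_word w"
    then obtain u a b v where split: "w = u @ [a, b] @ v"
      "\<not> (case a of (x, b) \<Rightarrow> \<lambda>(y, c). x = y \<longrightarrow> b = c) b"
      unfolding reduced_word_def using not_successively_split by blast
    then obtain x e where ab: "a = (x, e)" "b = (x, \<not> e)" by (auto split: prod.splits)
    have in_X: "fst ` set u \<subseteq> X" "fst ` set v \<subseteq> X" "x \<in> X"
      using w(1) split(1) ab by (auto simp: P_def)
    then have in_G: "fst ` set u \<subseteq> carrier G" "fst ` set v \<subseteq> carrier G" "x \<in> carrier G"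
      using assms(1) by auto
    have v_in: "word_value G v \<in> carrier G" by (rule word_value_closed[OF in_G(2)])
    have "word_value G ([a, b] @ v) = word_value G v"
      using in_G(3) v_in by (simp add: ab word_value_Cons m_assoc[symmetric])
    moreover have "word_value G w = word_value G u \<otimes> word_value G ([a, b] @ v)"
      unfolding split(1) by (rule word_value_append) (use in_G ab in auto)
    ultimately have "word_value G (u @ v) = word_value G w"
      using word_value_append[OF in_G(1,2)] by simp
    then have "P (u @ v)" using in_X w(1) by (simp add: P_def image_Un)
    from w(2)[OF this] show False by (simp add: split(1))
  qed
  with w(1) show ?thesis unfolding P_def by blast
qed

text \<open>A central \<open>z\<close> commutes with every basis element, so a commutator of
  \<open>z\<close> with a suitable letter is trivial. If \<open>z \<noteq> \<one>\<close>, that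
  commutator is spelled by a nonempty reduced word, which freeness forbids.\<close>

lemma free_basis_centerless:
  assumes basis: "free_basis G X" and two: "a \<in> X" "b \<in> X" "a \<noteq> b"
    and z: "z \<in> carrier G" and central: "\<And>s. s \<in> X \<Longrightarrow> s \<otimes> z = z \<otimes> s"
  shows "z = \<one>"
proof (rule ccontr)
  assume "z \<noteq> \<one>"
  have X: "X \<subseteq> carrier G" "generate G X = carrier G" using basis by (auto simp: free_basis_def)
  obtain w where w: "fst ` set w \<subseteq> X" "word_value G w = z" "reduced_word w"
    using ex_reduced_word[of X z] X z by auto
  have ne: "w \<noteq> []" using w(2) \<open>z \<noteq> \<one>\<close> by auto
  obtain x e where hd: "hd w = (x, e)" by fastforce
  obtain y c where last: "last w = (y, c)" by fastforce
  \<comment> \<open>A letter different from the last one of \<open>w\<close> cannot cancel at the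
    end of \<open>w\<close> or at the beginning of \<open>inverse_word w\<close>.\<close>
  obtain u where u: "u \<in> X" "u \<noteq> y" using two by metis
  have u_in: "u \<in> carrier G" using u X by auto
  have w_in: "fst ` set w \<subseteq> carrier G" using w X by auto
  have ne': "inverse_word w \<noteq> []" "hd (inverse_word w) = (y, \<not> c)"
    using ne last by (simp_all add: inverse_word_def hd_rev last_map)
  \<comment> \<open>The exponent of \<open>u\<close> is that of the first letter of
    \<open>w\<close>, so there is no cancellation there even if that letter is
    \<open>u\<close>.\<close>
  let ?W = "((u, e) # w) @ ((u, \<not> e) # inverse_word w)"
  have red: "reduced_word w" "reduced_word (inverse_word w)" using w(3) reduced_inverse_word by auto
  have "reduced_word ?W"
    unfolding reduced_word_def successively_append_iff successively_Cons
    using red[unfolded reduced_word_def] ne ne' hd last u(2) by simp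
  moreover have "fst ` set ?W \<subseteq> X" using w(1) u(1) inverse_word_letters[of w] by (simp add: image_Un)
  ultimately have "word_value G ?W \<noteq> \<one>" using basis unfolding free_basis_def by blast
  moreover have "word_value G ?W = \<one>"
  proof -
    define s where "s = (if e then u else inv u)"
    have s: "s \<in> carrier G" "s \<otimes> z = z \<otimes> s"
    proof -
      show "s \<in> carrier G" using u_in by (simp add: s_def)
      have "inv u \<otimes> z = z \<otimes> inv u"
      proof -
        have "inv u \<otimes> z = inv u \<otimes> (z \<otimes> u) \<otimes> inv u" using u_in z by (simp add: m_assoc)
        also have "\<dots> = inv u \<otimes> (u \<otimes> z) \<otimes> inv u" using central[OF u(1)] by simp
        also have "\<dots> = z \<otimes> inv u" using u_in z by (simp add: m_assoc[symmetric])
        finally show ?thesis .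
      qed
      then show "s \<otimes> z = z \<otimes> s" using central[OF u(1)] by (simp add: s_def)
    qed
    have inv_s: "(if \<not> e then u else inv u) = inv s" using u_in by (simp add: s_def)
    have "word_value G ?W = word_value G ((u, e) # w) \<otimes> word_value G ((u, \<not> e) # inverse_word w)"
      by (rule word_value_append) (use u_in w_in inverse_word_letters[of w] in auto)
    also have "\<dots> = (s \<otimes> z) \<otimes> (inv s \<otimes> inv z)"
      unfolding word_value_Cons inv_s word_value_inverse[OF w_in] w(2) by (simp add: s_def)
    also have "\<dots> = (s \<otimes> z) \<otimes> inv (z \<otimes> s)" using s z by (simp add: inv_mult_group)
    also have "\<dots> = \<one>" using s z by simp
    finally show ?thesis .
  qed
  ultimately show False by simp
qed

end

section \<open>Legal almost simple curves\<close>

lemma topological_edge_eq_iff: "topological_edge a = topological_edge b \<longleftrightarrow> b = a \<or> b = a\<inverse>"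
  unfolding topological_edge_def by (auto simp: doubleton_eq_iff)

lemma reverse_path_Nil_iff [simp]: "reverse_path p = [] \<longleftrightarrow> p = []"
  by (simp add: reverse_path_def)

lemma reverse_path_ends: "p \<noteq> [] \<Longrightarrow> hd (reverse_path p) = (last p)\<inverse>"
  "p \<noteq> [] \<Longrightarrow> last (reverse_path p) = (hd p)\<inverse>"
  by (simp_all add: reverse_path_def hd_rev last_rev last_map hd_map)

lemma set_reverse_path: "set (reverse_path p) = converse ` set p"
  by (simp add: reverse_path_def)

lemma topological_edges_append: "topological_edges (p @ q) = topological_edges p \<union> topological_edges q"
  by (auto simp: topological_edges_def)

lemma topological_edge_converse [simp]: "topological_edge (a\<inverse>) = topological_edge a"
  by (auto simp: topological_edge_def)

lemma topological_edges_reverse [simp]: "topological_edges (reverse_path p) = topological_edges p"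
  unfolding topological_edges_def set_reverse_path by (auto simp: image_image)

lemma distinct_append_edges:
  "distinct (map topological_edge (p @ q)) \<Longrightarrow> topological_edges p \<inter> topological_edges q = {}"
  by (simp add: topological_edges_def)

text \<open>This isolates what is used of the quotient graph, so that the search for almost simple
  curves is pure combinatorics, without the trees.\<close>

locale curve_graph = wf_digraph \<Gamma> for \<Gamma> :: "('a set, ('a \<times> 'a) set) pre_digraph" +
  assumes finite_verts: "finite (verts \<Gamma>)"
    and conv_in: "a \<in> arcs \<Gamma> \<Longrightarrow> a\<inverse> \<in> arcs \<Gamma>"
    and tail_conv: "a \<in> arcs \<Gamma> \<Longrightarrow> tail \<Gamma> (a\<inverse>) = head \<Gamma> a"
begin

lemma head_conv: "a \<in> arcs \<Gamma> \<Longrightarrow> head \<Gamma> (a\<inverse>) = tail \<Gamma> a"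
  using tail_conv[OF conv_in, of a] by simp

lemma distinct_tails_eq:
  "\<lbrakk>distinct (map (tail \<Gamma>) p); tail \<Gamma> (p ! i) = tail \<Gamma> (p ! j); i < length p; j < length p\<rbrakk> \<Longrightarrow> i = j"
  using nth_eq_iff_index_eq[of "map (tail \<Gamma>) p" i j] by simp

definition chain :: "('a \<times> 'a) set list \<Rightarrow> bool" where
  "chain p \<longleftrightarrow> set p \<subseteq> arcs \<Gamma> \<and> successively (\<lambda>a b. head \<Gamma> a = tail \<Gamma> b) p"

lemma chain_Cons: "chain (a # p) \<longleftrightarrow> a \<in> arcs \<Gamma> \<and> chain p \<and> (p \<noteq> [] \<longrightarrow> head \<Gamma> a = tail \<Gamma> (hd p))"
  by (cases p) (auto simp: chain_def)

lemma chain_awalk: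
  "chain p \<Longrightarrow> p \<noteq> [] \<Longrightarrow> awalk (tail \<Gamma> (hd p)) p (head \<Gamma> (last p))"
proof (induction p)
  case (Cons a p)
  then have a: "a \<in> arcs \<Gamma>" "chain p" by (simp_all add: chain_Cons)
  show ?case
  proof (cases "p = []")
    case True
    then show ?thesis using a by (auto simp: awalk_def)
  next
    case False
    then have "awalk (head \<Gamma> a) p (head \<Gamma> (last p))" using Cons by (simp add: chain_Cons)
    then show ?thesis using a False by (auto simp: awalk_def)
  qed
qed simp

lemma chain_nth: "chain p \<Longrightarrow> Suc i < length p \<Longrightarrow> tail \<Gamma> (p ! Suc i) = head \<Gamma> (p ! i)"
  unfolding chain_def successively_conv_nth by simp

lemma chain_heads: "chain p \<Longrightarrow> p \<noteq> [] \<Longrightarrow> map (head \<Gamma>) p = map (tail \<Gamma>) (tl p) @ [head \<Gamma> (last p)]"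
proof (induction p)
  case (Cons a p)
  then show ?case by (cases p) (auto simp: chain_Cons)
qed simp

definition reduced :: "('a \<times> 'a) set list \<Rightarrow> bool" where
  "reduced p \<longleftrightarrow> successively (\<lambda>a b. b \<noteq> a\<inverse>) p"

text \<open>An edge repeated in the same direction repeats its tail. If it recurs reversed, the
  later copy starts at the head of the earlier one, so by distinctness of tails it is the very next
  arc: a backtrack.\<close>

lemma distinct_edges:
  assumes "chain p" "reduced p" "distinct (map (tail \<Gamma>) p)"
  shows "distinct (map topological_edge p)"
  unfolding distinct_conv_nth
proof (intro allI impI)
  have lt: "topological_edge (p ! i) \<noteq> topological_edge (p ! j)" if ij: "i < j" "j < length p" for i j
  proof
    assume "topological_edge (p ! i) = topological_edge (p ! j)"
    then consider "p ! j = p ! i" | "p ! j = (p ! i)\<inverse>" by (auto simp: topological_edge_eq_iff)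
    then show False
    proof cases
      case 1
      then show False using distinct_tails_eq[OF assms(3), of j i] ij by simp
    next
      case 2
      have "p ! i \<in> arcs \<Gamma>" using assms(1) ij by (auto simp: chain_def subset_iff)
      then have "tail \<Gamma> (p ! j) = tail \<Gamma> (p ! Suc i)"
        using 2 tail_conv chain_nth[OF assms(1), of i] ij by simp
      then have "j = Suc i" using distinct_tails_eq[OF assms(3), of j "Suc i"] ij by simp
      then show False using 2 assms(2) ij by (auto simp: reduced_def successively_conv_nth)
    qed
  qed
  fix i j assume "i < length (map topological_edge p)" "j < length (map topological_edge p)" "i \<noteq> j"
  then show "map topological_edge p ! i \<noteq> map topological_edge p ! j"
    using lt[of i j] lt[of j i] by (cases "i < j") auto
qed

lemma simple_circuitI:
  assumes "chain p" "p \<noteq> []" "head \<Gamma> (last p) = tail \<Gamma> (hd p)" "distinct (map (tail \<Gamma>) p)" "reduced p"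
  shows "simple_circuit_at \<Gamma> (tail \<Gamma> (hd p)) p"
proof -
  have "awalk (tail \<Gamma> (hd p)) p (tail \<Gamma> (hd p))" using chain_awalk[OF assms(1,2)] assms(3) by simp
  moreover have "distinct (tl (awalk_verts (tail \<Gamma> (hd p)) p))"
    using assms(2,3,4) by (cases p) (auto simp: awalk_verts_conv)
  ultimately show ?thesis
    unfolding simple_circuit_at_def using assms distinct_edges by blast
qed

lemma tails_reverse:
  assumes "chain c" "c \<noteq> []"
  shows "map (tail \<Gamma>) (reverse_path c) = rev (map (tail \<Gamma>) (tl c) @ [head \<Gamma> (last c)])"
proof -
  have "map (tail \<Gamma>) (map converse c) = map (head \<Gamma>) c"
    using assms(1) tail_conv by (auto simp: chain_def)
  then show ?thesis unfolding reverse_path_def rev_map[symmetric] chain_heads[OF assms, symmetric]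
    by (simp only:)
qed

text \<open>Every arc of \<open>q\<close> touches the complement of \<open>A\<close>, the first
  through its head. This fails for a path of a single arc, which may be a loop or chord of
  \<open>A\<close>; such paths are treated separately.\<close>

lemma disjoint_edges:
  assumes "chain q" "\<And>a. a \<in> set (tl q) \<Longrightarrow> tail \<Gamma> a \<notin> A" "length q \<ge> 2"
    and "set c \<subseteq> arcs \<Gamma>" "\<And>a. a \<in> set c \<Longrightarrow> tail \<Gamma> a \<in> A \<and> head \<Gamma> a \<in> A"
  shows "topological_edges q \<inter> topological_edges c = {}"
proof (rule ccontr)
  assume "\<not> ?thesis"
  then obtain a b where ab: "a \<in> set q" "b \<in> set c" "topological_edge a = topological_edge b"
    unfolding topological_edges_def by blast
  have b: "b \<in> arcs \<Gamma>" "tail \<Gamma> b \<in> A" "head \<Gamma> b \<in> A" using assms(4,5) ab(2) by auto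
  have "a = b \<or> a = b\<inverse>" using ab(3)[symmetric] by (simp add: topological_edge_eq_iff)
  then have a: "tail \<Gamma> a \<in> A" "head \<Gamma> a \<in> A" using b tail_conv head_conv by auto
  obtain x y q' where q: "q = x # y # q'" using assms(3) by (cases q; cases "tl q") auto
  show False
  proof (cases "a \<in> set (tl q)")
    case True
    then show False using assms(2) a by blast
  next
    case False
    then have "a = x" using ab(1) q by simp
    then have "head \<Gamma> a = tail \<Gamma> y" using assms(1) q by (simp add: chain_Cons)
    moreover have "tail \<Gamma> y \<notin> A" using assms(2)[of y] q by simp
    ultimately show False using a by simp
  qed
qed

end

text \<open>Outgoing arcs are grouped into gates; a turn is legal if it joins two different gates.\<close>

locale gated_graph = curve_graph +
  fixes \<Delta> :: "('a \<times> 'a) set set" and gate :: "('a \<times> 'a) set \<Rightarrow> ('a \<times> 'a) set \<Rightarrow> bool"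
  assumes \<Delta>_arcs: "\<Delta> \<subseteq> arcs \<Gamma>" and \<Delta>_conv: "a \<in> \<Delta> \<Longrightarrow> a\<inverse> \<in> \<Delta>"
    and gate_refl: "a \<in> \<Delta> \<Longrightarrow> gate a a"
    and gate_sym: "\<lbrakk>a \<in> \<Delta>; b \<in> \<Delta>; gate a b\<rbrakk> \<Longrightarrow> gate b a"
    and gate_trans: "\<lbrakk>a \<in> \<Delta>; b \<in> \<Delta>; c \<in> \<Delta>; gate a b; gate b c\<rbrakk> \<Longrightarrow> gate a c"
    and legal_continuation: "a \<in> \<Delta> \<Longrightarrow> \<exists>b \<in> \<Delta>. tail \<Gamma> b = head \<Gamma> a \<and> \<not> gate (a\<inverse>) b"
begin

definition legal :: "('a \<times> 'a) set \<Rightarrow> ('a \<times> 'a) set \<Rightarrow> bool" where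
  "legal a b \<longleftrightarrow> head \<Gamma> a = tail \<Gamma> b \<and> \<not> gate (a\<inverse>) b"

definition legal_path :: "('a \<times> 'a) set list \<Rightarrow> bool" where
  "legal_path p \<longleftrightarrow> set p \<subseteq> \<Delta> \<and> successively legal p"

definition legal_cycle :: "('a \<times> 'a) set list \<Rightarrow> bool" where
  "legal_cycle p \<longleftrightarrow> p \<noteq> [] \<and> legal_path p \<and> legal (last p) (hd p)"

lemma legal_path_chain: "legal_path p \<Longrightarrow> chain p"
  unfolding legal_path_def chain_def using \<Delta>_arcs
  by (auto simp: legal_def elim: successively_mono)

lemma legal_path_reduced: "legal_path p \<Longrightarrow> reduced p"
  unfolding legal_path_def reduced_def successively_conv_nth
proof (intro allI impI)
  fix i assume p: "set p \<subseteq> \<Delta> \<and> (\<forall>i. Suc i < length p \<longrightarrow> legal (p ! i) (p ! Suc i))" "Suc i < length p"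
  then have "p ! i \<in> \<Delta>" by (auto simp: subset_iff)
  then show "p ! Suc i \<noteq> (p ! i)\<inverse>" using p gate_refl \<Delta>_conv unfolding legal_def by metis
qed

lemma legal_path_append:
  "legal_path (p @ q) \<longleftrightarrow> legal_path p \<and> legal_path q \<and>
     (p \<noteq> [] \<longrightarrow> q \<noteq> [] \<longrightarrow> legal (last p) (hd q))"
  unfolding legal_path_def successively_append_iff by auto

lemma legal_converse: "\<lbrakk>a \<in> \<Delta>; b \<in> \<Delta>; legal a b\<rbrakk> \<Longrightarrow> legal (b\<inverse>) (a\<inverse>)"
  unfolding legal_def using \<Delta>_arcs head_conv[of b] tail_conv[of a] \<Delta>_conv gate_sym[of b "a\<inverse>"] by auto

lemma legal_path_reverse: "legal_path p \<Longrightarrow> legal_path (reverse_path p)"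
proof (induction p)
  case (Cons a p)
  then have a: "a \<in> \<Delta>" "legal_path p" "p \<noteq> [] \<Longrightarrow> legal a (hd p)"
    using legal_path_append[of "[a]" p] by (auto simp: legal_path_def)
  have "legal_path (reverse_path p @ [a\<inverse>])"
    unfolding legal_path_append
  proof (intro conjI impI)
    show "legal_path (reverse_path p)" using Cons.IH a(2) .
    show "legal_path [a\<inverse>]" using a \<Delta>_conv by (simp add: legal_path_def)
    assume "reverse_path p \<noteq> []"
    then have p: "p \<noteq> []" by simp
    then have "hd p \<in> \<Delta>" using a(2) by (auto simp: legal_path_def subset_iff)
    then show "legal (last (reverse_path p)) (hd [a\<inverse>])"
      using legal_converse[OF a(1) _ a(3)[OF p]] p by (simp add: reverse_path_ends)
  qed
  then show ?case by (simp add: reverse_path_def)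
qed (simp add: legal_path_def reverse_path_def)

lemma legal_path_take: "legal_path p \<Longrightarrow> legal_path (take i p)"
  and legal_path_drop: "legal_path p \<Longrightarrow> legal_path (drop i p)"
  using legal_path_append[of "take i p" "drop i p"] by auto

lemma legal_cycle_circuit:
  assumes "p \<noteq> []" "legal_path p" "legal (last p) (hd p)" "distinct (map (tail \<Gamma>) p)"
  shows "almost_simple_curve \<Gamma> p \<and> legal_cycle p"
proof
  have "simple_circuit_at \<Gamma> (tail \<Gamma> (hd p)) p"
    by (rule simple_circuitI[OF legal_path_chain[OF assms(2)] assms(1) _ assms(4) legal_path_reduced[OF assms(2)]])
      (use assms(3) in \<open>simp add: legal_def\<close>)
  then show "almost_simple_curve \<Gamma> p" unfolding almost_simple_curve_def by blast
  show "legal_cycle p" using assms by (simp add: legal_cycle_def)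
qed

lemma legal_cycle_eight:
  assumes c: "c \<noteq> []" "legal_path c" "distinct (map (tail \<Gamma>) c)"
    and e: "e \<noteq> []" "legal_path e" "distinct (map (tail \<Gamma>) e)"
    and turns: "legal (last c) (hd e)" "legal (last e) (hd c)" and same: "tail \<Gamma> (hd c) = tail \<Gamma> (hd e)"
    and disj: "topological_edges c \<inter> topological_edges e = {}"
  shows "almost_simple_curve \<Gamma> (c @ e) \<and> legal_cycle (c @ e)"
proof
  have "simple_circuit_at \<Gamma> (tail \<Gamma> (hd c)) c"
    by (rule simple_circuitI[OF legal_path_chain[OF c(2)] c(1) _ c(3) legal_path_reduced[OF c(2)]])
      (use turns same in \<open>simp add: legal_def\<close>)
  moreover have "simple_circuit_at \<Gamma> (tail \<Gamma> (hd e)) e"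
    by (rule simple_circuitI[OF legal_path_chain[OF e(2)] e(1) _ e(3) legal_path_reduced[OF e(2)]])
      (use turns same in \<open>simp add: legal_def\<close>)
  ultimately have "figure_eight_curve \<Gamma> (c @ e)"
    unfolding figure_eight_curve_def using disj same by metis
  then show "almost_simple_curve \<Gamma> (c @ e)" unfolding almost_simple_curve_def by blast
  show "legal_cycle (c @ e)" using c e turns by (simp add: legal_cycle_def legal_path_append)
qed

text \<open>Since the bar is traversed in both directions, there are four turns at the junctions.
  Inside the returning bar legality comes from the symmetry of gates.\<close>

lemma legal_cycle_barbell:
  assumes c: "c \<noteq> []" "legal_path c" "distinct (map (tail \<Gamma>) c)" "head \<Gamma> (last c) = tail \<Gamma> (hd c)"
    and e: "e \<noteq> []" "legal_path e" "distinct (map (tail \<Gamma>) e)" "head \<Gamma> (last e) = tail \<Gamma> (hd e)"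
    and b: "b \<noteq> []" "legal_path b" "distinct (map (tail \<Gamma>) b)" "head \<Gamma> (last b) \<notin> tail \<Gamma> ` set b"
    and turns: "legal (last c) (hd b)" "legal (last b) (hd e)"
      "legal (last e) ((last b)\<inverse>)" "legal ((hd b)\<inverse>) (hd c)"
    and disj: "topological_edges c \<inter> topological_edges b = {}"
      "topological_edges b \<inter> topological_edges e = {}" "topological_edges c \<inter> topological_edges e = {}"
  shows "almost_simple_curve \<Gamma> (c @ b @ e @ reverse_path b) \<and>
    legal_cycle (c @ b @ e @ reverse_path b)"
proof
  let ?u = "tail \<Gamma> (hd c)" and ?v = "tail \<Gamma> (hd e)"
  have circ: "simple_circuit_at \<Gamma> ?u c" "simple_circuit_at \<Gamma> ?v e"
    by (rule simple_circuitI[OF legal_path_chain[OF c(2)] c(1,4,3) legal_path_reduced[OF c(2)]])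
      (rule simple_circuitI[OF legal_path_chain[OF e(2)] e(1,4,3) legal_path_reduced[OF e(2)]])
  have ends: "tail \<Gamma> (hd b) = ?u" "head \<Gamma> (last b) = ?v"
    using turns c(4) by (simp_all add: legal_def)
  have path: "apath ?u b ?v"
    unfolding apath_def using chain_awalk[OF legal_path_chain[OF b(2)] b(1)] ends b
    by (auto simp: awalk_verts_conv)
  have ne: "?u \<noteq> ?v"
    using ends b(1,4) by (metis hd_in_set image_eqI)
  have "barbell_curve \<Gamma> (c @ b @ e @ reverse_path b)"
    unfolding barbell_curve_def
    by (rule exI[of _ ?u], rule exI[of _ ?v], rule exI[of _ c], rule exI[of _ b], rule exI[of _ e])
      (intro conjI refl ne circ path disj)
  then show "almost_simple_curve \<Gamma> (c @ b @ e @ reverse_path b)"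
    unfolding almost_simple_curve_def by blast
  show "legal_cycle (c @ b @ e @ reverse_path b)"
    using c e b turns legal_path_reverse[OF b(2)]
    by (simp add: legal_cycle_def legal_path_append reverse_path_ends)
qed

text \<open>Extend legally as long as new vertices are reached. Finiteness stops this, and a longest
  such walk ends at one of its own vertices or in \<open>A\<close>. The first arc is exempt from
  avoiding \<open>A\<close>, because the walk may set out from there.\<close>

lemma lollipop:
  assumes "e \<in> \<Delta>"
  obtains p where "p \<noteq> []" "hd p = e" "legal_path p" "distinct (map (tail \<Gamma>) p)"
    "\<And>a. a \<in> set (tl p) \<Longrightarrow> tail \<Gamma> a \<notin> A" "head \<Gamma> (last p) \<in> A \<union> tail \<Gamma> ` set p"
proof -
  define P where "P p \<longleftrightarrow> p \<noteq> [] \<and> hd p = e \<and> legal_path p \<and> distinct (map (tail \<Gamma>) p) \<and>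
    (\<forall>a \<in> set (tl p). tail \<Gamma> a \<notin> A)" for p
  have "P [e]" using assms by (simp add: P_def legal_path_def)
  moreover have "length p < Suc (card (verts \<Gamma>))" if "P p" for p
  proof -
    have "length p = card (tail \<Gamma> ` set p)"
      using that distinct_card[of "map (tail \<Gamma>) p"] by (simp add: P_def)
    also have "\<dots> \<le> card (verts \<Gamma>)"
      using that \<Delta>_arcs by (intro card_mono finite_verts) (auto simp: P_def legal_path_def)
    finally show ?thesis by simp
  qed
  ultimately obtain p where p: "P p" "\<And>p'. P p' \<Longrightarrow> length p' \<le> length p"
    using ex_has_greatest_nat[of P "[e]" length "Suc (card (verts \<Gamma>))"] by auto
  have "head \<Gamma> (last p) \<in> A \<union> tail \<Gamma> ` set p"
  proof (rule ccontr)
    assume out: "head \<Gamma> (last p) \<notin> A \<union> tail \<Gamma> ` set p"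
    have "last p \<in> \<Delta>" using p(1) by (auto simp: P_def legal_path_def subset_iff)
    then obtain b where b: "b \<in> \<Delta>" "tail \<Gamma> b = head \<Gamma> (last p)" "\<not> gate ((last p)\<inverse>) b"
      using legal_continuation by blast
    have "legal_path (p @ [b])"
      using p(1) b unfolding legal_path_append by (auto simp: P_def legal_path_def legal_def)
    moreover have "distinct (map (tail \<Gamma>) (p @ [b]))" using p(1) out b(2) by (auto simp: P_def)
    ultimately have "P (p @ [b])" using p(1) out b(2) by (auto simp: P_def)
    from p(2)[OF this] show False by simp
  qed
  then show thesis using that p(1) unfolding P_def by blast
qed

text \<open>The path \<open>q\<close> leaves the circuit \<open>c\<close> at its base and returns at
  position \<open>j\<close>; it replaces the part of \<open>c\<close> before \<open>j\<close>.
  Stated for any \<open>c\<close> so that it also applies to the reversed circuit.\<close>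

lemma legal_cycle_through_chord:
  assumes c: "legal_path c" "distinct (map (tail \<Gamma>) c)"
    and q: "q \<noteq> []" "legal_path q" "distinct (map (tail \<Gamma>) q)" "tail \<Gamma> (hd q) = tail \<Gamma> (hd c)"
      "\<And>a. a \<in> set (tl q) \<Longrightarrow> tail \<Gamma> a \<notin> tail \<Gamma> ` set c"
    and j: "0 < j" "j < length c"
    and turns: "legal (last c) (hd q)" "legal (last q) (c ! j)"
  shows "almost_simple_curve \<Gamma> (q @ drop j c) \<and> legal_cycle (q @ drop j c)"
proof (rule legal_cycle_circuit)
  show "q @ drop j c \<noteq> []" using q by simp
  show "legal_path (q @ drop j c)"
    unfolding legal_path_append using q legal_path_drop[OF c(1)] turns(2) j by (simp add: hd_drop_conv_nth)
  show "legal (last (q @ drop j c)) (hd (q @ drop j c))" using turns(1) q(1) j by simp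
  have "tail \<Gamma> a \<noteq> tail \<Gamma> b" if a: "a \<in> set q" and b: "b \<in> set (drop j c)" for a b
  proof -
    obtain m where m: "m < length (drop j c)" "b = drop j c ! m"
      using b unfolding in_set_conv_nth by blast
    define k where "k = j + m"
    have k: "j \<le> k" "k < length c" "b = c ! k" using m j by (auto simp: k_def)
    show ?thesis
    proof (cases "a \<in> set (tl q)")
      case True
      then show ?thesis using q(5) k by (metis image_eqI nth_mem)
    next
      case False
      then have "a = hd q" using a q(1) by (cases q) auto
      then have "tail \<Gamma> a = map (tail \<Gamma>) c ! 0" using q(4) j by (cases c) auto
      moreover have "map (tail \<Gamma>) c ! 0 \<noteq> map (tail \<Gamma>) c ! k"
        using c(2) k j by (subst nth_eq_iff_index_eq) auto
      ultimately show ?thesis using k by simp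
    qed
  qed
  then have "tail \<Gamma> ` set q \<inter> tail \<Gamma> ` set (drop j c) = {}" by auto
  moreover have "distinct (map (tail \<Gamma>) (drop j c))" using c(2) by (simp add: drop_map[symmetric])
  ultimately show "distinct (map (tail \<Gamma>) (q @ drop j c))" using q(3) by simp
qed

text \<open>A legal walk runs into itself and leaves a circuit \<open>c\<close>, illegal at most at
  its base. In that case leave the base through another gate along \<open>q\<close>. If
  \<open>q\<close> returns to \<open>c\<close> away from the base, one of the two ways round
  \<open>c\<close> closes it legally; at the base, \<open>q\<close> closes legally by itself or
  forms a figure eight with \<open>c\<close>; if \<open>q\<close> runs into itself, its loop is
  legal or completes a barbell.\<close>

theorem ex_legal_cycle:
  assumes "\<Delta> \<noteq> {}"
  shows "\<exists>p. almost_simple_curve \<Gamma> p \<and> legal_cycle p"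
proof -
  obtain e where e: "e \<in> \<Delta>" using assms by blast
  obtain p where p: "p \<noteq> []" "hd p = e" "legal_path p" "distinct (map (tail \<Gamma>) p)"
    "\<And>a. a \<in> set (tl p) \<Longrightarrow> tail \<Gamma> a \<notin> {}" "head \<Gamma> (last p) \<in> {} \<union> tail \<Gamma> ` set p"
    using lollipop[OF e, of "{}"] by metis
  then obtain i where i: "i < length p" "head \<Gamma> (last p) = tail \<Gamma> (p ! i)"
    by (auto simp: in_set_conv_nth)
  \<comment> \<open>The part of the walk before the vertex where it closes is discarded.\<close>
  define c where "c = drop i p"
  have c: "c \<noteq> []" "legal_path c" "distinct (map (tail \<Gamma>) c)" "head \<Gamma> (last c) = tail \<Gamma> (hd c)"
    using p i legal_path_drop by (auto simp: c_def hd_drop_conv_nth drop_map[symmetric])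
  have c_in: "last c \<in> \<Delta>" "hd c \<in> \<Delta>" "set c \<subseteq> \<Delta>"
    using c(1,2) by (auto simp: legal_path_def subset_iff)
  show ?thesis
  proof (cases "legal (last c) (hd c)")
    case True
    then show ?thesis using legal_cycle_circuit[OF c(1,2) _ c(3)] by blast
  next
    case False
    then have illegal: "gate ((last c)\<inverse>) (hd c)" using c(4) by (simp add: legal_def)
    obtain x where x: "x \<in> \<Delta>" "tail \<Gamma> x = head \<Gamma> (last c)" "\<not> gate ((last c)\<inverse>) x"
      using legal_continuation[OF c_in(1)] by blast
    have x': "legal (last c) x" using x by (simp add: legal_def)
    \<comment> \<open>Both ends of \<open>c\<close> lie in one gate and \<open>x\<close> in another,
      so \<open>x\<close> can follow \<open>c\<close> in either orientation.\<close>
    have not_gate: "\<not> gate (hd c) x"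
      using gate_trans[OF \<Delta>_conv[OF c_in(1)] c_in(2) x(1) illegal] x(3) by blast
    have x'': "legal ((hd c)\<inverse>) x"
      unfolding legal_def using not_gate x(2) c(4) head_conv \<Delta>_arcs c_in(2) by auto
    obtain q where q: "q \<noteq> []" "hd q = x" "legal_path q" "distinct (map (tail \<Gamma>) q)"
      "\<And>a. a \<in> set (tl q) \<Longrightarrow> tail \<Gamma> a \<notin> tail \<Gamma> ` set c"
      "head \<Gamma> (last q) \<in> tail \<Gamma> ` set c \<union> tail \<Gamma> ` set q"
      using lollipop[OF x(1), of "tail \<Gamma> ` set c"] by metis
    have q_in: "last q \<in> \<Delta>" using q(1,3) by (auto simp: legal_path_def subset_iff)
    have qc: "tail \<Gamma> (hd q) = tail \<Gamma> (hd c)" using q(2) x(2) c(4) by simp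
    have c_inside: "tail \<Gamma> a \<in> tail \<Gamma> ` set c \<and> head \<Gamma> a \<in> tail \<Gamma> ` set c" if a: "a \<in> set c" for a
    proof -
      have "head \<Gamma> a \<in> set (map (head \<Gamma>) c)" using a by simp
      also have "set (map (head \<Gamma>) c) \<subseteq> tail \<Gamma> ` set c"
        unfolding chain_heads[OF legal_path_chain[OF c(2)] c(1)] using c(1,4)
        by (auto dest: list.set_sel)
      finally show ?thesis using a by blast
    qed
    show ?thesis
    proof (cases "head \<Gamma> (last q) \<in> tail \<Gamma> ` set c")
      case True
      then obtain j where j: "j < length c" "head \<Gamma> (last q) = tail \<Gamma> (c ! j)"
        by (auto simp: in_set_conv_nth)
      show ?thesis
      proof (cases "j = 0")
        case False
        show ?thesis
        proof (cases "legal (last q) (c ! j)")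
          case True
          have "almost_simple_curve \<Gamma> (q @ drop j c) \<and> legal_cycle (q @ drop j c)"
            by (rule legal_cycle_through_chord[OF c(2,3) q(1,3,4) qc q(5)])
              (use False j True x' q(2) in auto)
          then show ?thesis by blast
        next
          \<comment> \<open>At position \<open>j\<close> the two ways along \<open>c\<close> lie in
            different gates, \<open>c\<close> being legal there. As the way forward is illegal after
            \<open>q\<close>, the way back is legal; in the reversed circuit it starts at position
            \<open>length c - j\<close>.\<close>
          case illegal_turn: False
          let ?c = "reverse_path c" and ?j = "length c - j"
          have cj: "c ! j \<in> \<Delta>" "c ! (j - 1) \<in> \<Delta>" using c_in(3) j by auto
          have legal_j: "legal (c ! (j - 1)) (c ! j)"
            using c(2) j False unfolding legal_path_def successively_conv_nth
            by (metis Suc_pred' neq0_conv)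
          have nth: "?c ! ?j = (c ! (j - 1))\<inverse>"
            using j False by (simp add: reverse_path_def rev_nth)
          have len: "length ?c = length c" by (simp add: reverse_path_def)
          have tail_j: "tail \<Gamma> ((c ! (j - 1))\<inverse>) = head \<Gamma> (last q)"
            using legal_j j(2) tail_conv cj \<Delta>_arcs by (auto simp: legal_def)
          have "gate ((last q)\<inverse>) (c ! j)" using illegal_turn j(2) by (simp add: legal_def)
          then have "\<not> gate ((last q)\<inverse>) ((c ! (j - 1))\<inverse>)"
            using gate_trans[of "(c ! (j - 1))\<inverse>" "(last q)\<inverse>" "c ! j"]
              gate_sym[of "(last q)\<inverse>" "(c ! (j - 1))\<inverse>"] legal_j cj q_in \<Delta>_conv
            unfolding legal_def by blast
          then have turn: "legal (last q) (?c ! ?j)" unfolding nth legal_def using tail_j by simp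
          have tails: "set (map (tail \<Gamma>) ?c) = tail \<Gamma> ` set c" "distinct (map (tail \<Gamma>) ?c)"
            "tail \<Gamma> (hd q) = tail \<Gamma> (hd ?c)"
          proof -
            have eq: "map (tail \<Gamma>) ?c = rev (map (tail \<Gamma>) (tl c) @ [tail \<Gamma> (hd c)])"
              using tails_reverse[OF legal_path_chain[OF c(2)] c(1)] c(4) by simp
            show "set (map (tail \<Gamma>) ?c) = tail \<Gamma> ` set c" "distinct (map (tail \<Gamma>) ?c)"
              unfolding eq using c(1,3) by (cases c; auto)+
            show "tail \<Gamma> (hd q) = tail \<Gamma> (hd ?c)"
              using qc c(1,4) tail_conv c_in \<Delta>_arcs by (auto simp: reverse_path_ends)
          qed
          have "almost_simple_curve \<Gamma> (q @ drop ?j ?c) \<and> legal_cycle (q @ drop ?j ?c)"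
          proof (rule legal_cycle_through_chord[OF legal_path_reverse[OF c(2)] tails(2) q(1,3,4) tails(3)])
            show "tail \<Gamma> a \<notin> tail \<Gamma> ` set ?c" if "a \<in> set (tl q)" for a
              using q(5)[OF that] tails(1) by simp
            show "0 < ?j" "?j < length ?c" using j False len by auto
            show "legal (last ?c) (hd q)" using x'' q(2) c(1) by (simp add: reverse_path_ends)
          qed (fact turn)
          then show ?thesis by blast
        qed
      next
        case True
        then have closed: "head \<Gamma> (last q) = tail \<Gamma> (hd c)" using j c(1) by (simp add: hd_conv_nth)
        show ?thesis
        proof (cases "legal (last q) (hd q)")
          case True
          then show ?thesis using legal_cycle_circuit[OF q(1,3) _ q(4)] by blast
        next
          case False
          then have gq: "gate ((last q)\<inverse>) x" using closed qc q(2) by (simp add: legal_def)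
          \<comment> \<open>If \<open>q\<close> closes illegally, its last arc shares the gate of
            \<open>x\<close> and therefore not that of \<open>hd c\<close>.\<close>
          have "\<not> gate ((last q)\<inverse>) (hd c)"
            using gate_trans[of "hd c" "(last q)\<inverse>" x] gate_sym[of "(last q)\<inverse>" "hd c"] gq not_gate
              q_in c_in x(1) \<Delta>_conv by blast
          then have turn: "legal (last q) (hd c)" using closed by (simp add: legal_def)
          have "topological_edges q \<inter> topological_edges c = {}"
          proof (cases "length q \<ge> 2")
            case True
            show ?thesis
              by (rule disjoint_edges[OF legal_path_chain[OF q(3)] q(5) True])
                (use c_in(3) \<Delta>_arcs c_inside in auto)
          next
            \<comment> \<open>Here \<open>q\<close> is a single loop. Sharing an edge with
              \<open>c\<close> would make \<open>x\<close> the first arc of \<open>c\<close> or the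
              reverse of its last arc, and both lie in the other gate.\<close>
            case False
            then have q1: "q = [x]" using q(1,2) by (cases q; cases "tl q") auto
            have "topological_edge x \<noteq> topological_edge a" if a: "a \<in> set c" for a
            proof
              assume "topological_edge x = topological_edge a"
              then have xa: "x = a \<or> x = a\<inverse>"
                using topological_edge_eq_iff[of a x] by simp
              have a_in: "a \<in> arcs \<Gamma>" using a c_in(3) \<Delta>_arcs by blast
              obtain k where k: "k < length c" "a = c ! k" using a by (auto simp: in_set_conv_nth)
              from xa show False
              proof
                assume "x = a"
                then have "tail \<Gamma> (c ! k) = tail \<Gamma> (c ! 0)"
                  using k qc q(2) c(1) by (simp add: hd_conv_nth)
                then have "k = 0" using distinct_tails_eq[OF c(3)] k c(1) by simp
                then show False using k \<open>x = a\<close> not_gate gate_refl[OF x(1)] c(1) by (simp add: hd_conv_nth)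
              next
                assume xa: "x = a\<inverse>"
                have hx: "head \<Gamma> a = tail \<Gamma> (hd c)" using xa tail_conv[OF a_in] qc q(2) by simp
                have "Suc k = length c"
                proof (rule ccontr)
                  assume "Suc k \<noteq> length c"
                  then have "tail \<Gamma> (c ! Suc k) = tail \<Gamma> (c ! 0)" "Suc k < length c"
                    using chain_nth[OF legal_path_chain[OF c(2)], of k] k hx c(1) by (auto simp: hd_conv_nth)
                  then show False using distinct_tails_eq[OF c(3), of "Suc k" 0] c(1) by simp
                qed
                then have "a = last c" using k c(1) by (simp add: last_conv_nth flip: \<open>Suc k = length c\<close>)
                then show False using xa x(3) gate_refl[OF x(1)] by simp
              qed
            qed
            then show ?thesis using q1 by (auto simp: topological_edges_def)
          qed
          then have "almost_simple_curve \<Gamma> (c @ q) \<and> legal_cycle (c @ q)"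
            by (intro legal_cycle_eight[OF c(1-3) q(1,3,4) _ turn]) (use x' q(2) qc in auto)
          then show ?thesis by blast
        qed
      qed
    next
      case False
      then obtain k where k: "k < length q" "head \<Gamma> (last q) = tail \<Gamma> (q ! k)"
        using q(6) by (auto simp: in_set_conv_nth)
      have "hd q \<noteq> q ! k" using False k qc c(1) by auto
      then have k0: "0 < k" using q(1) by (cases k) (auto simp: hd_conv_nth)
      \<comment> \<open>The stick of the lollipop \<open>q\<close>, which becomes the bar;
        \<open>e\<close> is its loop.\<close>
      define s where "s = take k q"
      define e where "e = drop k q"
      have qse: "q = s @ e" by (simp add: s_def e_def)
      have ne: "s \<noteq> []" "e \<noteq> []" using k k0 by (auto simp: s_def e_def)
      have legal_se: "legal_path s" "legal_path e" "legal (last s) (hd e)"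
        using q(3) ne unfolding qse legal_path_append by auto
      have dist_se: "distinct (map (tail \<Gamma>) s)" "distinct (map (tail \<Gamma>) e)"
        "tail \<Gamma> ` set s \<inter> tail \<Gamma> ` set e = {}" using q(4) unfolding qse by auto
      have closed: "head \<Gamma> (last e) = tail \<Gamma> (hd e)" "last e = last q"
        using k by (auto simp: e_def hd_drop_conv_nth)
      have in_D: "last s \<in> \<Delta>" "hd e \<in> \<Delta>" "last e \<in> \<Delta>" "hd s \<in> \<Delta>"
        using legal_se ne by (auto simp: legal_path_def subset_iff)
      have hds: "hd s = x" using q(2) ne unfolding qse by simp
      show ?thesis
      proof (cases "legal (last e) (hd e)")
        case True
        then show ?thesis using legal_cycle_circuit[OF ne(2) legal_se(2) _ dist_se(2)] by blast
      next
        case False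
        then have ge: "gate ((last e)\<inverse>) (hd e)" using closed by (simp add: legal_def)
        have "\<not> gate ((last e)\<inverse>) ((last s)\<inverse>)"
          using gate_trans[of "(last s)\<inverse>" "(last e)\<inverse>" "hd e"]
            gate_sym[of "(last e)\<inverse>" "(last s)\<inverse>"] ge legal_se(3) in_D \<Delta>_conv
          unfolding legal_def by blast
        moreover have "tail \<Gamma> ((last s)\<inverse>) = head \<Gamma> (last e)"
          using legal_se(3) closed(1) tail_conv in_D \<Delta>_arcs by (auto simp: legal_def)
        ultimately have t3: "legal (last e) ((last s)\<inverse>)" by (simp add: legal_def)
        have t4: "legal ((hd s)\<inverse>) (hd c)"
          using legal_converse[OF \<Delta>_conv[OF c_in(2)] x(1) x''] hds by simp
        have "length q \<ge> 2" using k k0 by simp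
        then have "topological_edges q \<inter> topological_edges c = {}"
          by (intro disjoint_edges[OF legal_path_chain[OF q(3)] q(5)])
            (use c_in(3) \<Delta>_arcs c_inside in auto)
        then have disj: "topological_edges c \<inter> topological_edges s = {}"
          "topological_edges c \<inter> topological_edges e = {}"
          unfolding qse topological_edges_append by auto
        have disj': "topological_edges s \<inter> topological_edges e = {}"
          using distinct_edges[OF legal_path_chain[OF q(3)] legal_path_reduced[OF q(3)] q(4)]
          unfolding qse by (rule distinct_append_edges)
        have s_end: "head \<Gamma> (last s) \<notin> tail \<Gamma> ` set s"
        proof -
          have "head \<Gamma> (last s) \<in> tail \<Gamma> ` set e"
            using legal_se(3) ne(2) by (auto simp: legal_def)
          then show ?thesis using dist_se(3) by blast
        qed
        have "almost_simple_curve \<Gamma> (c @ s @ e @ reverse_path s) \<and>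
            legal_cycle (c @ s @ e @ reverse_path s)"
          by (rule legal_cycle_barbell[OF c ne(2) legal_se(2) dist_se(2) closed(1) ne(1) legal_se(1)
                dist_se(1) s_end _ legal_se(3) t3 t4 disj(1) disj' disj(2)])
            (use x' hds in simp)
        then show ?thesis by blast
      qed
    qed
  qed
qed

end

definition follows :: "'e list \<Rightarrow> 'e \<Rightarrow> 'e \<Rightarrow> bool" where
  "follows p a b \<longleftrightarrow> (\<exists>u v. p = u @ [a, b] @ v) \<or> (p \<noteq> [] \<and> last p = a \<and> hd p = b)"

lemma follows_append: "\<lbrakk>p \<noteq> []; q \<noteq> []\<rbrakk> \<Longrightarrow> follows (r @ p @ q @ t) (last p) (hd q)"
proof -
  assume "p \<noteq> []" "q \<noteq> []"
  then have "r @ p @ q @ t = (r @ butlast p) @ [last p, hd q] @ (tl q @ t)"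
    by (metis append_butlast_last_id append_Cons append_Nil append_assoc list.collapse)
  then show ?thesis unfolding follows_def by blast
qed

lemma last_edge: "p \<noteq> [] \<Longrightarrow> topological_edge (last p) \<in> topological_edges p"
  by (simp add: topological_edges_def)

section \<open>Curves through a prescribed turn\<close>

context curve_graph
begin

text \<open>Follow two different arcs issuing from a vertex until they run into themselves or each other.\<close>

theorem ex_curve_through_turn:
  assumes cont: "\<And>a. a \<in> arcs \<Gamma> \<Longrightarrow> \<exists>b \<in> arcs \<Gamma>. tail \<Gamma> b = head \<Gamma> a \<and> b \<noteq> a\<inverse>"
    and x: "x \<in> arcs \<Gamma>" and y: "y \<in> arcs \<Gamma>" and xy: "tail \<Gamma> x = tail \<Gamma> y" "x \<noteq> y"
  shows "\<exists>p. almost_simple_curve \<Gamma> p \<and> gated_graph.legal_cycle \<Gamma> (arcs \<Gamma>) (=) p \<and>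
    (follows p (x\<inverse>) y \<or> follows p (y\<inverse>) x)"
proof -
  \<comment> \<open>With equality as the gate relation, a legal path is one without
    backtracking.\<close>
  interpret gated_graph \<Gamma> "arcs \<Gamma>" "(=)"
  proof
    show "\<exists>b\<in>arcs \<Gamma>. tail \<Gamma> b = head \<Gamma> a \<and> a\<inverse> \<noteq> b" if "a \<in> arcs \<Gamma>" for a
      using cont[OF that] by blast
  qed (auto simp: conv_in)
  have legalI: "legal a b" if "head \<Gamma> a = tail \<Gamma> b" "b \<noteq> a\<inverse>" for a b
    using that by (auto simp: legal_def)
  have turn: "legal (y\<inverse>) x" using head_conv[OF y] xy by (intro legalI) auto
  obtain p where p: "p \<noteq> []" "hd p = y" "legal_path p" "distinct (map (tail \<Gamma>) p)"
    "\<And>a. a \<in> set (tl p) \<Longrightarrow> tail \<Gamma> a \<notin> {}" "head \<Gamma> (last p) \<in> {} \<union> tail \<Gamma> ` set p"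
    using lollipop[OF y, of "{}"] by metis
  then obtain i where i: "i < length p" "head \<Gamma> (last p) = tail \<Gamma> (p ! i)"
    by (auto simp: in_set_conv_nth)
  obtain q where q: "q \<noteq> []" "hd q = x" "legal_path q" "distinct (map (tail \<Gamma>) q)"
    "\<And>a. a \<in> set (tl q) \<Longrightarrow> tail \<Gamma> a \<notin> tail \<Gamma> ` set p"
    "head \<Gamma> (last q) \<in> tail \<Gamma> ` set p \<union> tail \<Gamma> ` set q"
    using lollipop[OF x, of "tail \<Gamma> ` set p"] by metis
  have p_in: "set p \<subseteq> arcs \<Gamma>" and q_in: "set q \<subseteq> arcs \<Gamma>" using p(3) q(3) by (auto simp: legal_path_def)
  have p0: "p ! 0 = y" using p(1,2) by (simp add: hd_conv_nth)
  have chain_p: "chain p" and chain_q: "chain q" using p(3) q(3) legal_path_chain by auto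
  have heads_p: "head \<Gamma> (p ! k) = (if Suc k < length p then tail \<Gamma> (p ! Suc k) else tail \<Gamma> (p ! i))"
    if "k < length p" for k
  proof (cases "Suc k < length p")
    case False
    then have "last p = p ! k" using that p(1) by (metis Suc_lessI diff_Suc_1 last_conv_nth)
    then show ?thesis using False i by simp
  qed (use chain_nth[OF chain_p, of k] in simp)
  have p_inside: "tail \<Gamma> a \<in> tail \<Gamma> ` set p \<and> head \<Gamma> a \<in> tail \<Gamma> ` set p" if a: "a \<in> set p" for a
  proof -
    obtain k where k: "k < length p" "a = p ! k" using a by (auto simp: in_set_conv_nth)
    have "head \<Gamma> a \<in> tail \<Gamma> ` set p" using heads_p[OF k(1)] k i by (auto split: if_splits)
    then show ?thesis using a by blast
  qed
  \<comment> \<open>Only the first arc of \<open>q\<close> starts on \<open>p\<close>, so if the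
    last one does, they are the same arc.\<close>
  have single: "q = [x]" if "tail \<Gamma> (last q) \<in> tail \<Gamma> ` set p"
    using that q(1,2,5) by (cases q) (auto split: if_splits)
  define c where "c = drop i p"
  define s where "s = take i p"
  have p_split: "p = s @ c" by (simp add: s_def c_def)
  have c: "c \<noteq> []" "legal_path c" "distinct (map (tail \<Gamma>) c)" "head \<Gamma> (last c) = tail \<Gamma> (hd c)"
    "hd c = p ! i" "last c = last p"
    using p i legal_path_drop by (auto simp: c_def hd_drop_conv_nth drop_map[symmetric])
  have s: "legal_path s" "distinct (map (tail \<Gamma>) s)" "tail \<Gamma> ` set s \<inter> tail \<Gamma> ` set c = {}"
    using p(3,4) unfolding p_split legal_path_append by auto
  have cs_edges: "topological_edges s \<inter> topological_edges c = {}"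
    using distinct_edges[OF chain_p legal_path_reduced[OF p(3)] p(4)]
    unfolding p_split by (rule distinct_append_edges)
  have last_c_in: "last c \<in> arcs \<Gamma>" using c(1,6) p(1) p_in by auto
  show ?thesis
  proof (cases "head \<Gamma> (last q) \<in> tail \<Gamma> ` set p")
    case True
    then obtain j where j: "j < length p" "head \<Gamma> (last q) = tail \<Gamma> (p ! j)"
      by (auto simp: in_set_conv_nth)
    show ?thesis
    proof (cases "j = 0")
      case False
      \<comment> \<open>From the meeting point back along \<open>p\<close> to the common vertex,
        then out along \<open>q\<close>: a circuit making the turn from \<open>y\<inverse>\<close>
        to \<open>x\<close>.\<close>
      let ?r = "reverse_path (take j p)"
      have take_ne: "take j p \<noteq> []" "hd (take j p) = y" "last (take j p) = p ! (j - 1)"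
        using False j p(1,2) by (auto simp: last_conv_nth hd_take)
      have r_ends: "hd ?r = (p ! (j - 1))\<inverse>" "last ?r = y\<inverse>"
        using take_ne by (simp_all add: reverse_path_ends)
      have pj: "p ! (j - 1) \<in> arcs \<Gamma>" "head \<Gamma> (p ! (j - 1)) = tail \<Gamma> (p ! j)"
        using p_in j False heads_p[of "j - 1"] by (auto simp: subset_iff)
      \<comment> \<open>Equality would mean that \<open>q\<close> is the single arc \<open>x\<close>
        and, as this starts at the base of \<open>p\<close>, that \<open>x = y\<close>.\<close>
      have "last q \<noteq> p ! (j - 1)"
      proof
        assume eq: "last q = p ! (j - 1)"
        then have "tail \<Gamma> (last q) \<in> tail \<Gamma> ` set p" using j by simp
        then have "q = [x]" by (rule single)
        then have "tail \<Gamma> (p ! (j - 1)) = tail \<Gamma> (p ! 0)" using eq xy p0 by simp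
        then have "j - 1 = 0" using distinct_tails_eq[OF p(4), of "j - 1" 0] j p(1) by simp
        then show False using eq \<open>q = [x]\<close> p0 xy by simp
      qed
      then have closing: "legal (last q) (hd ?r)"
        using r_ends j pj tail_conv by (intro legalI) auto
      have tails_r: "map (tail \<Gamma>) ?r = rev (map (tail \<Gamma>) (tl (take j p)) @ [tail \<Gamma> (p ! j)])"
        using tails_reverse[OF legal_path_chain[OF legal_path_take[OF p(3)]] take_ne(1)] take_ne(3) pj
        by simp
      have set_r: "tail \<Gamma> ` set ?r = tail \<Gamma> ` (set (tl (take j p)) \<union> {p ! j})"
        using arg_cong[OF tails_r, of set] by auto
      have suc: "take (Suc j) p = hd p # (tl (take j p) @ [p ! j])"
      proof -
        have "take j p = hd p # tl (take j p)" using take_ne p(2) by (metis list.collapse)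
        moreover have "take (Suc j) p = take j p @ [p ! j]" using j(1) by (rule take_Suc_conv_app_nth)
        ultimately show ?thesis by (metis append_Cons)
      qed
      have dist: "distinct (map (tail \<Gamma>) (hd p # (tl (take j p) @ [p ! j])))"
        using p(4) distinct_take[of "map (tail \<Gamma>) p" "Suc j"] unfolding suc[symmetric] take_map by simp
      have "almost_simple_curve \<Gamma> (?r @ q) \<and> legal_cycle (?r @ q)"
      proof (rule legal_cycle_circuit)
        show "?r @ q \<noteq> []" using q by simp
        show "legal_path (?r @ q)"
          unfolding legal_path_append
          using legal_path_reverse[OF legal_path_take[OF p(3)]] q turn r_ends by simp
        show "legal (last (?r @ q)) (hd (?r @ q))" using closing q(1) take_ne(1) by simp
        have "distinct (map (tail \<Gamma>) ?r)" unfolding tails_r using dist by auto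
        moreover have "tail \<Gamma> ` set ?r \<inter> tail \<Gamma> ` set q = {}"
        proof -
          have sub: "tail \<Gamma> ` set ?r \<subseteq> tail \<Gamma> ` set p"
          proof -
            have "set (tl (take j p)) \<subseteq> set p"
              using set_take_subset[of j p] by (meson list.set_sel(2) subset_iff take_ne(1))
            then show ?thesis unfolding set_r using j(1) by auto
          qed
          have "tail \<Gamma> x \<notin> tail \<Gamma> ` set ?r"
            unfolding set_r using dist p(2) xy(1) by auto
          moreover have "tail \<Gamma> ` set q = insert (tail \<Gamma> x) (tail \<Gamma> ` set (tl q))"
            using q(1,2) by (cases q) auto
          moreover have "tail \<Gamma> ` set (tl q) \<inter> tail \<Gamma> ` set p = {}" using q(5) by blast
          moreover have "R \<inter> Q = {}" if "t \<notin> R" "Q = insert t Q'" "Q' \<inter> P = {}" "R \<subseteq> P"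
            for R P Q Q' :: "'a set set" and t
            using that by blast
          ultimately show ?thesis using sub by meson
        qed
        ultimately show "distinct (map (tail \<Gamma>) (?r @ q))" using q(4) by simp
      qed
      moreover have "follows (?r @ q) (y\<inverse>) x"
        using follows_append[of ?r q "[]" "[]"] take_ne(1) q(1,2) r_ends by simp
      ultimately show ?thesis by blast
    next
      case True
      then have closed: "head \<Gamma> (last q) = tail \<Gamma> (hd q)" using j q(2) xy p0 by simp
      show ?thesis
      proof (cases "last q = y\<inverse>")
        \<comment> \<open>The circuit \<open>q\<close> makes the turn by itself, at the place where
          it closes up.\<close>
        case True
        then have "almost_simple_curve \<Gamma> q \<and> legal_cycle q"
          using legal_cycle_circuit[OF q(1,3) _ q(4)] turn q(2) by simp
        moreover have "follows q (y\<inverse>) x" unfolding follows_def using True q(1,2) by simp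
        ultimately show ?thesis by blast
      next
        case not_y: False
        have q_p_edges: "topological_edges q \<inter> topological_edges p' = {}"
          if sub: "set p' \<subseteq> set p"
            and loop: "\<And>a. a \<in> set p' \<Longrightarrow> q = [x] \<Longrightarrow> topological_edge x \<noteq> topological_edge a" for p'
        proof (cases "length q \<ge> 2")
          case True
          show ?thesis
            by (rule disjoint_edges[OF chain_q q(5) True])
              (use sub p_in p_inside in \<open>auto simp: subset_iff\<close>)
        next
          case False
          then have "q = [x]" using q(1,2) by (cases q; cases "tl q") auto
          then show ?thesis using loop by (auto simp: topological_edges_def)
        qed
        \<comment> \<open>This supplies the disjointness of edges when \<open>q\<close> is one loop:
          such a loop shares an edge with \<open>p\<close> only if \<open>p\<close> consists of a
          single arc.\<close>
        have loop_x: "k = 0 \<and> (Suc 0 < length p \<longrightarrow> False)"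
          if "k < length p" "q = [x]" "topological_edge x = topological_edge (p ! k)" for k
        proof -
          have hx: "head \<Gamma> x = tail \<Gamma> (p ! 0)" using closed that(2) xy p0 by simp
          have pk: "p ! k \<in> arcs \<Gamma>" using p_in that(1) by (auto simp: subset_iff)
          have "x = p ! k \<or> x = (p ! k)\<inverse>"
            using topological_edge_eq_iff[of "p ! k" x] that(3) by simp
          then have "tail \<Gamma> (p ! k) = tail \<Gamma> (p ! 0) \<and> head \<Gamma> (p ! k) = tail \<Gamma> (p ! 0)"
            using hx xy p0 tail_conv[OF pk] head_conv[OF pk] by auto
          then have "k = 0" "head \<Gamma> (p ! 0) = tail \<Gamma> (p ! 0)"
            using distinct_tails_eq[OF p(4), of k 0] that(1) p(1) by auto
          moreover have False if "Suc 0 < length p"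
            using \<open>head \<Gamma> (p ! 0) = tail \<Gamma> (p ! 0)\<close> chain_nth[OF chain_p that]
              distinct_tails_eq[OF p(4) _ that, of 0] p(1) by simp
          ultimately show ?thesis by blast
        qed
        have no_loop: "topological_edge x \<noteq> topological_edge a"
          if a: "a \<in> set p" and q1: "q = [x]" and len: "Suc 0 < length p" for a
        proof
          assume e: "topological_edge x = topological_edge a"
          obtain k where "k < length p" "a = p ! k" using a by (auto simp: in_set_conv_nth)
          then show False using loop_x[of k] q1 e len by simp
        qed
        show ?thesis
        proof (cases "i = 0")
          case True
          then have cp: "c = p" by (simp add: c_def)
          show ?thesis
          proof (cases "q = [x] \<and> length p = 1")
            \<comment> \<open>Both walks are single loops at one vertex. They form a figure eight,
              unless they are inverse to each other, which has been excluded.\<close>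
            case True
            then have py: "p = [y]" using p0 by (cases p) auto
            have hy: "head \<Gamma> y = tail \<Gamma> y" "head \<Gamma> x = tail \<Gamma> x"
              using c(4) cp py closed True by auto
            show ?thesis
            proof (cases "x = y\<inverse>")
              case True
              then show ?thesis using not_y \<open>q = [x] \<and> length p = 1\<close> by simp
            next
              case False
              have "almost_simple_curve \<Gamma> ([y\<inverse>] @ [x]) \<and> legal_cycle ([y\<inverse>] @ [x])"
                by (rule legal_cycle_eight)
                  (use turn hy False xy x y conv_in tail_conv head_conv topological_edge_eq_iff[of x y]
                    in \<open>auto simp: legal_path_def legal_def topological_edges_def\<close>)
              moreover have "follows ([y\<inverse>] @ [x]) (y\<inverse>) x"
                using follows_append[of "[y\<inverse>]" "[x]" "[]" "[]"] by simp
              ultimately show ?thesis by blast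
            qed
          next
            case False
            have disj: "topological_edges (reverse_path p) \<inter> topological_edges q = {}"
            proof -
              have "topological_edges q \<inter> topological_edges p = {}"
              proof (rule q_p_edges)
                fix a assume "a \<in> set p" "q = [x]"
                then show "topological_edge x \<noteq> topological_edge a"
                  using no_loop False p(1) by (cases p) auto
              qed simp
              then show ?thesis by auto
            qed
            have tails: "map (tail \<Gamma>) (reverse_path p) = rev (map (tail \<Gamma>) (tl p) @ [tail \<Gamma> (hd p)])"
              using tails_reverse[OF chain_p p(1)] c(4) cp by simp
            have dist: "distinct (map (tail \<Gamma>) (reverse_path p))"
              unfolding tails using p(1,4) by (cases p) auto
            have closing: "legal (last q) (hd (reverse_path p))"
            proof (rule legalI)
              show "head \<Gamma> (last q) = tail \<Gamma> (hd (reverse_path p))"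
                using closed q(2) xy p(1,2) c(4) cp tail_conv last_c_in by (simp add: reverse_path_ends)
              show "hd (reverse_path p) \<noteq> (last q)\<inverse>"
              proof
                assume "hd (reverse_path p) = (last q)\<inverse>"
                then have "topological_edge (last q) = topological_edge (last p)"
                  using p(1) by (simp add: reverse_path_ends)
                then show False using disj last_edge[OF q(1)] last_edge[OF p(1)] by auto
              qed
            qed
            have "almost_simple_curve \<Gamma> (reverse_path p @ q) \<and> legal_cycle (reverse_path p @ q)"
              by (rule legal_cycle_eight[OF _ legal_path_reverse[OF p(3)] dist q(1,3,4) _ closing _ disj])
                (use p(1,2) turn q(2) c(4) cp xy tail_conv last_c_in in \<open>auto simp: reverse_path_ends\<close>)
            moreover have "follows (reverse_path p @ q) (y\<inverse>) x"
              using follows_append[of "reverse_path p" q "[]" "[]"] p(1,2) q(1,2)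
              by (simp add: reverse_path_ends)
            ultimately show ?thesis by blast
          qed
        next
          case False
          then have len: "Suc 0 < length p" using i by simp
          have s_ne: "s \<noteq> []" "hd s = y" "last s = p ! (i - 1)"
            using False i p(1,2) by (auto simp: s_def last_conv_nth hd_take)
          have pi: "p ! (i - 1) \<in> arcs \<Gamma>" "head \<Gamma> (p ! (i - 1)) = tail \<Gamma> (p ! i)"
            using p_in i False heads_p[of "i - 1"] by (auto simp: subset_iff)
          have se: "legal (last s) (hd c)"
            using p(3) s_ne c(1) unfolding p_split legal_path_append by auto
          have q_s: "topological_edges q \<inter> topological_edges s = {}"
            and q_c: "topological_edges q \<inter> topological_edges c = {}"
            using q_p_edges[of s] q_p_edges[of c] no_loop len unfolding p_split by auto
          have edge_neq: "topological_edge (last c) \<noteq> topological_edge (last s)"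
            using cs_edges last_edge[OF s_ne(1)] last_edge[OF c(1)] by auto
          \<comment> \<open>The turn occurs where the barbell closes up: the returning bar ends with
            \<open>y\<inverse>\<close> and \<open>q\<close> begins with \<open>x\<close>.\<close>
          have "almost_simple_curve \<Gamma> (q @ s @ c @ reverse_path s) \<and>
              legal_cycle (q @ s @ c @ reverse_path s)"
          proof (rule legal_cycle_barbell[OF q(1,3,4) closed c(1-4) s_ne(1) s(1,2) _ _ se _ _ q_s cs_edges q_c])
            show "head \<Gamma> (last s) \<notin> tail \<Gamma> ` set s"
            proof -
              have "head \<Gamma> (last s) \<in> tail \<Gamma> ` set c" using se c(1) by (auto simp: legal_def)
              then show ?thesis using s(3) by blast
            qed
            show "legal (last q) (hd s)"
            proof (rule legalI)
              show "head \<Gamma> (last q) = tail \<Gamma> (hd s)" using closed q(2) xy s_ne(2) by simp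
              show "hd s \<noteq> (last q)\<inverse>" using not_y s_ne(2) by auto
            qed
            show "legal (last c) ((last s)\<inverse>)"
            proof (rule legalI)
              show "head \<Gamma> (last c) = tail \<Gamma> ((last s)\<inverse>)"
                using c(4,5) s_ne(3) pi tail_conv by simp
              show "(last s)\<inverse> \<noteq> (last c)\<inverse>" using edge_neq by auto
            qed
            show "legal ((hd s)\<inverse>) (hd q)" using turn s_ne(2) q(2) by simp
          qed
          moreover have "follows (q @ s @ c @ reverse_path s) (y\<inverse>) x"
            unfolding follows_def using q(1,2) s_ne by (simp add: reverse_path_ends)
          ultimately show ?thesis by blast
        qed
      qed
    qed
  next
    case False
    then obtain k where k: "k < length q" "head \<Gamma> (last q) = tail \<Gamma> (q ! k)"
      using q(6) by (auto simp: in_set_conv_nth)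
    have qp: "tail \<Gamma> (hd q) \<in> tail \<Gamma> ` set p" using q(2) xy p(1,2) by auto
    have "hd q \<noteq> q ! k" using False k qp by auto
    then have k0: "0 < k" using q(1) by (cases k) (auto simp: hd_conv_nth)
    define r where "r = take k q"
    define e where "e = drop k q"
    have q_split: "q = r @ e" by (simp add: r_def e_def)
    have ne: "r \<noteq> []" "e \<noteq> []" using k k0 by (auto simp: r_def e_def)
    have legal_re: "legal_path r" "legal_path e" "legal (last r) (hd e)"
      using q(3) ne unfolding q_split legal_path_append by auto
    have dist_re: "distinct (map (tail \<Gamma>) r)" "distinct (map (tail \<Gamma>) e)"
      "tail \<Gamma> ` set r \<inter> tail \<Gamma> ` set e = {}" using q(4) unfolding q_split by auto
    have closed: "head \<Gamma> (last e) = tail \<Gamma> (hd e)" "last e = last q"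
      using k by (auto simp: e_def hd_drop_conv_nth)
    have hdr: "hd r = x" using q(2) ne unfolding q_split by simp
    have r_in: "set r \<subseteq> arcs \<Gamma>" "last r \<in> arcs \<Gamma>" using q_in ne unfolding q_split by auto
    have re_edges: "topological_edges r \<inter> topological_edges e = {}"
      using distinct_edges[OF chain_q legal_path_reduced[OF q(3)] q(4)]
      unfolding q_split by (rule distinct_append_edges)
    have len: "length q \<ge> 2" using k k0 by simp
    have q_p: "topological_edges q \<inter> topological_edges p = {}"
      by (rule disjoint_edges[OF chain_q q(5) len]) (use p_in p_inside in auto)
    have disj: "topological_edges r \<inter> topological_edges s = {}" "topological_edges r \<inter> topological_edges c = {}"
      "topological_edges e \<inter> topological_edges s = {}" "topological_edges e \<inter> topological_edges c = {}"
      using q_p unfolding q_split p_split topological_edges_append by auto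
    have neq: "topological_edge a \<noteq> topological_edge b"
      if "topological_edges u \<inter> topological_edges w = {}" "a \<in> set u" "b \<in> set w" for a b u w
      using that by (auto simp: topological_edges_def)
    have e_back: "legal (last e) ((last r)\<inverse>)"
    proof (rule legalI)
      show "head \<Gamma> (last e) = tail \<Gamma> ((last r)\<inverse>)"
        using closed(1) legal_re(3) tail_conv r_in by (simp add: legal_def)
      show "(last r)\<inverse> \<noteq> (last e)\<inverse>"
        using neq[OF re_edges, of "last r" "last e"] ne by auto
    qed
    have r_end: "head \<Gamma> (last r) \<notin> tail \<Gamma> ` set p"
    proof -
      have "hd e \<in> set (tl q)" using ne unfolding q_split by (cases r) auto
      then show ?thesis using q(5) legal_re(3) by (auto simp: legal_def)
    qed
    have r_end': "head \<Gamma> (last r) \<notin> tail \<Gamma> ` set r"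
    proof -
      have "head \<Gamma> (last r) \<in> tail \<Gamma> ` set e" using legal_re(3) ne by (auto simp: legal_def)
      then show ?thesis using dist_re(3) by blast
    qed
    show ?thesis
    proof (cases "i = 0")
      case True
      then have cp: "c = p" and hc: "hd c = y" using p(2) by (auto simp: c_def)
      \<comment> \<open>Here the bar begins with \<open>x\<close> and the circuit with
        \<open>y\<close>, so the turn appears in the opposite orientation. This accounts for the
        second alternative of the conclusion.\<close>
      have "almost_simple_curve \<Gamma> (c @ r @ e @ reverse_path r) \<and>
          legal_cycle (c @ r @ e @ reverse_path r)"
      proof (rule legal_cycle_barbell[OF c(1-4) ne(2) legal_re(2) dist_re(2) closed(1) ne(1) legal_re(1)
            dist_re(1) r_end' _ legal_re(3) e_back _ _ re_edges])
        show "legal (last c) (hd r)"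
        proof (rule legalI)
          show "head \<Gamma> (last c) = tail \<Gamma> (hd r)" using c(4) hc hdr xy by simp
          show "hd r \<noteq> (last c)\<inverse>" using neq[OF disj(2), of "hd r" "last c"] ne c(1) by auto
        qed
        show "legal ((hd r)\<inverse>) (hd c)"
          using hdr hc xy head_conv[OF x] by (intro legalI) auto
        show "topological_edges c \<inter> topological_edges r = {}" "topological_edges c \<inter> topological_edges e = {}"
          using disj by auto
      qed
      moreover have "follows (c @ r @ e @ reverse_path r) (x\<inverse>) y"
        unfolding follows_def using c(1) hc ne hdr by (simp add: reverse_path_ends)
      ultimately show ?thesis by blast
    next
      case False
      have s_ne: "s \<noteq> []" "hd s = y" "last s = p ! (i - 1)"
        using False i p(1,2) by (auto simp: s_def last_conv_nth hd_take)
      have pi: "p ! (i - 1) \<in> arcs \<Gamma>" "head \<Gamma> (p ! (i - 1)) = tail \<Gamma> (p ! i)"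
        using p_in i False heads_p[of "i - 1"] by (auto simp: subset_iff)
      have sc: "legal (last s) (hd c)"
        using p(3) s_ne c(1) unfolding p_split legal_path_append by auto
      have tails_s: "map (tail \<Gamma>) (reverse_path s) = rev (map (tail \<Gamma>) (tl s) @ [tail \<Gamma> (hd c)])"
        using tails_reverse[OF legal_path_chain[OF s(1)] s_ne(1)] sc by (simp add: legal_def)
      have set_s: "tail \<Gamma> ` set (reverse_path s) = tail \<Gamma> ` (set (tl s) \<union> {hd c})"
        using arg_cong[OF tails_s, of set] by auto
      have hc_in: "hd c \<in> set c" using c(1) by simp
      have tl_s: "tail \<Gamma> y \<notin> tail \<Gamma> ` set (tl s)" "distinct (map (tail \<Gamma>) (tl s))"
        using s(2) s_ne by (cases s; auto)+
      have y_c: "tail \<Gamma> y \<notin> tail \<Gamma> ` set c"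
      proof -
        have "tail \<Gamma> y \<in> tail \<Gamma> ` set s" using s_ne(1,2) hd_in_set by blast
        then show ?thesis using s(3) by blast
      qed
      have tl_s_sub: "set (tl s) \<subseteq> set s" by (cases s) auto
      \<comment> \<open>The bar runs from the loop of \<open>p\<close> down its stick, through the
        prescribed turn, and up the stick of \<open>q\<close>.\<close>
      let ?b = "reverse_path s @ r"
      have b_legal: "legal_path ?b"
        unfolding legal_path_append
        using legal_path_reverse[OF s(1)] legal_re(1) turn s_ne hdr by (simp add: reverse_path_ends)
      have set_sp: "tail \<Gamma> ` set (reverse_path s) \<subseteq> tail \<Gamma> ` set p"
        unfolding set_s p_split using tl_s_sub hc_in by auto
      have r_tails: "tail \<Gamma> a \<notin> tail \<Gamma> ` set (reverse_path s)" if a: "a \<in> set r" for a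
      proof (cases "a = x")
        case True
        then show ?thesis unfolding set_s using tl_s y_c hc_in xy by auto
      next
        case False
        have "a \<in> set (tl q)" using a False hdr ne(1) unfolding q_split by (cases r) auto
        then show ?thesis using q(5) set_sp by blast
      qed
      have b_dist: "distinct (map (tail \<Gamma>) ?b)"
      proof -
        have "distinct (map (tail \<Gamma>) (reverse_path s))"
          unfolding tails_s using tl_s s(3) tl_s_sub hc_in by auto
        then show ?thesis using dist_re(1) r_tails by auto
      qed
      have b_end: "head \<Gamma> (last ?b) \<notin> tail \<Gamma> ` set ?b"
        using r_end r_end' set_sp ne by auto
      have "almost_simple_curve \<Gamma> (c @ ?b @ e @ reverse_path ?b) \<and>
          legal_cycle (c @ ?b @ e @ reverse_path ?b)"
      proof (rule legal_cycle_barbell[OF c(1-4) ne(2) legal_re(2) dist_re(2) closed(1) _ b_legal b_dist b_end])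
        show "?b \<noteq> []" using ne by simp
        show "legal (last c) (hd ?b)"
        proof (rule legalI)
          show "head \<Gamma> (last c) = tail \<Gamma> (hd ?b)"
            using c(4,5) s_ne pi tail_conv by (simp add: reverse_path_ends)
          show "hd ?b \<noteq> (last c)\<inverse>"
            using neq[OF cs_edges last_in_set[OF s_ne(1)] last_in_set[OF c(1)]] s_ne(1)
            by (auto simp: reverse_path_ends)
        qed
        show "legal (last ?b) (hd e)" using legal_re(3) ne by simp
        show "legal (last e) ((last ?b)\<inverse>)" using e_back ne by simp
        show "legal ((hd ?b)\<inverse>) (hd c)" using sc s_ne by (simp add: reverse_path_ends)
        show "topological_edges c \<inter> topological_edges ?b = {}"
          "topological_edges ?b \<inter> topological_edges e = {}" "topological_edges c \<inter> topological_edges e = {}"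
          using disj cs_edges re_edges unfolding topological_edges_append by auto
      qed
      moreover have "follows (c @ ?b @ e @ reverse_path ?b) (y\<inverse>) x"
        using follows_append[of "reverse_path s" r c "e @ reverse_path ?b"] s_ne ne hdr
        by (simp add: reverse_path_ends)
      ultimately show ?thesis by blast
    qed
  qed
qed

end

section \<open>Equivariant maps with minimal stretch\<close>

lemma positive_below_finite:
  fixes S :: "real set"
  assumes "finite S" "\<And>x. x \<in> S \<Longrightarrow> 0 < x"
  obtains t where "0 < t" "\<And>x. x \<in> S \<Longrightarrow> t < x"
proof -
  have "0 < Min (insert 1 S)" using assms by (subst Min_gr_iff) auto
  moreover have "Min (insert 1 S) / 2 < x" if x: "x \<in> S" for x
  proof -
    have "Min (insert 1 S) \<le> x" using x assms(1) by (intro Min_le) auto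
    then show ?thesis using assms(2)[OF x] by linarith
  qed
  ultimately show thesis using that[of "Min (insert 1 S) / 2"] by simp
qed

section \<open>Points of bounded displacement\<close>

context fg_tree_action
begin

text \<open>If every generator \<open>s\<close> moves \<open>\<phi> g k\<close> by at most
  \<open>C\<close>, then \<open>inv g \<otimes> s \<otimes> g\<close> lies in the finite set
  \<open>near C\<close>. The family of these conjugates determines \<open>g\<close> up to the
  centre, which is trivial.\<close>

lemma finite_bounded_displacement:
  assumes center: "\<And>z. \<lbrakk>z \<in> carrier G; \<And>s. s \<in> X \<Longrightarrow> s \<otimes> z = z \<otimes> s\<rbrakk> \<Longrightarrow> z = \<one>"
  shows "finite {g \<in> carrier G. \<exists>k \<in> K. \<forall>s \<in> X. d (\<phi> g k) (\<phi> s (\<phi> g k)) \<le> C}" (is "finite ?B")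
proof -
  define F where "F g = (\<lambda>s \<in> X. inv g \<otimes> s \<otimes> g)" for g
  have "F g \<in> X \<rightarrow>\<^sub>E near C" if g: "g \<in> ?B" for g
  proof -
    from g obtain k where k: "g \<in> carrier G" "k \<in> K" "\<And>s. s \<in> X \<Longrightarrow> d (\<phi> g k) (\<phi> s (\<phi> g k)) \<le> C"
      by auto
    have "inv g \<otimes> s \<otimes> g \<in> near C" if s: "s \<in> X" for s
    proof (rule nearI[OF _ k(2,2)])
      have s_in: "s \<in> carrier G" and k_in: "k \<in> M" using s gens_in k K_in by auto
      show "inv g \<otimes> s \<otimes> g \<in> carrier G" using k(1) s_in by simp
      have "d k (\<phi> (inv g \<otimes> s \<otimes> g) k) = d (\<phi> g k) (\<phi> s (\<phi> g k))"
        using act_dist[of "inv g" "\<phi> g k" "\<phi> s (\<phi> g k)"] k(1) s_in k_in act_in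
        by (simp add: act_mult)
      then show "d k (\<phi> (inv g \<otimes> s \<otimes> g) k) \<le> C" using k(3)[OF s] by simp
    qed
    then show ?thesis unfolding F_def by auto
  qed
  then have "F ` ?B \<subseteq> X \<rightarrow>\<^sub>E near C" by blast
  moreover have "finite (X \<rightarrow>\<^sub>E near C)" using finite_gens finite_near by (rule finite_PiE)
  moreover have "inj_on F ?B"
  proof (rule inj_onI)
    fix g h assume "g \<in> ?B" "h \<in> ?B" and eq: "F g = F h"
    then have gh: "g \<in> carrier G" "h \<in> carrier G" by auto
    have "g \<otimes> inv h = \<one>"
    proof (rule center)
      show "g \<otimes> inv h \<in> carrier G" using gh by simp
      fix s assume s: "s \<in> X"
      then have s_in: "s \<in> carrier G" using gens_in by auto
      have "inv g \<otimes> s \<otimes> g = inv h \<otimes> s \<otimes> h" using fun_cong[OF eq, of s] s by (simp add: F_def)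
      then have "g \<otimes> (inv g \<otimes> s \<otimes> g) \<otimes> inv h = g \<otimes> (inv h \<otimes> s \<otimes> h) \<otimes> inv h" by simp
      moreover have "g \<otimes> (inv g \<otimes> s \<otimes> g) \<otimes> inv h = s \<otimes> (g \<otimes> inv h)"
        using gh s_in by (simp add: m_assoc[symmetric])
      moreover have "g \<otimes> (inv h \<otimes> s \<otimes> h) \<otimes> inv h = (g \<otimes> inv h) \<otimes> s"
        using gh s_in by (simp add: m_assoc)
      ultimately show "s \<otimes> (g \<otimes> inv h) = (g \<otimes> inv h) \<otimes> s" by simp
    qed
    then show "g = h" using gh by (metis inv_equality inv_inv inv_closed)
  qed
  ultimately show ?thesis by (meson finite_imageD finite_subset)
qed

text \<open>Only finitely many translates of \<open>K\<close> contain points of displacement at most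
  \<open>C\<close>, and \<open>K\<close> is compact. This is what keeps a minimising sequence of
  maps from drifting away.\<close>

lemma bounded_displacement_compact:
  fixes y :: "nat \<Rightarrow> 'a"
  assumes center: "\<And>z. \<lbrakk>z \<in> carrier G; \<And>s. s \<in> X \<Longrightarrow> s \<otimes> z = z \<otimes> s\<rbrakk> \<Longrightarrow> z = \<one>"
    and y: "\<And>n. y n \<in> M" "\<And>n s. s \<in> X \<Longrightarrow> d (y n) (\<phi> s (y n)) \<le> C"
  obtains q r where "q \<in> M" "strict_mono r" "(\<lambda>n. d (y (r n)) q) \<longlonglongrightarrow> 0"
proof -
  let ?B = "{g \<in> carrier G. \<exists>k \<in> K. \<forall>s \<in> X. d (\<phi> g k) (\<phi> s (\<phi> g k)) \<le> C}"
  have "\<exists>g k. g \<in> carrier G \<and> k \<in> K \<and> y n = \<phi> g k" for n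
    using cover[OF y(1)[of n]] by metis
  then obtain g k where gk: "\<And>n. g n \<in> carrier G" "\<And>n. k n \<in> K" "\<And>n. y n = \<phi> (g n) (k n)"
    by metis
  have "g n \<in> ?B" for n
    using gk(1)[of n] gk(2)[of n] y(2)[of _ n] unfolding gk(3)[of n] by auto
  then have "range g \<subseteq> ?B" by blast
  then have "finite (range g)" by (rule finite_subset) (rule finite_bounded_displacement[OF center])
  then obtain n0 where "infinite {n. g n = g n0}"
    using pigeonhole_infinite[of UNIV g] by auto
  then obtain r1 :: "nat \<Rightarrow> nat" where r1: "strict_mono r1" "\<And>n. r1 n \<in> {n. g n = g n0}"
    using infinite_enumerate by blast
  obtain q r2 where q: "q \<in> K" "strict_mono r2" "(\<lambda>n. d (k (r1 (r2 n))) q) \<longlonglongrightarrow> 0"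
    using K_seq_compact[of "\<lambda>n. k (r1 n)"] gk(2) by metis
  have q_in: "q \<in> M" using q K_in by auto
  have "d (y (r1 (r2 n))) (\<phi> (g n0) q) = d (k (r1 (r2 n))) q" for n
  proof -
    have "g (r1 (r2 n)) = g n0" using r1(2)[of "r2 n"] by simp
    then have "y (r1 (r2 n)) = \<phi> (g n0) (k (r1 (r2 n)))" using gk(3)[of "r1 (r2 n)"] by simp
    moreover have "k (r1 (r2 n)) \<in> M" using gk(2) K_in by blast
    ultimately show ?thesis using act_dist[OF gk(1) _ q_in] by simp
  qed
  then have "(\<lambda>n. d (y ((r1 \<circ> r2) n)) (\<phi> (g n0) q)) \<longlonglongrightarrow> 0" using q(3) by simp
  moreover have "strict_mono (r1 \<circ> r2)" using r1(1) q(2) by (rule strict_mono_o)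
  moreover have "\<phi> (g n0) q \<in> M" using act_in gk(1) q_in by blast
  ultimately show thesis using that by blast
qed

end

section \<open>Equivariant maps on the vertices\<close>

locale action_pair =
  src: fg_tree_action M d G \<phi> X x0 + tgt: fg_tree_action M' d' G \<phi>' X x1
  for M :: "'a set" and d and G :: "('g, 'm) monoid_scheme" (structure) and \<phi> :: "'g \<Rightarrow> 'a \<Rightarrow> 'a"
    and X x0 and M' :: "'b set" and d' and \<phi>' :: "'g \<Rightarrow> 'b \<Rightarrow> 'b" and x1 +
  assumes center: "\<And>z. \<lbrakk>z \<in> carrier G; \<And>s. s \<in> X \<Longrightarrow> s \<otimes> z = z \<otimes> s\<rbrakk> \<Longrightarrow> z = \<one>"
begin

abbreviation V where "V \<equiv> src.branch_points"
abbreviation A where "A \<equiv> src.branch_arcs"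

text \<open>Values outside the branch points are irrelevant: the map is thought of as extended
  linearly over the arcs, and \<open>lip\<close> bounds the stretch of that extension.\<close>

definition equivariant :: "('a \<Rightarrow> 'b) \<Rightarrow> bool" where
  "equivariant f \<longleftrightarrow> (\<forall>v \<in> V. f v \<in> M') \<and> (\<forall>g \<in> carrier G. \<forall>v \<in> V. f (\<phi> g v) = \<phi>' g (f v))"

definition lip :: "real \<Rightarrow> ('a \<Rightarrow> 'b) \<Rightarrow> bool" where
  "lip L f \<longleftrightarrow> (\<forall>(v, w) \<in> A. d' (f v) (f w) \<le> L * d v w)"

lemma equivariantD:
  assumes "equivariant f"
  shows "v \<in> V \<Longrightarrow> f v \<in> M'" "\<lbrakk>g \<in> carrier G; v \<in> V\<rbrakk> \<Longrightarrow> f (\<phi> g v) = \<phi>' g (f v)"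
  using assms unfolding equivariant_def by auto

lemma lipD: "\<lbrakk>lip L f; (v, w) \<in> A\<rbrakk> \<Longrightarrow> d' (f v) (f w) \<le> L * d v w"
  unfolding lip_def by auto

lemma V_in: "v \<in> V \<Longrightarrow> v \<in> M" using src.branch_points_in by auto

lemma equivariant_dist:
  assumes "equivariant f" "g \<in> carrier G" "v \<in> V" "w \<in> V"
  shows "d' (f (\<phi> g v)) (f (\<phi> g w)) = d' (f v) (f w)"
  using equivariantD[OF assms(1)] assms tgt.act_dist by simp

text \<open>Induction along the arcs from \<open>v\<close> to \<open>w\<close>. The number of branch
  points on the remaining segment drops with each arc, since \<open>v\<close> is left
  behind.\<close>

lemma segment_induct:
  assumes "v \<in> V" "w \<in> V"
    and refl: "\<And>v. v \<in> V \<Longrightarrow> P v v"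
    and step: "\<And>v u w. \<lbrakk>(v, u) \<in> A; src.btw v u w; w \<in> V; P u w\<rbrakk> \<Longrightarrow> P v w"
  shows "P v w"
  using assms(1,2)
proof (induction "card {z \<in> V. src.btw v z w}" arbitrary: v rule: less_induct)
  case less
  show ?case
  proof (cases "v = w")
    case True
    then show ?thesis using refl less by simp
  next
    case False
    then obtain u where u: "(v, u) \<in> A" "src.btw v u w" using src.first_arc less.prems by metis
    note A = src.branch_arcsD[OF u(1)]
    have "{z \<in> V. src.btw u z w} \<subset> {z \<in> V. src.btw v z w}"
    proof
      have wuv: "src.btw w u v" using u(2) by (rule src.btw_sym)
      show "{z \<in> V. src.btw u z w} \<subseteq> {z \<in> V. src.btw v z w}"
      proof
        fix z assume "z \<in> {z \<in> V. src.btw u z w}"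
        then have z: "z \<in> V" "src.btw w z u" using src.btw_sym by auto
        from src.btw_inner1[OF wuv z(2)] have "src.btw v z w" by (rule src.btw_sym)
        then show "z \<in> {z \<in> V. src.btw v z w}" using z by simp
      qed
      have "\<not> src.btw u v w" using src.btw_antisym[OF wuv src.btw_sym] A(3) by metis
      moreover have "src.btw v v w" using A(4) V_in[OF less.prems(2)] by simp
      ultimately show "{z \<in> V. src.btw u z w} \<noteq> {z \<in> V. src.btw v z w}" using less.prems by blast
    qed
    then have "card {z \<in> V. src.btw u z w} < card {z \<in> V. src.btw v z w}"
      using src.finite_branch_segment[OF A(4) V_in[OF less.prems(2)]] by (rule psubset_card_mono[rotated])
    then have "P u w" using less.hyps A(2) less.prems(2) by blast
    then show ?thesis using step[OF u less.prems(2)] by blast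
  qed
qed

lemma lip_global:
  assumes "equivariant f" "lip L f" "v \<in> V" "w \<in> V"
  shows "d' (f v) (f w) \<le> L * d v w"
  using assms(3,4)
proof (rule segment_induct)
  show "d' (f v) (f v) \<le> L * d v v" if "v \<in> V" for v
    using that equivariantD(1)[OF assms(1)] V_in by simp
  fix v u w assume a: "(v, u) \<in> A" "src.btw v u w" "w \<in> V" "d' (f u) (f w) \<le> L * d u w"
  note A = src.branch_arcsD[OF a(1)]
  have "d' (f v) (f w) \<le> d' (f v) (f u) + d' (f u) (f w)"
    using tgt.triangle equivariantD(1)[OF assms(1)] A a(3) by blast
  also have "\<dots> \<le> L * d v u + L * d u w" using lipD[OF assms(2) a(1)] a(4) by simp
  also have "\<dots> = L * d v w" using src.btw_dist[OF a(2)] by (simp add: algebra_simps)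
  finally show "d' (f v) (f w) \<le> L * d v w" .
qed

text \<open>Freeness makes the element carrying an orbit representative \<open>R v\<close> to
  \<open>v\<close> unique. Sending all representatives to \<open>x1\<close> therefore extends
  consistently over the orbits.\<close>

lemma ex_equivariant: "\<exists>f. equivariant f"
proof -
  define R where "R v = (SOME u. u \<in> orbit G \<phi> v)" for v
  have orb: "orbit G \<phi> (\<phi> g v) = orbit G \<phi> v" if g: "g \<in> carrier G" and v: "v \<in> M" for g v
  proof (intro equalityI subsetI)
    fix y assume "y \<in> orbit G \<phi> (\<phi> g v)"
    then obtain h where "h \<in> carrier G" "y = \<phi> h (\<phi> g v)" by (auto simp: orbit_def)
    then have "h \<otimes> g \<in> carrier G" "y = \<phi> (h \<otimes> g) v" using g v by (simp_all add: src.act_mult)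
    then show "y \<in> orbit G \<phi> v" unfolding orbit_def by blast
  next
    fix y assume "y \<in> orbit G \<phi> v"
    then obtain h where h: "h \<in> carrier G" "y = \<phi> h v" by (auto simp: orbit_def)
    then have "h \<otimes> inv g \<in> carrier G" "y = \<phi> (h \<otimes> inv g) (\<phi> g v)"
      using g v src.act_in by (simp_all add: src.act_mult)
    then show "y \<in> orbit G \<phi> (\<phi> g v)" unfolding orbit_def by blast
  qed
  have R: "R v \<in> M" "\<exists>g \<in> carrier G. \<phi> g (R v) = v" if v: "v \<in> M" for v
  proof -
    have "v \<in> orbit G \<phi> v" using src.act_one[OF v] unfolding orbit_def by force
    then have "R v \<in> orbit G \<phi> v" unfolding R_def by (rule someI)
    then obtain h where h: "h \<in> carrier G" "R v = \<phi> h v" by (auto simp: orbit_def)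
    then show "R v \<in> M" using src.act_in v by simp
    show "\<exists>g \<in> carrier G. \<phi> g (R v) = v" using h v by (intro bexI[of _ "inv h"]) auto
  qed
  define \<gamma> where "\<gamma> v = (SOME g. g \<in> carrier G \<and> \<phi> g (R v) = v)" for v
  have \<gamma>: "\<gamma> v \<in> carrier G" "\<phi> (\<gamma> v) (R v) = v" if "v \<in> M" for v
    using someI_ex[of "\<lambda>g. g \<in> carrier G \<and> \<phi> g (R v) = v"] R(2)[OF that] unfolding \<gamma>_def by auto
  have "equivariant (\<lambda>v. \<phi>' (\<gamma> v) x1)"
    unfolding equivariant_def
  proof (intro conjI ballI)
    show "\<phi>' (\<gamma> v) x1 \<in> M'" if "v \<in> V" for v
      using tgt.act_in \<gamma>(1) V_in that tgt.base_in by blast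
    fix g v assume g: "g \<in> carrier G" and "v \<in> V"
    then have v: "v \<in> M" "\<phi> g v \<in> M" using V_in src.act_in by auto
    have "R (\<phi> g v) = R v" unfolding R_def orb[OF g v(1)] ..
    then have "\<phi> (\<gamma> (\<phi> g v)) (R v) = \<phi> (g \<otimes> \<gamma> v) (R v)"
      using \<gamma>[OF v(2)] \<gamma>[OF v(1)] g R(1)[OF v(1)] by (simp add: src.act_mult)
    then have "\<gamma> (\<phi> g v) = g \<otimes> \<gamma> v"
      using src.act_eq[OF \<gamma>(1)[OF v(2)] _ R(1)[OF v(1)]] g \<gamma>(1)[OF v(1)] by simp
    then show "\<phi>' (\<gamma> (\<phi> g v)) x1 = \<phi>' g (\<phi>' (\<gamma> v) x1)"
      using tgt.act_mult g \<gamma>(1)[OF v(1)] tgt.base_in by simp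
  qed
  then show ?thesis by blast
qed

definition arc_reps where "arc_reps = {(v, w). v \<in> src.K \<and> (v, w) \<in> A}"

lemma finite_arc_reps: "finite arc_reps"
  unfolding arc_reps_def by (rule src.finite_arc_representatives)

lemma arc_repsE:
  assumes "(v, w) \<in> A"
  obtains g a b where "g \<in> carrier G" "(a, b) \<in> arc_reps" "(a, b) \<in> A" "v = \<phi> g a" "w = \<phi> g b"
proof -
  obtain g a b where ab: "g \<in> carrier G" "a \<in> src.K" "(a, b) \<in> A" "v = \<phi> g a" "w = \<phi> g b"
    by (rule src.arc_representative[OF assms])
  have "(a, b) \<in> arc_reps" using ab(2,3) by (simp add: arc_reps_def)
  from ab(1) this ab(3-5) show thesis by (rule that)
qed

lemma lip_repsI:
  assumes "equivariant f" "\<And>v w. (v, w) \<in> arc_reps \<Longrightarrow> d' (f v) (f w) \<le> L * d v w"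
  shows "lip L f"
  unfolding lip_def
proof (intro ballI, clarify)
  fix v w assume "(v, w) \<in> A"
  then obtain g a b where ab: "g \<in> carrier G" "(a, b) \<in> arc_reps" "(a, b) \<in> A" "v = \<phi> g a" "w = \<phi> g b"
    by (rule arc_repsE)
  note A = src.branch_arcsD[OF ab(3)]
  show "d' (f v) (f w) \<le> L * d v w"
    unfolding ab(4,5) using equivariant_dist[OF assms(1) ab(1) A(1,2)] src.act_dist[OF ab(1) A(4,5)]
      assms(2)[OF ab(2)] by simp
qed

lemma ex_lip: "\<exists>f L. equivariant f \<and> 0 \<le> L \<and> lip L f"
proof -
  obtain f where f: "equivariant f" using ex_equivariant by blast
  \<comment> \<open>Any common bound for the finitely many stretch factors will do; the sum avoids a
    maximum over a possibly empty set.\<close>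
  define L where "L = (\<Sum>(v, w) \<in> arc_reps. d' (f v) (f w) / d v w)"
  have term_nonneg: "0 \<le> (case e of (v, w) \<Rightarrow> d' (f v) (f w) / d v w)" for e
    by (cases e) simp
  have "0 \<le> L" unfolding L_def by (rule sum_nonneg) (rule term_nonneg)
  moreover have "lip L f"
  proof (rule lip_repsI[OF f])
    fix v w assume vw: "(v, w) \<in> arc_reps"
    then have pos: "d v w > 0" using src.branch_arcsD(7) by (auto simp: arc_reps_def)
    have "d' (f v) (f w) / d v w \<le> L"
      unfolding L_def using member_le_sum[OF vw _ finite_arc_reps,
          of "\<lambda>(v, w). d' (f v) (f w) / d v w"] term_nonneg by simp
    then show "d' (f v) (f w) \<le> L * d v w" using pos by (simp add: pos_divide_le_eq)
  qed
  ultimately show ?thesis using f by blast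
qed

lemma limit_unique:
  assumes "p \<in> M'" "q \<in> M'" "\<And>n. y n \<in> M'" "(\<lambda>n. d' (y n) p) \<longlonglongrightarrow> 0" "(\<lambda>n. d' (y n) q) \<longlonglongrightarrow> 0"
  shows "p = q"
proof -
  have "(\<lambda>n. d' (y n) p + d' (y n) q) \<longlonglongrightarrow> 0 + 0" by (rule tendsto_add[OF assms(4,5)])
  moreover have "d' p q \<le> d' (y n) p + d' (y n) q" for n
    using tgt.triangle[OF assms(1) assms(3)[of n] assms(2)] tgt.commute[of p "y n"] by simp
  ultimately have "d' p q \<le> 0 + 0" by (intro LIMSEQ_le_const) auto
  then have "d' p q = 0" using tgt.nonneg[of p q] by simp
  then show ?thesis using assms(1,2) by simp
qed

text \<open>Equivariance turns the Lipschitz bound into a bound, independent of \<open>n\<close>, on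
  how far the generators move \<open>f n v\<close>. So compactness applies at each point of
  \<open>R\<close>, one after the other, with nested subsequences.\<close>

lemma subsequence_limits:
  assumes f: "\<And>n. equivariant (f n)" "\<And>n. lip L (f n)" and R: "finite R" "R \<subseteq> V"
  shows "\<exists>r. strict_mono (r :: nat \<Rightarrow> nat) \<and> (\<forall>v \<in> R. \<exists>l \<in> M'. (\<lambda>n. d' (f (r n) v) l) \<longlonglongrightarrow> 0)"
  using R
proof (induction R rule: finite_induct)
  case empty
  show ?case using strict_mono_id by auto
next
  case (insert v R)
  then obtain r where r: "strict_mono (r :: nat \<Rightarrow> nat)"
    "\<And>v. v \<in> R \<Longrightarrow> \<exists>l \<in> M'. (\<lambda>n. d' (f (r n) v) l) \<longlonglongrightarrow> 0" by auto
  have v: "v \<in> V" using insert by simp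
  define C where "C = (\<Sum>s \<in> X. \<bar>L\<bar> * d v (\<phi> s v))"
  have "d' (f n v) (\<phi>' s (f n v)) \<le> C" if s: "s \<in> X" for n s
  proof -
    have s_in: "s \<in> carrier G" using s src.gens_in by auto
    have "d' (f n v) (\<phi>' s (f n v)) = d' (f n v) (f n (\<phi> s v))"
      using equivariantD(2)[OF f(1) s_in v] by simp
    also have "\<dots> \<le> L * d v (\<phi> s v)"
      by (rule lip_global[OF f v src.act_branch_point[OF v s_in]])
    also have "\<dots> \<le> \<bar>L\<bar> * d v (\<phi> s v)" by (rule mult_right_mono) auto
    also have "\<dots> \<le> C" unfolding C_def
      using member_le_sum[OF s _ src.finite_gens, of "\<lambda>s. \<bar>L\<bar> * d v (\<phi> s v)"] by simp
    finally show ?thesis .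
  qed
  then obtain q r' where q: "q \<in> M'" "strict_mono r'" "(\<lambda>n. d' (f (r (r' n)) v) q) \<longlonglongrightarrow> 0"
    using tgt.bounded_displacement_compact[OF center, of "\<lambda>n. f (r n) v" C]
      equivariantD(1)[OF f(1) v] by metis
  have "\<exists>l \<in> M'. (\<lambda>n. d' (f ((r \<circ> r') n) w) l) \<longlonglongrightarrow> 0" if w: "w \<in> insert v R" for w
  proof (cases "w = v")
    case True
    then show ?thesis using q by auto
  next
    case False
    then obtain l where l: "l \<in> M'" "(\<lambda>n. d' (f (r n) w) l) \<longlonglongrightarrow> 0" using w r(2) by blast
    have "((\<lambda>n. d' (f (r n) w) l) \<circ> r') \<longlonglongrightarrow> 0" using LIMSEQ_subseq_LIMSEQ[OF l(2) q(2)] .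
    then show ?thesis using l(1) by (auto simp: comp_def)
  qed
  moreover have "strict_mono (r \<circ> r')" using r(1) q(2) by (rule strict_mono_o)
  ultimately show ?case by blast
qed

text \<open>A minimising sequence converges along a subsequence at the finitely many branch points
  in \<open>K\<close>; equivariance carries the limits to all branch points, and the stretch bounds
  pass to the limit.\<close>

lemma ex_minimal_lip:
  obtains f \<mu> where "equivariant f" "0 \<le> \<mu>" "lip \<mu> f"
    "\<And>g L. \<lbrakk>equivariant g; 0 \<le> L; lip L g\<rbrakk> \<Longrightarrow> \<mu> \<le> L"
proof -
  define S where "S = {L. 0 \<le> L \<and> (\<exists>f. equivariant f \<and> lip L f)}"
  define \<mu> where "\<mu> = Inf S"
  have S: "S \<noteq> {}" "bdd_below S" using ex_lip by (auto simp: S_def intro!: bdd_belowI[of _ 0])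
  have min: "\<mu> \<le> L" if "equivariant g" "0 \<le> L" "lip L g" for g L
    unfolding \<mu>_def using S(2) that by (intro cInf_lower) (auto simp: S_def)
  have \<mu>0: "0 \<le> \<mu>" unfolding \<mu>_def by (rule cInf_greatest[OF S(1)]) (simp add: S_def)
  have "\<exists>f. equivariant f \<and> lip (\<mu> + inverse (real (Suc n))) f" for n
  proof -
    have "\<mu> < \<mu> + inverse (real (Suc n))" by simp
    then obtain L where L: "L \<in> S" "L < \<mu> + inverse (real (Suc n))"
      using cInf_lessD[OF S(1)] unfolding \<mu>_def by blast
    then obtain f where f: "equivariant f" "lip L f" by (auto simp: S_def)
    have "lip (\<mu> + inverse (real (Suc n))) f"
    proof (rule lip_repsI[OF f(1)])
      fix v w assume "(v, w) \<in> arc_reps"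
      then have "d' (f v) (f w) \<le> L * d v w" using lipD[OF f(2)] by (auto simp: arc_reps_def)
      also have "\<dots> \<le> (\<mu> + inverse (real (Suc n))) * d v w"
        using L(2) by (intro mult_right_mono) auto
      finally show "d' (f v) (f w) \<le> (\<mu> + inverse (real (Suc n))) * d v w" .
    qed
    then show ?thesis using f(1) by blast
  qed
  then obtain f where f: "\<And>n. equivariant (f n)" "\<And>n. lip (\<mu> + inverse (real (Suc n))) (f n)"
    by metis
  \<comment> \<open>The extraction of limits requires one constant for the whole sequence.\<close>
  have lip1: "lip (\<mu> + 1) (f n)" for n
  proof (rule lip_repsI[OF f(1)])
    fix v w assume "(v, w) \<in> arc_reps"
    then have "d' (f n v) (f n w) \<le> (\<mu> + inverse (real (Suc n))) * d v w"
      using lipD[OF f(2)] by (auto simp: arc_reps_def)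
    also have "\<dots> \<le> (\<mu> + 1) * d v w"
      by (intro mult_right_mono add_left_mono) (auto simp: inverse_eq_divide)
    finally show "d' (f n v) (f n w) \<le> (\<mu> + 1) * d v w" .
  qed
  have "\<exists>r. strict_mono (r :: nat \<Rightarrow> nat) \<and>
      (\<forall>v \<in> V \<inter> src.K. \<exists>l \<in> M'. (\<lambda>n. d' (f (r n) v) l) \<longlonglongrightarrow> 0)"
    by (rule subsequence_limits[OF f(1) lip1 src.finite_branch_K]) simp
  then obtain r where r: "strict_mono (r :: nat \<Rightarrow> nat)"
    "\<And>v. v \<in> V \<inter> src.K \<Longrightarrow> \<exists>l \<in> M'. (\<lambda>n. d' (f (r n) v) l) \<longlonglongrightarrow> 0"
    by blast
  have ex_lim: "\<exists>l \<in> M'. (\<lambda>n. d' (f (r n) v) l) \<longlonglongrightarrow> 0" if v: "v \<in> V" for v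
  proof -
    obtain g k where gk: "g \<in> carrier G" "k \<in> V \<inter> src.K" "v = \<phi> g k" by (rule src.branch_orbit_K[OF v])
    obtain l where l: "l \<in> M'" "(\<lambda>n. d' (f (r n) k) l) \<longlonglongrightarrow> 0" using r(2)[OF gk(2)] by blast
    have "d' (f (r n) v) (\<phi>' g l) = d' (f (r n) k) l" for n
      using equivariantD[OF f(1)[of "r n"]] gk l(1) tgt.act_dist by simp
    then have "(\<lambda>n. d' (f (r n) v) (\<phi>' g l)) \<longlonglongrightarrow> 0" using l(2) by simp
    then show ?thesis using tgt.act_in[OF gk(1) l(1)] by blast
  qed
  define F where "F v = (SOME l. l \<in> M' \<and> (\<lambda>n. d' (f (r n) v) l) \<longlonglongrightarrow> 0)" for v
  have F: "F v \<in> M'" "(\<lambda>n. d' (f (r n) v) (F v)) \<longlonglongrightarrow> 0" if "v \<in> V" for v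
    using someI_ex[of "\<lambda>l. l \<in> M' \<and> (\<lambda>n. d' (f (r n) v) l) \<longlonglongrightarrow> 0"] ex_lim[OF that]
    unfolding F_def by auto
  have eqF: "equivariant F"
    unfolding equivariant_def
  proof (intro conjI ballI)
    fix g v assume g: "g \<in> carrier G" and v: "v \<in> V"
    have gv: "\<phi> g v \<in> V" using src.act_branch_point v g by blast
    have "d' (f (r n) (\<phi> g v)) (\<phi>' g (F v)) = d' (f (r n) v) (F v)" for n
      using equivariantD[OF f(1)[of "r n"]] g v F(1)[OF v] tgt.act_dist by simp
    then have "(\<lambda>n. d' (f (r n) (\<phi> g v)) (\<phi>' g (F v))) \<longlonglongrightarrow> 0" using F(2)[OF v] by simp
    then show "F (\<phi> g v) = \<phi>' g (F v)"
      using limit_unique[OF F(1)[OF gv] tgt.act_in[OF g F(1)[OF v]] _ F(2)[OF gv]]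
        equivariantD(1)[OF f(1) gv] by blast
  qed (rule F(1))
  moreover have "lip \<mu> F"
  proof (rule lip_repsI[OF eqF])
    fix v w assume "(v, w) \<in> arc_reps"
    then have arc: "(v, w) \<in> A" by (auto simp: arc_reps_def)
    note A = src.branch_arcsD[OF arc]
    have lim1: "(\<lambda>n. inverse (real (Suc (r n)))) \<longlonglongrightarrow> 0"
      using LIMSEQ_subseq_LIMSEQ[OF LIMSEQ_inverse_real_of_nat r(1)] by (simp add: comp_def)
    have "(\<lambda>n. d' (f (r n) v) (F v) + (\<mu> + inverse (real (Suc (r n)))) * d v w + d' (f (r n) w) (F w))
        \<longlonglongrightarrow> 0 + (\<mu> + 0) * d v w + 0"
      by (intro tendsto_intros F(2) A lim1)
    moreover have "d' (F v) (F w) \<le>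
        d' (f (r n) v) (F v) + (\<mu> + inverse (real (Suc (r n)))) * d v w + d' (f (r n) w) (F w)" for n
      using tgt.dist_triangle4[OF F(1)[OF A(1)] equivariantD(1)[OF f(1) A(1)]
          equivariantD(1)[OF f(1) A(2)] F(1)[OF A(2)], of "r n" "r n"]
        lipD[OF f(2)[of "r n"] arc] tgt.commute[of "F v" "f (r n) v"] by linarith
    ultimately have "d' (F v) (F w) \<le> 0 + (\<mu> + 0) * d v w + 0" by (intro LIMSEQ_le_const) auto
    then show "d' (F v) (F w) \<le> \<mu> * d v w" by simp
  qed
  ultimately show thesis using that \<mu>0 min by blast
qed

end

section \<open>Arcs of maximal stretch\<close>

context action_pair
begin

text \<open>The preimage in the source tree of what is known as the tension graph of
  \<open>f\<close>, when \<open>\<mu>\<close> bounds the stretch.\<close>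

definition tension :: "real \<Rightarrow> ('a \<Rightarrow> 'b) \<Rightarrow> ('a \<times> 'a) set" where
  "tension \<mu> f = {(v, w). (v, w) \<in> A \<and> d' (f v) (f w) = \<mu> * d v w}"

definition tension_orbits :: "real \<Rightarrow> ('a \<Rightarrow> 'b) \<Rightarrow> ('a \<times> 'a) set set" where
  "tension_orbits \<mu> f = arc_orbit G \<phi> ` tension \<mu> f"

lemma tension_iff: "(v, w) \<in> tension \<mu> f \<longleftrightarrow> (v, w) \<in> A \<and> d' (f v) (f w) = \<mu> * d v w"
  by (simp add: tension_def)

lemma tension_act:
  assumes "equivariant f" "(v, w) \<in> tension \<mu> f" "g \<in> carrier G"
  shows "(\<phi> g v, \<phi> g w) \<in> tension \<mu> f"
proof -
  have arc: "(v, w) \<in> A" using assms(2) by (simp add: tension_iff)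
  note A = src.branch_arcsD[OF arc]
  show ?thesis
    unfolding tension_iff equivariant_dist[OF assms(1,3) A(1,2)] src.act_dist[OF assms(3) A(4,5)]
    using assms(2) src.act_branch_arc[OF arc assms(3)] by (simp add: tension_iff)
qed

lemma tension_sym: "(v, w) \<in> tension \<mu> f \<Longrightarrow> (w, v) \<in> tension \<mu> f"
  unfolding tension_iff using src.branch_arcs_sym src.commute[of v w] tgt.commute[of "f v" "f w"] by simp

lemma arc_orbit_act:
  assumes "v \<in> M" "w \<in> M" "g \<in> carrier G"
  shows "arc_orbit G \<phi> (\<phi> g v, \<phi> g w) = arc_orbit G \<phi> (v, w)"
proof (intro equalityI subsetI)
  fix e assume "e \<in> arc_orbit G \<phi> (\<phi> g v, \<phi> g w)"
  then obtain h where h: "h \<in> carrier G" "e = (\<phi> h (\<phi> g v), \<phi> h (\<phi> g w))" by (auto simp: arc_orbit_def)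
  then have "e = map_prod (\<phi> (h \<otimes> g)) (\<phi> (h \<otimes> g)) (v, w)" using assms by (simp add: src.act_mult)
  then show "e \<in> arc_orbit G \<phi> (v, w)" unfolding arc_orbit_def using h(1) assms(3) by blast
next
  fix e assume "e \<in> arc_orbit G \<phi> (v, w)"
  then obtain h where h: "h \<in> carrier G" "e = (\<phi> h v, \<phi> h w)" by (auto simp: arc_orbit_def)
  then have "e = map_prod (\<phi> (h \<otimes> inv g)) (\<phi> (h \<otimes> inv g)) (\<phi> g v, \<phi> g w)"
    using assms src.act_in by (simp add: src.act_mult)
  then show "e \<in> arc_orbit G \<phi> (\<phi> g v, \<phi> g w)" unfolding arc_orbit_def using h(1) assms(3) by blast
qed

lemma finite_arc_orbits: "finite (arc_orbit G \<phi> ` A)"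
proof -
  have "arc_orbit G \<phi> ` A \<subseteq> arc_orbit G \<phi> ` arc_reps"
  proof
    fix o' assume "o' \<in> arc_orbit G \<phi> ` A"
    then obtain v w where vw: "(v, w) \<in> A" "o' = arc_orbit G \<phi> (v, w)" by auto
    obtain g a b where ab: "g \<in> carrier G" "(a, b) \<in> arc_reps" "(a, b) \<in> A" "v = \<phi> g a" "w = \<phi> g b"
      by (rule arc_repsE[OF vw(1)])
    have "o' = arc_orbit G \<phi> (a, b)"
      unfolding vw(2) ab(4,5) using arc_orbit_act ab(1) src.branch_arcsD(4,5)[OF ab(3)] by blast
    then show "o' \<in> arc_orbit G \<phi> ` arc_reps" using ab(2) by blast
  qed
  then show ?thesis using finite_arc_reps by (meson finite_imageI finite_subset)
qed

lemma finite_tension_orbits: "finite (tension_orbits \<mu> f)"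
  unfolding tension_orbits_def
  by (rule finite_subset[OF _ finite_arc_orbits]) (auto simp: tension_def)

text \<open>Move the image of \<open>v\<close>, and equivariantly those of its orbit, in the common direction of the
  maximally stretched arcs at \<open>v\<close>.\<close>

lemma relax:
  assumes f: "equivariant f" "lip \<mu> f" and uv: "(u, v) \<in> tension \<mu> f"
    and stuck: "\<And>w. (v, w) \<in> tension \<mu> f \<Longrightarrow> \<not> tgt.btw (f u) (f v) (f w)"
  shows "\<exists>f'. equivariant f' \<and> lip \<mu> f' \<and> tension_orbits \<mu> f' \<subset> tension_orbits \<mu> f"
proof -
  have vu: "(v, u) \<in> tension \<mu> f" by (rule tension_sym[OF uv])
  then have arc_vu: "(v, u) \<in> A" by (simp add: tension_iff)
  have vV: "v \<in> V" and uV: "u \<in> V" using src.branch_arcsD[OF arc_vu] by auto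
  note f_in = equivariantD(1)[OF f(1)] and f_eq = equivariantD(2)[OF f(1)]
  define N where "N = {w. (v, w) \<in> A}"
  have finN: "finite N" unfolding N_def using src.finite_arcs_at[OF vV] .
  have wV: "w \<in> V" "w \<in> M" if "w \<in> N" for w using that src.branch_arcsD[of v w] by (auto simp: N_def)
  have pos: "d v w > 0" if "w \<in> N" for w using that src.branch_arcsD(7)[of v w] by (auto simp: N_def)
  \<comment> \<open>By \<open>stuck\<close>, the images of all stretched arcs at \<open>v\<close>
    leave \<open>f v\<close> in the direction of \<open>f u\<close>; \<open>r\<close> measures the
    initial piece they share with the segment to \<open>f u\<close>.\<close>
  have "\<exists>r>0. \<forall>q. tgt.btw (f v) q (f u) \<longrightarrow> d' (f v) q \<le> r \<longrightarrow> tgt.btw (f v) q (f w)"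
    if w: "(v, w) \<in> tension \<mu> f" for w
  proof -
    have "w \<in> V" using w src.branch_arcsD[of v w] by (simp add: tension_iff)
    then show ?thesis
      using tgt.not_btw_common[OF f_in[OF uV] f_in[OF vV] f_in stuck[OF w]] by metis
  qed
  then obtain r where r: "\<And>w. (v, w) \<in> tension \<mu> f \<Longrightarrow> r w > 0"
    "\<And>w q. (v, w) \<in> tension \<mu> f \<Longrightarrow> tgt.btw (f v) q (f u) \<Longrightarrow> d' (f v) q \<le> r w \<Longrightarrow> tgt.btw (f v) q (f w)"
    by metis
  have "f u \<noteq> f v" using stuck[OF vu] f_in[OF uV] f_in[OF vV] by auto
  then have pos_uv: "d' (f v) (f u) > 0" using f_in[OF uV] f_in[OF vV] by simp
  \<comment> \<open>The admissible move towards \<open>f w\<close>. A stretched arc requires staying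
    in the common piece and within the image. An unstretched one allows half its slack, because both
    its ends move if \<open>w\<close> lies in the orbit of \<open>v\<close>.\<close>
  define b where "b w = (if (v, w) \<in> tension \<mu> f then min (r w) (\<mu> * d v w)
    else (\<mu> * d v w - d' (f v) (f w)) / 2)" for w
  have \<mu>: "\<mu> > 0"
  proof -
    have "0 < \<mu> * d v u" using vu pos_uv by (simp add: tension_iff)
    then show ?thesis using pos[of u] arc_vu by (simp add: N_def zero_less_mult_iff)
  qed
  have b_pos: "0 < b w" if w: "w \<in> N" for w
  proof (cases "(v, w) \<in> tension \<mu> f")
    case True
    then show ?thesis using r(1) pos[OF w] \<mu> by (simp add: b_def)
  next
    case False
    have "d' (f v) (f w) \<le> \<mu> * d v w" using lipD[OF f(2)] w by (simp add: N_def)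
    then show ?thesis using False w by (simp add: b_def tension_iff N_def)
  qed
  obtain t where t: "0 < t" "\<And>x. x \<in> insert (d' (f v) (f u)) (b ` N) \<Longrightarrow> t < x"
    using positive_below_finite[of "insert (d' (f v) (f u)) (b ` N)"] finN b_pos pos_uv by blast
  obtain q where q: "tgt.btw (f v) q (f u)" "d' (f v) q = t"
    using tgt.btw_point[OF f_in[OF vV] f_in[OF uV], of t] t by (metis insertI1 less_imp_le)
  have q_in: "q \<in> M'" using tgt.btw_in[OF q(1)] by simp
  \<comment> \<open>The choice is of a unique element, by freeness, so the moved value
    \<open>q\<close> is transported equivariantly over the orbit.\<close>
  define f' where "f' x = (if x \<in> orbit G \<phi> v then \<phi>' (SOME g. g \<in> carrier G \<and> x = \<phi> g v) q else f x)" for x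
  have vM: "v \<in> M" using V_in[OF vV] .
  have f'_orbit: "f' (\<phi> g v) = \<phi>' g q" if g: "g \<in> carrier G" for g
  proof -
    have "(SOME h. h \<in> carrier G \<and> \<phi> g v = \<phi> h v) = g"
      by (rule some_equality) (use g src.act_eq[OF _ _ vM] in auto)
    moreover have "\<phi> g v \<in> orbit G \<phi> v" using g by (auto simp: orbit_def)
    ultimately show ?thesis by (simp add: f'_def)
  qed
  have f'_other: "f' x = f x" if "x \<notin> orbit G \<phi> v" for x using that by (simp add: f'_def)
  have f'_v: "f' v = q" using f'_orbit[of \<one>] src.act_one[OF vM] tgt.act_one[OF q_in] by simp
  have orbit_iff: "\<phi> g x \<in> orbit G \<phi> v \<longleftrightarrow> x \<in> orbit G \<phi> v" if g: "g \<in> carrier G" and x: "x \<in> M" for g x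
  proof
    assume "\<phi> g x \<in> orbit G \<phi> v"
    then obtain h where h: "h \<in> carrier G" "\<phi> g x = \<phi> h v" by (auto simp: orbit_def)
    have "x = \<phi> (inv g) (\<phi> g x)" using g x by simp
    also have "\<dots> = \<phi> (inv g \<otimes> h) v" using h g vM by (simp add: src.act_mult)
    finally have "x = \<phi> (inv g \<otimes> h) v" .
    moreover have "inv g \<otimes> h \<in> carrier G" using g h by simp
    ultimately show "x \<in> orbit G \<phi> v" unfolding orbit_def by blast
  next
    assume "x \<in> orbit G \<phi> v"
    then obtain h where h: "h \<in> carrier G" "x = \<phi> h v" by (auto simp: orbit_def)
    then have "\<phi> g x = \<phi> (g \<otimes> h) v" "g \<otimes> h \<in> carrier G" using g vM by (simp_all add: src.act_mult)
    then show "\<phi> g x \<in> orbit G \<phi> v" unfolding orbit_def by blast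
  qed
  have eq': "equivariant f'"
    unfolding equivariant_def
  proof (intro conjI ballI)
    fix x assume x: "x \<in> V"
    show "f' x \<in> M'"
    proof (cases "x \<in> orbit G \<phi> v")
      case True
      then obtain h where "h \<in> carrier G" "x = \<phi> h v" by (auto simp: orbit_def)
      then show ?thesis using f'_orbit tgt.act_in q_in by simp
    next
      case False
      then show ?thesis using f'_other f_in x by simp
    qed
  next
    fix g x assume g: "g \<in> carrier G" and x: "x \<in> V"
    show "f' (\<phi> g x) = \<phi>' g (f' x)"
    proof (cases "x \<in> orbit G \<phi> v")
      case True
      then obtain h where h: "h \<in> carrier G" "x = \<phi> h v" by (auto simp: orbit_def)
      then have "f' (\<phi> g x) = f' (\<phi> (g \<otimes> h) v)" using g vM by (simp add: src.act_mult)
      also have "\<dots> = \<phi>' g (f' x)" using f'_orbit g h tgt.act_mult q_in by simp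
      finally show ?thesis .
    next
      case False
      then show ?thesis using f'_other orbit_iff[OF g V_in[OF x]] f_eq[OF g x] by simp
    qed
  qed
  have star: "d' (f' v) (f' w) < \<mu> * d v w" if w: "w \<in> N" for w
  proof -
    have tb: "t < b w" using t(2) w by blast
    have le: "d' (f v) (f w) \<le> \<mu> * d v w" using lipD[OF f(2)] w by (simp add: N_def)
    have fvw: "f v \<in> M'" "f w \<in> M'" using f_in vV wV w by auto
    show ?thesis
    proof (cases "(v, w) \<in> tension \<mu> f")
      case True
      then have len: "d' (f v) (f w) = \<mu> * d v w" by (simp add: tension_iff)
      have tr: "t < r w" "t < \<mu> * d v w" using tb True by (simp_all add: b_def)
      have qw: "tgt.btw (f v) q (f w)" using r(2)[OF True q(1)] q(2) tr by simp
      then have dqw: "d' q (f w) = \<mu> * d v w - t" using tgt.btw_dist[OF qw] q(2) len by simp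
      show ?thesis
      proof (cases "w \<in> orbit G \<phi> v")
        case False
        then show ?thesis using f'_v f'_other dqw t(1) by simp
      next
        \<comment> \<open>Both ends of the arc move. The reversed arc, translated back to
          \<open>v\<close>, is stretched as well, so the far end also moves inwards along the same
          image segment; the new length \<open>\<bar>2 * t - \<mu> * d v w\<bar>\<close> is still
          strictly smaller.\<close>
        case in_orbit: True
        then obtain h where h: "h \<in> carrier G" "w = \<phi> h v" by (auto simp: orbit_def)
        have fw: "f w = \<phi>' h (f v)" using f_eq h vV by simp
        let ?w = "\<phi> (inv h) v"
        have "(?w, v) \<in> tension \<mu> f" using tension_act[OF f(1) True, of "inv h"] h vM by simp
        then have w': "(v, ?w) \<in> tension \<mu> f" by (rule tension_sym)
        then have wN: "?w \<in> N" by (simp add: N_def tension_iff)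
        have "t < b ?w" using t(2) wN by blast
        then have "t < r ?w" using w' by (simp add: b_def)
        then have "tgt.btw (f v) q (f ?w)" using r(2)[OF w' q(1)] q(2) by simp
        from tgt.act_btw[OF this h(1)] have "tgt.btw (f w) (\<phi>' h q) (f v)"
          using fw f_eq[of "inv h" v] h vV fvw(1) by simp
        then have hq: "tgt.btw (f v) (\<phi>' h q) (f w)" by (rule tgt.btw_sym)
        have "d' (f w) (\<phi>' h q) = t" using fw q(2) tgt.act_dist[OF h(1) fvw(1) q_in] by simp
        then have "d' (f v) (\<phi>' h q) = \<mu> * d v w - t"
          using tgt.btw_dist[OF hq] len tgt.commute[of "f w" "\<phi>' h q"] by simp
        then have "d' q (\<phi>' h q) = \<bar>t - (\<mu> * d v w - t)\<bar>"
          using tgt.btw_dist_diff[OF qw hq] q(2) by simp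
        also have "\<dots> < \<mu> * d v w" using t(1) tr(2) by linarith
        finally show ?thesis using f'_v f'_orbit h by simp
      qed
    next
      case False
      then have slack: "2 * t < \<mu> * d v w - d' (f v) (f w)" using tb by (simp add: b_def)
      have qv: "d' q (f v) = t" using q(2) tgt.commute[of q "f v"] by simp
      show ?thesis
      proof (cases "w \<in> orbit G \<phi> v")
        case False
        have "d' q (f w) \<le> d' q (f v) + d' (f v) (f w)" using tgt.triangle q_in fvw by blast
        then show ?thesis using qv slack t(1) f'_v f'_other[OF False] by simp
      next
        case True
        then obtain h where h: "h \<in> carrier G" "w = \<phi> h v" by (auto simp: orbit_def)
        have hq_in: "\<phi>' h q \<in> M'" using tgt.act_in h q_in by blast
        have "d' q (\<phi>' h q) \<le> d' q (f v) + d' (f v) (f w) + d' (f w) (\<phi>' h q)"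
          by (rule tgt.dist_triangle4[OF q_in fvw hq_in])
        moreover have "d' (f w) (\<phi>' h q) = t"
          using f_eq[OF h(1) vV] h(2) q(2) tgt.act_dist[OF h(1) fvw(1) q_in] by simp
        ultimately show ?thesis using qv slack f'_v f'_orbit[OF h(1)] h(2) by simp
      qed
    qed
  qed
  have at_orbit: "d' (f' x) (f' y) < \<mu> * d x y" if xy: "(x, y) \<in> A" "x \<in> orbit G \<phi> v" for x y
  proof -
    obtain h where h: "h \<in> carrier G" "x = \<phi> h v" using xy(2) by (auto simp: orbit_def)
    note A = src.branch_arcsD[OF xy(1)]
    let ?w = "\<phi> (inv h) y"
    have y: "y = \<phi> h ?w" using h A by simp
    have "?w \<in> N" using src.act_branch_arc[OF xy(1), of "inv h"] h vM by (simp add: N_def)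
    then have w: "d' (f' v) (f' ?w) < \<mu> * d v ?w" "?w \<in> V" "?w \<in> M" using star wV by auto
    have "d' (f' x) (f' y) = d' (f' v) (f' ?w)"
      unfolding h(2) by (subst y, rule equivariant_dist[OF eq' h(1) vV w(2)])
    moreover have "d x y = d v ?w" unfolding h(2) by (subst y, rule src.act_dist[OF h(1) vM w(3)])
    ultimately show ?thesis using w(1) by simp
  qed
  have at_orbit': "d' (f' x) (f' y) < \<mu> * d x y" if xy: "(x, y) \<in> A" "y \<in> orbit G \<phi> v" for x y
    using at_orbit[OF src.branch_arcs_sym[OF xy(1)] xy(2)] src.commute[of x y] tgt.commute[of "f' x" "f' y"]
    by simp
  have lip': "lip \<mu> f'"
    unfolding lip_def
  proof (intro ballI, clarify)
    fix x y assume xy: "(x, y) \<in> A"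
    show "d' (f' x) (f' y) \<le> \<mu> * d x y"
    proof (cases "x \<in> orbit G \<phi> v \<or> y \<in> orbit G \<phi> v")
      case True
      then show ?thesis using at_orbit[OF xy] at_orbit'[OF xy] by auto
    next
      case False
      then show ?thesis using lipD[OF f(2) xy] f'_other by simp
    qed
  qed
  have sub: "tension \<mu> f' \<subseteq> tension \<mu> f"
  proof
    fix e assume e: "e \<in> tension \<mu> f'"
    obtain x y where xy: "e = (x, y)" by fastforce
    have arc: "(x, y) \<in> A" "d' (f' x) (f' y) = \<mu> * d x y" using e xy by (simp_all add: tension_iff)
    have "x \<notin> orbit G \<phi> v" "y \<notin> orbit G \<phi> v" using at_orbit[OF arc(1)] at_orbit'[OF arc(1)] arc(2) by auto
    then show "e \<in> tension \<mu> f" using arc f'_other xy by (simp add: tension_iff)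
  qed
  \<comment> \<open>All arcs meeting the orbit of \<open>v\<close> are now strictly below maximal
    stretch. This makes the inclusion of tension orbits proper.\<close>
  have "arc_orbit G \<phi> (v, u) \<notin> tension_orbits \<mu> f'"
  proof
    assume "arc_orbit G \<phi> (v, u) \<in> tension_orbits \<mu> f'"
    then obtain x y where xy: "(x, y) \<in> tension \<mu> f'" "arc_orbit G \<phi> (v, u) = arc_orbit G \<phi> (x, y)"
      unfolding tension_orbits_def by auto
    have arc: "(x, y) \<in> A" "d' (f' x) (f' y) = \<mu> * d x y" using xy by (simp_all add: tension_iff)
    have "(x, y) \<in> arc_orbit G \<phi> (x, y)"
      unfolding arc_orbit_def
      by (rule image_eqI[of _ _ \<one>]) (use src.act_one src.branch_arcsD(4,5)[OF arc(1)] in simp_all)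
    then have "(x, y) \<in> arc_orbit G \<phi> (v, u)" using xy(2) by simp
    then have "x \<in> orbit G \<phi> v" by (auto simp: arc_orbit_def orbit_def)
    then show False using at_orbit[OF arc(1)] arc(2) by simp
  qed
  moreover have "arc_orbit G \<phi> (v, u) \<in> tension_orbits \<mu> f" using vu by (auto simp: tension_orbits_def)
  moreover have "tension_orbits \<mu> f' \<subseteq> tension_orbits \<mu> f" using sub by (auto simp: tension_orbits_def)
  ultimately show ?thesis using eq' lip' by blast
qed

text \<open>Minimality is used twice: of the stretch, for the existence of stretched arcs, and of
  the number of their orbits, which lets \<open>relax\<close> exclude a vertex they leave in one
  direction only.\<close>

theorem ex_tight_map:
  obtains f \<mu> where "equivariant f" "0 \<le> \<mu>" "lip \<mu> f" "\<mu> > 0 \<Longrightarrow> tension \<mu> f \<noteq> {}"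
    "\<And>u v. (u, v) \<in> tension \<mu> f \<Longrightarrow> \<exists>w. (v, w) \<in> tension \<mu> f \<and> tgt.btw (f u) (f v) (f w)"
proof -
  obtain f0 \<mu> where f0: "equivariant f0" "0 \<le> \<mu>" "lip \<mu> f0"
    and min: "\<And>g L. \<lbrakk>equivariant g; 0 \<le> L; lip L g\<rbrakk> \<Longrightarrow> \<mu> \<le> L"
    using ex_minimal_lip by blast
  obtain f where f: "equivariant f" "lip \<mu> f"
    and least: "\<And>g. equivariant g \<Longrightarrow> lip \<mu> g \<Longrightarrow> card (tension_orbits \<mu> f) \<le> card (tension_orbits \<mu> g)"
    using ex_has_least_nat[of "\<lambda>f. equivariant f \<and> lip \<mu> f" f0 "\<lambda>f. card (tension_orbits \<mu> f)"] f0 by blast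
  have cont: "\<exists>w. (v, w) \<in> tension \<mu> f \<and> tgt.btw (f u) (f v) (f w)" if uv: "(u, v) \<in> tension \<mu> f" for u v
  proof (rule ccontr)
    assume "\<not> ?thesis"
    then have "\<And>w. (v, w) \<in> tension \<mu> f \<Longrightarrow> \<not> tgt.btw (f u) (f v) (f w)" by blast
    from relax[OF f uv this] obtain f' where f': "equivariant f'" "lip \<mu> f'"
      "tension_orbits \<mu> f' \<subset> tension_orbits \<mu> f" by blast
    have "card (tension_orbits \<mu> f') < card (tension_orbits \<mu> f)"
      by (rule psubset_card_mono[OF finite_tension_orbits f'(3)])
    then show False using least[OF f'(1,2)] by simp
  qed
  have ne: "tension \<mu> f \<noteq> {}" if pos: "\<mu> > 0"
  proof
    assume empty: "tension \<mu> f = {}"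
    \<comment> \<open>The relative slacks of the finitely many representatives are all positive, so
      the stretch could be lowered by \<open>t\<close>. Including \<open>\<mu>\<close> itself keeps
      \<open>\<mu> - t\<close> nonnegative.\<close>
    define S where "S = insert \<mu> ((\<lambda>(v, w). (\<mu> * d v w - d' (f v) (f w)) / d v w) ` arc_reps)"
    have reps: "(v, w) \<in> A" "d v w > 0" if "(v, w) \<in> arc_reps" for v w
      using that src.branch_arcsD(7)[of v w] by (auto simp: arc_reps_def)
    have "0 < x" if x: "x \<in> S" for x
    proof (cases "x = \<mu>")
      case False
      then obtain v w where vw: "(v, w) \<in> arc_reps" "x = (\<mu> * d v w - d' (f v) (f w)) / d v w"
        using x by (auto simp: S_def)
      have "d' (f v) (f w) \<noteq> \<mu> * d v w" using empty reps(1)[OF vw(1)] by (auto simp: tension_def)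
      then have "d' (f v) (f w) < \<mu> * d v w" using lipD[OF f(2) reps(1)[OF vw(1)]] by simp
      then show ?thesis using vw reps(2) by simp
    qed (use pos in simp)
    moreover have "finite S" unfolding S_def using finite_arc_reps by simp
    ultimately obtain t where t: "0 < t" "\<And>x. x \<in> S \<Longrightarrow> t < x" using positive_below_finite by metis
    have "lip (\<mu> - t) f"
    proof (rule lip_repsI[OF f(1)])
      fix v w assume vw: "(v, w) \<in> arc_reps"
      then have "(\<mu> * d v w - d' (f v) (f w)) / d v w \<in> S" by (force simp: S_def)
      then have "t < (\<mu> * d v w - d' (f v) (f w)) / d v w" by (rule t(2))
      then show "d' (f v) (f w) \<le> (\<mu> - t) * d v w"
        using reps(2)[OF vw] by (simp add: pos_less_divide_eq algebra_simps)
    qed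
    moreover have "0 \<le> \<mu> - t" using t(2)[of \<mu>] by (simp add: S_def)
    ultimately show False using min[OF f(1)] t(1) by fastforce
  qed
  show thesis using that[OF f(1) f0(2) f(2) ne cont] .
qed

end

section \<open>Lifting closed paths\<close>

context tree_action
begin

text \<open>The sequence is a geodesic by \<open>chain_additive\<close>. Its first two periods show
  that \<open>x 0\<close> lies on the axis of \<open>g\<close>, and one period is the translation
  length.\<close>

lemma tl_length_periodic:
  assumes g: "g \<in> carrier G" and n: "n > 0" and x: "\<And>i. x (i + n) = \<phi> g (x i)"
    and btw: "\<And>i. btw (x i) (x (Suc i)) (x (Suc (Suc i)))" and ne: "\<And>i. x i \<noteq> x (Suc i)"
  shows "tl_length g = (\<Sum>i<n. d (x i) (x (Suc i)))" "0 < (\<Sum>i<n. d (x i) (x (Suc i)))"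
proof -
  let ?S = "\<Sum>i<n. d (x i) (x (Suc i))"
  have x_in: "x i \<in> M" for i using btw_in(1)[OF btw[of i]] .
  have pos: "0 < d (x i) (x (Suc i))" for i using x_in ne[of i] by simp
  show S_pos: "0 < ?S" using n pos by (intro sum_pos) auto
  have sums: "d (x 0) (x k) = (\<Sum>i<k. d (x i) (x (Suc i)))" for k
    by (rule chain_additive) (rule btw ne)+
  have x1: "x n = \<phi> g (x 0)" and x2: "x (n + n) = \<phi> g (\<phi> g (x 0))" using x[of 0] x[of n] by simp_all
  have "d (x n) (x (n + n)) = ?S" using act_dist[OF g x_in x_in, of 0 n] sums[of n] x1 x2 by simp
  moreover have "(\<Sum>i<n + n. d (x i) (x (Suc i))) = ?S + ?S"
  proof -
    have "(\<Sum>i<n + n. d (x i) (x (Suc i))) = ?S + (\<Sum>i<n. d (x (i + n)) (x (Suc i + n)))"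
      by (simp add: sum.nat_group[symmetric] lessThan_atLeast0 sum.atLeastLessThan_concat[of 0 n "n + n", symmetric]
          sum.shift_bounds_nat_ivl[of _ 0 n n, simplified])
    also have "(\<Sum>i<n. d (x (i + n)) (x (Suc i + n))) = ?S"
      by (rule sum.cong) (simp_all only: x act_dist[OF g x_in x_in])
    finally show ?thesis .
  qed
  ultimately have "btw (x 0) (x n) (x (n + n))"
    using sums[of n] sums[of "n + n"] x_in by (simp add: btw_def)
  moreover have "\<phi> g (x 0) \<noteq> x 0" using S_pos sums[of n] x1 x_in[of 0] by auto
  ultimately show "tl_length g = ?S"
    using tl_length_axis[OF g x_in[of 0]] sums[of n] unfolding x1 x2 by simp
qed

end

context action_pair
begin

definition Q where
  "Q = \<lparr>verts = orbit G \<phi> ` V, arcs = arc_orbit G \<phi> ` A, tail = (\<lambda>a. fst ` a), head = (\<lambda>a. snd ` a)\<rparr>"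

lemma Q_sel [simp]: "verts Q = orbit G \<phi> ` V" "arcs Q = arc_orbit G \<phi> ` A"
  "tail Q a = fst ` a" "head Q a = snd ` a"
  by (simp_all add: Q_def)

lemma arc_orbit_ends: "fst ` arc_orbit G \<phi> (v, w) = orbit G \<phi> v" "snd ` arc_orbit G \<phi> (v, w) = orbit G \<phi> w"
  by (force simp: arc_orbit_def orbit_def)+

lemma arc_orbit_converse: "(arc_orbit G \<phi> (v, w))\<inverse> = arc_orbit G \<phi> (w, v)"
  by (auto simp: arc_orbit_def)

lemma arc_orbit_memI: "(v, w) \<in> A \<Longrightarrow> (v, w) \<in> arc_orbit G \<phi> (v, w)"
  unfolding arc_orbit_def
  by (rule image_eqI[of _ _ \<one>]) (use src.act_one src.branch_arcsD(4,5)[of v w] in simp_all)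

lemma arcs_QE:
  assumes "a \<in> arcs Q"
  obtains v w where "(v, w) \<in> A" "a = arc_orbit G \<phi> (v, w)"
  using assms by auto

lemma mem_arc_Q:
  assumes "a \<in> arcs Q" "(v, w) \<in> a"
  shows "(v, w) \<in> A" "a = arc_orbit G \<phi> (v, w)"
proof -
  obtain x y where xy: "(x, y) \<in> A" "a = arc_orbit G \<phi> (x, y)" by (rule arcs_QE[OF assms(1)])
  then obtain g where g: "g \<in> carrier G" "v = \<phi> g x" "w = \<phi> g y"
    using assms(2) by (auto simp: arc_orbit_def)
  show "(v, w) \<in> A" using src.act_branch_arc[OF xy(1) g(1)] g by simp
  show "a = arc_orbit G \<phi> (v, w)"
    using arc_orbit_act[of x y g] src.branch_arcsD(4,5)[OF xy(1)] g xy(2) by simp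
qed

text \<open>Unique lifting of an arc at a given starting vertex; two lifts differ by an element
  fixing that vertex, which is trivial by freeness.\<close>

lemma mem_arc_Q_unique:
  assumes "a \<in> arcs Q" "(v, w) \<in> a" "(v, w') \<in> a"
  shows "w = w'"
proof -
  note A = src.branch_arcsD[OF mem_arc_Q(1)[OF assms(1,2)]]
  obtain g where g: "g \<in> carrier G" "v = \<phi> g v" "w' = \<phi> g w"
    using assms(3) mem_arc_Q(2)[OF assms(1,2)] by (auto simp: arc_orbit_def)
  then have "g = \<one>" using src.act_free A by metis
  then show ?thesis using g(3) src.act_one A by simp
qed

lemma arc_Q_act:
  assumes "a \<in> arcs Q" "(v, w) \<in> a" "g \<in> carrier G"
  shows "(\<phi> g v, \<phi> g w) \<in> a"
  using mem_arc_Q(2)[OF assms(1,2)] assms(3) by (auto simp: arc_orbit_def)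

sublocale Q: curve_graph Q
proof
  fix a assume a: "a \<in> arcs Q"
  obtain v w where vw: "(v, w) \<in> A" "a = arc_orbit G \<phi> (v, w)" by (rule arcs_QE[OF a])
  note A = src.branch_arcsD[OF vw(1)]
  show "tail Q a \<in> verts Q" "head Q a \<in> verts Q" using vw A by (auto simp: arc_orbit_ends)
  show "a\<inverse> \<in> arcs Q" using vw src.branch_arcs_sym by (auto simp: arc_orbit_converse)
  show "tail Q (a\<inverse>) = head Q a" unfolding vw(2) arc_orbit_converse Q_sel arc_orbit_ends ..
next
  show "finite (verts Q)" using src.finite_branch_orbits by simp
qed

lemma orbit_memE:
  assumes "x \<in> orbit G \<phi> v"
  obtains g where "g \<in> carrier G" "x = \<phi> g v"
  using assms by (auto simp: orbit_def)

text \<open>Lift the closed path repeated forever. After one round the lift is back in the orbit of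
  its start, which provides \<open>g\<close>; unique lifting then makes the whole lift periodic
  under \<open>g\<close>.\<close>

lemma periodic_lift:
  assumes p: "p \<noteq> []" "set p \<subseteq> arcs Q"
    and cyc: "\<And>i. head Q (p ! (i mod length p)) = tail Q (p ! (Suc i mod length p))"
  obtains x g where "g \<in> carrier G" "\<And>i. (x i, x (Suc i)) \<in> p ! (i mod length p)"
    "\<And>i. x (i + length p) = \<phi> g (x i)" "represented_by \<phi> g p"
proof -
  let ?n = "length p"
  have n: "?n > 0" using p by simp
  have pa: "p ! (i mod ?n) \<in> arcs Q" for i using p n by (auto simp: subset_iff)
  obtain v0 w0 where vw0: "(v0, w0) \<in> A" "p ! 0 = arc_orbit G \<phi> (v0, w0)"
    using arcs_QE[OF pa[of 0]] n by (metis mod_less)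
  define x where "x = rec_nat v0 (\<lambda>i v. SOME w. (v, w) \<in> p ! (i mod ?n))"
  have x0: "x 0 = v0" and xS: "x (Suc i) = (SOME w. (x i, w) \<in> p ! (i mod ?n))" for i
    by (simp_all add: x_def)
  have ex: "\<exists>w. (v, w) \<in> a" if "v \<in> tail Q a" for v and a :: "('a \<times> 'a) set" using that by auto
  have x_tail: "x i \<in> tail Q (p ! (i mod ?n)) \<and> (x i, x (Suc i)) \<in> p ! (i mod ?n)" for i
  proof (induction i)
    case 0
    have "x 0 \<in> tail Q (p ! (0 mod ?n))"
      using arc_orbit_memI[OF vw0(1)] vw0(2) x0 n by force
    then show ?case using someI_ex[OF ex] xS[of 0] by metis
  next
    case (Suc i)
    then have "x (Suc i) \<in> head Q (p ! (i mod ?n))" by force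
    then have "x (Suc i) \<in> tail Q (p ! (Suc i mod ?n))" using cyc by blast
    then show ?case using someI_ex[OF ex] xS[of "Suc i"] by metis
  qed
  then have step: "(x i, x (Suc i)) \<in> p ! (i mod ?n)" for i by blast
  have "x ?n \<in> tail Q (p ! (?n mod ?n))" using x_tail by blast
  then have "x ?n \<in> orbit G \<phi> v0" using vw0(2) by (simp add: arc_orbit_ends)
  then obtain g where g: "g \<in> carrier G" "x ?n = \<phi> g v0" by (rule orbit_memE)
  have per: "x (i + ?n) = \<phi> g (x i)" for i
  proof (induction i)
    case 0
    show ?case using g x0 by simp
  next
    case (Suc i)
    have "(\<phi> g (x i), x (Suc i + ?n)) \<in> p ! (i mod ?n)" using step[of "i + ?n"] Suc by simp
    moreover have "(\<phi> g (x i), \<phi> g (x (Suc i))) \<in> p ! (i mod ?n)"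
      by (rule arc_Q_act[OF pa step g(1)])
    ultimately show ?case by (rule mem_arc_Q_unique[OF pa])
  qed
  have "represented_by \<phi> g p"
    unfolding represented_by_def
  proof (intro exI[of _ "map x [0..<Suc ?n]"] conjI)
    show "lift_of_path p (map x [0..<Suc ?n])"
      unfolding lift_of_path_def
    proof (intro conjI allI impI)
      show "length (map x [0..<Suc ?n]) = Suc ?n" by simp
      fix i assume "i < ?n"
      then show "(map x [0..<Suc ?n] ! i, map x [0..<Suc ?n] ! Suc i) \<in> p ! i"
        using step[of i] by (simp del: upt_Suc)
    qed
    have "last (map x [0..<Suc ?n]) = x ?n" by simp
    moreover have "hd (map x [0..<Suc ?n]) = x 0" by (simp add: upt_rec)
    ultimately show "last (map x [0..<Suc ?n]) = \<phi> g (hd (map x [0..<Suc ?n]))"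
      using g(2) x0 by simp
  qed
  with g(1) step per show thesis by (rule that)
qed

end

lemma (in gated_graph) legal_cycle_nth:
  assumes "legal_cycle p"
  shows "legal (p ! (i mod length p)) (p ! (Suc i mod length p))"
proof -
  have p: "p \<noteq> []" "successively legal p" "legal (last p) (hd p)"
    using assms by (auto simp: legal_cycle_def legal_path_def)
  show ?thesis
  proof (cases "Suc (i mod length p) = length p")
    case True
    then have "i mod length p = length p - 1" "Suc i mod length p = 0" by (simp_all add: mod_Suc)
    then show ?thesis using p by (simp add: last_conv_nth hd_conv_nth)
  next
    case False
    then have "Suc i mod length p = Suc (i mod length p)" by (simp add: mod_Suc)
    moreover have "Suc (i mod length p) < length p" using False p(1) by (simp add: Suc_lessI)
    ultimately show ?thesis using p(2) by (simp add: successively_conv_nth)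
  qed
qed

lemma follows_nth:
  assumes "follows p a b"
  obtains j where "j < length p" "p ! j = a" "p ! (Suc j mod length p) = b"
proof -
  from assms consider (inner) u v where "p = u @ [a, b] @ v" | (wrap) "p \<noteq> []" "last p = a" "hd p = b"
    unfolding follows_def by blast
  then show thesis
  proof cases
    case inner
    then show thesis by (intro that[of "length u"]) (simp_all add: nth_append)
  next
    case wrap
    then show thesis
      by (intro that[of "length p - 1"]) (simp_all add: last_conv_nth hd_conv_nth)
  qed
qed

section \<open>Rigidity\<close>

locale equal_lengths = action_pair +
  assumes lengths: "\<And>g p. \<lbrakk>g \<in> carrier G; almost_simple_curve Q p; represented_by \<phi> g p\<rbrakk> \<Longrightarrow>
      src.tl_length g = tgt.tl_length g"
begin

text \<open>Let \<open>?S\<close> be the length of one period of the lift of a legal almost simple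
  curve. Legality makes the image of the lift an axis, so the translation length of \<open>g\<close>
  is \<open>\<mu> * ?S\<close> in the target, while in the source it is at most
  \<open>?S\<close>.\<close>

lemma ex_short_map: "\<exists>f. equivariant f \<and> lip 1 f"
proof -
  obtain f \<mu> where f: "equivariant f" "0 \<le> \<mu>" "lip \<mu> f" "\<mu> > 0 \<Longrightarrow> tension \<mu> f \<noteq> {}"
    and cont: "\<And>u v. (u, v) \<in> tension \<mu> f \<Longrightarrow> \<exists>w. (v, w) \<in> tension \<mu> f \<and> tgt.btw (f u) (f v) (f w)"
    using ex_tight_map by metis
  have "\<mu> \<le> 1"
  proof (cases "\<mu> > 0")
    case pos: True
    let ?D = "tension_orbits \<mu> f"
    \<comment> \<open>Two stretched arcs share a gate if the images of lifts starting at a common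
      vertex leave in a common direction. By freeness and equivariance the choice of that vertex
      does not matter.\<close>
    define gate where "gate a b \<longleftrightarrow> (\<exists>v u w. (v, u) \<in> a \<and> (v, w) \<in> b \<and> \<not> tgt.btw (f u) (f v) (f w))"
      for a b :: "('a \<times> 'a) set"
    have D_arcs: "a \<in> arcs Q" if "a \<in> ?D" for a
      using that by (auto simp: tension_orbits_def tension_def)
    have D_mem: "(v, w) \<in> tension \<mu> f" if a: "a \<in> ?D" and vw: "(v, w) \<in> a" for a v w
    proof -
      obtain x y where xy: "(x, y) \<in> tension \<mu> f" "a = arc_orbit G \<phi> (x, y)"
        using a by (auto simp: tension_orbits_def)
      then obtain g where "g \<in> carrier G" "v = \<phi> g x" "w = \<phi> g y" using vw by (auto simp: arc_orbit_def)
      then show ?thesis using tension_act[OF f(1) xy(1)] by simp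
    qed
    have ex_mem: "\<exists>v w. (v, w) \<in> a" if "a \<in> arcs Q" for a
      using arcs_QE[OF that] arc_orbit_memI by metis
    have in_V: "v \<in> V" "w \<in> V" if "(v, w) \<in> tension \<mu> f" for v w
      using that src.branch_arcsD(1,2) by (auto simp: tension_def)
    interpret gated_graph Q ?D gate
    proof
      show "?D \<subseteq> arcs Q" using D_arcs by blast
      fix a assume a: "a \<in> ?D"
      show "a\<inverse> \<in> ?D"
        using a tension_sym unfolding tension_orbits_def by (auto simp: arc_orbit_converse)
      obtain v w where vw: "(v, w) \<in> a" using ex_mem[OF D_arcs[OF a]] by blast
      have ten: "(v, w) \<in> tension \<mu> f" by (rule D_mem[OF a vw])
      have "\<not> tgt.btw (f w) (f v) (f w)"
      proof
        assume "tgt.btw (f w) (f v) (f w)"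
        then have "f v = f w" by (rule tgt.btw_same_ends)
        then have "\<mu> * d v w = 0" using ten equivariantD(1)[OF f(1) in_V(2)[OF ten]] by (simp add: tension_def)
        then show False using pos ten src.branch_arcsD(7)[of v w] by (auto simp: tension_def)
      qed
      then show "gate a a" unfolding gate_def using vw by blast
      show "\<exists>b\<in>?D. tail Q b = head Q a \<and> \<not> gate (a\<inverse>) b"
      proof -
        obtain z where z: "(w, z) \<in> tension \<mu> f" "tgt.btw (f v) (f w) (f z)" using cont[OF ten] by blast
        let ?b = "arc_orbit G \<phi> (w, z)"
        have b: "?b \<in> ?D" using z(1) by (auto simp: tension_orbits_def)
        have wz: "(w, z) \<in> ?b" using z(1) by (intro arc_orbit_memI) (simp add: tension_def)
        have a_eq: "a = arc_orbit G \<phi> (v, w)" by (rule mem_arc_Q(2)[OF D_arcs[OF a] vw])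
        have "tail Q ?b = head Q a" unfolding a_eq Q_sel arc_orbit_ends ..
        moreover have "\<not> gate (a\<inverse>) ?b"
        proof
          assume "gate (a\<inverse>) ?b"
          then obtain w' v' z' where g: "(v', w') \<in> a" "(w', z') \<in> ?b" "\<not> tgt.btw (f v') (f w') (f z')"
            by (auto simp: gate_def)
          obtain h where h: "h \<in> carrier G" "w' = \<phi> h w" "z' = \<phi> h z"
            using g(2) by (auto simp: arc_orbit_def)
          \<comment> \<open>Unique lifting shows that the supposed illegal turn is the translate by
            \<open>h\<close> of the legal one at \<open>w\<close>.\<close>
          have "(w', v') \<in> a\<inverse>" "(w', \<phi> h v) \<in> a\<inverse>"
            using g(1) arc_Q_act[OF D_arcs[OF a] vw h(1)] h(2) by auto
          then have "v' = \<phi> h v" using mem_arc_Q_unique Q.conv_in[OF D_arcs[OF a]] by blast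
          then have "tgt.btw (f v') (f w') (f z')"
            using tgt.act_btw[OF z(2) h(1)] h equivariantD(2)[OF f(1) h(1)] in_V[OF ten] in_V[OF z(1)] by simp
          with g(3) show False by blast
        qed
        ultimately show ?thesis using b by blast
      qed
    next
      fix a b assume a: "a \<in> ?D" and b: "b \<in> ?D" and ab: "gate a b"
      then obtain v u w where *: "(v, u) \<in> a" "(v, w) \<in> b" "\<not> tgt.btw (f u) (f v) (f w)"
        by (auto simp: gate_def)
      have "\<not> tgt.btw (f w) (f v) (f u)" using *(3) tgt.btw_sym[of "f w" "f v" "f u"] by blast
      then show "gate b a" unfolding gate_def using *(1,2) by blast
    next
      fix a b c assume a: "a \<in> ?D" and b: "b \<in> ?D" and c: "c \<in> ?D" and ab: "gate a b" and bc: "gate b c"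
      obtain v u w where 1: "(v, u) \<in> a" "(v, w) \<in> b" "\<not> tgt.btw (f u) (f v) (f w)"
        using ab by (auto simp: gate_def)
      obtain v' u' w' where 2: "(v', u') \<in> b" "(v', w') \<in> c" "\<not> tgt.btw (f u') (f v') (f w')"
        using bc by (auto simp: gate_def)
      have b_eq: "b = arc_orbit G \<phi> (v', u')" by (rule mem_arc_Q(2)[OF D_arcs[OF b] 2(1)])
      \<comment> \<open>The second comparison is moved by \<open>g\<close> to the vertex of the
        first, so that \<open>not_btw_trans\<close> can combine them.\<close>
      obtain g where g: "g \<in> carrier G" "v = \<phi> g v'" "w = \<phi> g u'"
        using 1(2) unfolding b_eq by (auto simp: arc_orbit_def)
      have vw': "(v, \<phi> g w') \<in> c" using arc_Q_act[OF D_arcs[OF c] 2(2) g(1)] g(2) by simp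
      note ten1 = D_mem[OF b 2(1)] and ten2 = D_mem[OF c 2(2)]
      have "\<not> tgt.btw (f w) (f v) (f (\<phi> g w'))"
        using 2(3) tgt.act_btw_iff[OF equivariantD(1)[OF f(1) in_V(2)[OF ten1]]
            equivariantD(1)[OF f(1) in_V(1)[OF ten1]] equivariantD(1)[OF f(1) in_V(2)[OF ten2]] g(1)]
          equivariantD(2)[OF f(1) g(1)] in_V[OF ten1] in_V[OF ten2] g(2,3) by simp
      moreover have "f w \<in> M'" using D_mem[OF b 1(2)] in_V equivariantD(1)[OF f(1)] by blast
      ultimately have "\<not> tgt.btw (f u) (f v) (f (\<phi> g w'))" using tgt.not_btw_trans[OF 1(3)] by blast
      then show "gate a c" unfolding gate_def using 1(1) vw' by blast
    qed
    have "?D \<noteq> {}" using f(4)[OF pos] by (auto simp: tension_orbits_def)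
    then obtain p where p: "almost_simple_curve Q p" "legal_cycle p" using ex_legal_cycle by blast
    note legal = legal_cycle_nth[OF p(2)]
    have pD: "p \<noteq> []" "set p \<subseteq> ?D" using p(2) by (auto simp: legal_cycle_def legal_path_def)
    have p_arcs: "set p \<subseteq> arcs Q" using pD(2) D_arcs by blast
    obtain x g where x: "g \<in> carrier G" "\<And>i. (x i, x (Suc i)) \<in> p ! (i mod length p)"
      "\<And>i. x (i + length p) = \<phi> g (x i)" "represented_by \<phi> g p"
      using periodic_lift[OF pD(1) p_arcs] legal unfolding legal_def by metis
    have ten: "(x i, x (Suc i)) \<in> tension \<mu> f" for i
    proof (rule D_mem[OF _ x(2)])
      show "p ! (i mod length p) \<in> ?D" using pD by (auto simp: subset_iff)
    qed
    have arc: "(x i, x (Suc i)) \<in> A" "d' (f (x i)) (f (x (Suc i))) = \<mu> * d (x i) (x (Suc i))" for i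
      using ten[of i] by (auto simp: tension_def)
    have n: "length p > 0" using pD by simp
    have btw': "tgt.btw (f (x i)) (f (x (Suc i))) (f (x (Suc (Suc i))))" for i
    proof (rule ccontr)
      assume "\<not> ?thesis"
      moreover have "(x (Suc i), x i) \<in> (p ! (i mod length p))\<inverse>" using x(2)[of i] by simp
      ultimately have "gate ((p ! (i mod length p))\<inverse>) (p ! (Suc i mod length p))"
        unfolding gate_def using x(2)[of "Suc i"] by blast
      then show False using legal[of i] by (simp add: legal_def)
    qed
    have ne: "f (x i) \<noteq> f (x (Suc i))" for i
    proof
      assume "f (x i) = f (x (Suc i))"
      then have "\<mu> * d (x i) (x (Suc i)) = 0"
        using arc(2)[of i] equivariantD(1)[OF f(1) in_V(2)[OF ten[of i]]] by simp
      then show False using pos src.branch_arcsD(7)[OF arc(1)[of i]] by simp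
    qed
    let ?S = "\<Sum>i<length p. d (x i) (x (Suc i))"
    have "tgt.tl_length g = (\<Sum>i<length p. d' (f (x i)) (f (x (Suc i))))"
    proof (rule tgt.tl_length_periodic(1)[where x = "\<lambda>i. f (x i)", OF x(1) n])
      show "f (x (i + length p)) = \<phi>' g (f (x i))" for i
        using x(3) equivariantD(2)[OF f(1) x(1)] in_V(1)[OF ten] by simp
    qed (rule btw' ne)+
    then have 1: "tgt.tl_length g = \<mu> * ?S" by (simp add: arc(2) sum_distrib_left)
    have x_in: "x i \<in> M" for i using src.branch_arcsD(4)[OF arc(1)[of i]] .
    have "src.tl_length g \<le> d (x 0) (x (0 + length p))"
      using src.tl_length_le[OF x_in[of 0], of g] x(3)[of 0] by simp
    also have "\<dots> \<le> ?S" using src.dist_chain_le[of x 0 "length p", OF x_in] by simp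
    finally have "\<mu> * ?S \<le> ?S" using lengths[OF x(1) p(1) x(4)] 1 by simp
    moreover have "0 < ?S" using n src.branch_arcsD(7)[OF arc(1)] by (intro sum_pos) auto
    ultimately show ?thesis by simp
  qed simp
  have "lip 1 f"
  proof (rule lip_repsI[OF f(1)])
    fix v w assume "(v, w) \<in> arc_reps"
    then have "d' (f v) (f w) \<le> \<mu> * d v w" using lipD[OF f(3)] by (auto simp: arc_reps_def)
    also have "\<dots> \<le> 1 * d v w" using \<open>\<mu> \<le> 1\<close> by (rule mult_right_mono) simp
    finally show "d' (f v) (f w) \<le> 1 * d v w" .
  qed
  then show ?thesis using f(1) by blast
qed

text \<open>Along an almost simple curve the chain of inequalities between its lengths in the two trees
  collapses to equalities.\<close>

lemma short_map_turn:
  assumes f: "equivariant f" "lip 1 f" and vu: "(v, u) \<in> A" and vw: "(v, w) \<in> A" and ne: "u \<noteq> w"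
  shows "tgt.btw (f u) (f v) (f w)" "d' (f v) (f u) = d v u"
proof -
  let ?a = "arc_orbit G \<phi> (v, u)" and ?b = "arc_orbit G \<phi> (v, w)"
  have ab: "?a \<in> arcs Q" "?b \<in> arcs Q" using vu vw by auto
  have "?a \<noteq> ?b"
  proof
    assume "?a = ?b"
    then have "(v, u) \<in> ?a" "(v, w) \<in> ?a" using arc_orbit_memI vu vw by auto
    then show False using mem_arc_Q_unique[OF ab(1)] ne by blast
  qed
  moreover have "tail Q ?a = tail Q ?b" by (simp add: arc_orbit_ends)
  moreover have cont: "\<exists>b \<in> arcs Q. tail Q b = head Q a \<and> b \<noteq> a\<inverse>" if a: "a \<in> arcs Q" for a
  proof -
    obtain x y where xy: "(x, y) \<in> A" "a = arc_orbit G \<phi> (x, y)" by (rule arcs_QE[OF a])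
    obtain z where z: "(y, z) \<in> A" "z \<noteq> x" using src.arc_continue[OF xy(1)] by metis
    let ?c = "arc_orbit G \<phi> (y, z)"
    have "?c \<noteq> a\<inverse>"
    proof
      assume eq: "?c = a\<inverse>"
      have "(y, z) \<in> ?c" "(y, x) \<in> ?c"
        using arc_orbit_memI[OF z(1)] arc_orbit_memI[OF xy(1)] xy(2) eq by auto
      then show False using mem_arc_Q_unique[of ?c y z x] z by auto
    qed
    moreover have "tail Q ?c = head Q a" by (simp add: xy(2) arc_orbit_ends)
    moreover have "?c \<in> arcs Q" using z(1) by auto
    ultimately show ?thesis by blast
  qed
  ultimately obtain p where p: "almost_simple_curve Q p" "gated_graph.legal_cycle Q (arcs Q) (=) p"
    "follows p (?a\<inverse>) ?b \<or> follows p (?b\<inverse>) ?a"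
    using Q.ex_curve_through_turn[OF cont ab] by blast
  interpret gated_graph Q "arcs Q" "(=)"
  proof
    show "\<exists>b\<in>arcs Q. tail Q b = head Q a \<and> a\<inverse> \<noteq> b" if "a \<in> arcs Q" for a
      using cont[OF that] by blast
  qed (auto simp: Q.conv_in simp del: Q_sel)
  note legal = legal_cycle_nth[OF p(2)]
  let ?n = "length p"
  have p_ne: "p \<noteq> []" "set p \<subseteq> arcs Q"
    using p(2) unfolding legal_cycle_def legal_path_def by (auto simp del: Q_sel)
  have pa: "p ! (i mod ?n) \<in> arcs Q" for i
  proof -
    have "i mod ?n < ?n" using p_ne by simp
    then show ?thesis using p_ne(2) nth_mem by blast
  qed
  obtain x g where x: "g \<in> carrier G" "\<And>i. (x i, x (Suc i)) \<in> p ! (i mod ?n)"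
    "\<And>i. x (i + ?n) = \<phi> g (x i)" "represented_by \<phi> g p"
    using periodic_lift[OF p_ne] legal unfolding legal_def by metis
  have arc: "(x i, x (Suc i)) \<in> A" for i by (rule mem_arc_Q(1)[OF pa x(2)])
  have xV: "x i \<in> V" "x i \<in> M" for i using src.branch_arcsD[OF arc[of i]] by auto
  have fx: "f (x i) \<in> M'" for i using equivariantD(1)[OF f(1)] xV by blast
  have fper: "f (x (i + ?n)) = \<phi>' g (f (x i))" for i using x(3) equivariantD(2)[OF f(1) x(1)] xV by simp
  have n: "?n > 0" using p_ne by simp
  have btw: "src.btw (x i) (x (Suc i)) (x (Suc (Suc i)))" for i
  proof (rule src.arc_turn[OF src.branch_arcs_sym[OF arc] arc])
    show "x i \<noteq> x (Suc (Suc i))"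
    proof
      assume eq: "x i = x (Suc (Suc i))"
      have "(x (Suc i), x i) \<in> (p ! (i mod ?n))\<inverse>" using x(2)[of i] by simp
      then have "(p ! (i mod ?n))\<inverse> = arc_orbit G \<phi> (x (Suc i), x i)"
        by (rule mem_arc_Q(2)[OF Q.conv_in[OF pa]])
      moreover have "p ! (Suc i mod ?n) = arc_orbit G \<phi> (x (Suc i), x i)"
        using mem_arc_Q(2)[OF pa x(2)[of "Suc i"]] eq by simp
      ultimately show False using legal[of i] by (simp add: legal_def del: Q_sel)
    qed
  qed
  have ne_x: "x i \<noteq> x (Suc i)" for i using src.branch_arcsD(3)[OF arc] .
  \<comment> \<open>A period may start at any index. This makes the equalities below available at
    every vertex of the lift.\<close>
  have len: "tgt.tl_length g = (\<Sum>i<?n. d (x (k + i)) (x (Suc (k + i))))" for k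
  proof -
    have "src.tl_length g = (\<Sum>i<?n. d (x (k + i)) (x (k + Suc i)))"
      by (rule src.tl_length_periodic(1)[OF x(1) n])
        (use x(3)[of "k + i" for i] btw ne_x in \<open>simp_all add: add.assoc\<close>)
    then show ?thesis using lengths[OF x(1) p(1) x(4)] by simp
  qed
  let ?S = "\<lambda>k m. \<Sum>i<m. d' (f (x (k + i))) (f (x (Suc (k + i))))"
  have arc_le: "d' (f (x i)) (f (x (Suc i))) \<le> d (x i) (x (Suc i))" for i
    using lipD[OF f(2) arc] by simp
  have disp: "tgt.tl_length g \<le> d' (f (x k)) (f (x (k + ?n)))" for k
    using tgt.tl_length_le[OF fx] fper by simp
  have chain: "d' (f (x k)) (f (x (k + m))) \<le> ?S k m" for k m
    by (rule tgt.dist_chain_le[of "\<lambda>i. f (x i)", OF fx])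
  have S_le: "?S k ?n \<le> tgt.tl_length g" for k unfolding len[of k] by (rule sum_mono) (rule arc_le)
  \<comment> \<open>The translation length is at most the displacement of \<open>f (x k)\<close>,
    this at most the length of the image of a period, and this again at most the translation
    length.\<close>
  have S_eq: "?S k ?n = tgt.tl_length g" "d' (f (x k)) (f (x (k + ?n))) = ?S k ?n" for k
    using S_le[of k] disp[of k] chain[of k ?n] by linarith+
  have arc_eq: "d' (f (x k)) (f (x (Suc k))) = d (x k) (x (Suc k))" for k
  proof (rule antisym[OF arc_le], rule ccontr)
    assume "\<not> d (x k) (x (Suc k)) \<le> d' (f (x k)) (f (x (Suc k)))"
    then have "?S k ?n < (\<Sum>i<?n. d (x (k + i)) (x (Suc (k + i))))"
      using n arc_le by (intro sum_strict_mono_ex1) (auto intro!: bexI[of _ 0])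
    then show False using S_eq(1)[of k] len[of k] by simp
  qed
  \<comment> \<open>The image vertices have minimal displacement, so \<open>f (x k)\<close>,
    \<open>f (x K)\<close> and \<open>f (x (K + ?n))\<close> are in line. Cutting this segment one
    step before and one step after the middle gives the turn; the shift of the index by
    \<open>?n\<close> leaves room for the period before it.\<close>
  have turn: "tgt.btw (f (x (j + ?n))) (f (x (Suc (j + ?n)))) (f (x (Suc (Suc (j + ?n)))))" for j
  proof -
    obtain m where m: "?n = Suc m" using n by (cases ?n) auto
    define k where "k = Suc j"
    define K where "K = k + ?n"
    have idx: "k + m = j + ?n" "K = Suc (j + ?n)" "Suc K + m = K + ?n" using m by (simp_all add: k_def K_def)
    have fK: "f (x K) = \<phi>' g (f (x k))" "f (x (K + ?n)) = \<phi>' g (f (x K))"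
      using fper[of k] fper[of K] by (simp_all add: K_def)
    have dK: "d' (f (x k)) (f (x K)) = ?S k ?n" "?S k ?n = tgt.tl_length g"
      "d' (f (x K)) (f (x (K + ?n))) = ?S K ?n"
      using S_eq(2)[of k] S_eq(1)[of k] S_eq(2)[of K] by (simp_all add: K_def)
    have "tgt.tl_length g = d' (f (x k)) (\<phi>' g (f (x k)))" using dK(1,2) fK(1) by simp
    then have axis: "tgt.btw (f (x k)) (f (x K)) (f (x (K + ?n)))"
      unfolding fK by (rule tgt.min_displacement_axis[OF x(1) fx])
    have "tgt.btw (f (x k)) (f (x (k + m))) (f (x K))"
    proof -
      have "?S k ?n = ?S k m + d' (f (x (k + m))) (f (x K))" using m by (simp add: K_def)
      then have "d' (f (x k)) (f (x K)) \<ge> d' (f (x k)) (f (x (k + m))) + d' (f (x (k + m))) (f (x K))"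
        using chain[of k m] dK(1) by linarith
      then show ?thesis
        using tgt.triangle[OF fx[of k] fx[of "k + m"] fx[of K]] fx unfolding tgt.btw_def by auto
    qed
    from tgt.btw_inner2[OF axis this]
    have before: "tgt.btw (f (x (K + ?n))) (f (x K)) (f (x (k + m)))" by (rule tgt.btw_sym)
    have "tgt.btw (f (x K)) (f (x (Suc K))) (f (x (K + ?n)))"
    proof -
      have "?S K ?n = d' (f (x K)) (f (x (Suc K))) + ?S (Suc K) m"
        unfolding m by (subst sum.lessThan_Suc_shift) simp
      moreover have "d' (f (x (Suc K))) (f (x (K + ?n))) \<le> ?S (Suc K) m"
        using chain[of "Suc K" m] unfolding idx(3) .
      ultimately have "d' (f (x K)) (f (x (K + ?n))) \<ge>
          d' (f (x K)) (f (x (Suc K))) + d' (f (x (Suc K))) (f (x (K + ?n)))"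
        using dK(3) by linarith
      then show ?thesis
        using tgt.triangle[OF fx[of K] fx[of "Suc K"] fx[of "K + ?n"]] fx unfolding tgt.btw_def by auto
    qed
    from tgt.btw_inner2[OF before tgt.btw_sym[OF this]]
    have "tgt.btw (f (x (k + m))) (f (x K)) (f (x (Suc K)))" by (rule tgt.btw_sym)
    then show ?thesis unfolding idx(1) unfolding idx(2) .
  qed
  have use: "tgt.btw (f u') (f v) (f w') \<and> d' (f v) (f u') = d v u' \<and> d' (f v) (f w') = d v w'"
    if arcs: "(v, u') \<in> A" "(v, w') \<in> A" and fol: "follows p ((arc_orbit G \<phi> (v, u'))\<inverse>) (arc_orbit G \<phi> (v, w'))"
    for u' w'
  proof -
    obtain j where j: "j < ?n" "p ! j = (arc_orbit G \<phi> (v, u'))\<inverse>"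
      "p ! (Suc j mod ?n) = arc_orbit G \<phi> (v, w')" by (rule follows_nth[OF fol])
    let ?J = "j + ?n"
    have "?J mod ?n = j" "Suc ?J mod ?n = Suc j mod ?n" using j(1) by (simp_all add: mod_Suc)
    then have mem: "(x (Suc ?J), x ?J) \<in> arc_orbit G \<phi> (v, u')"
      "(x (Suc ?J), x (Suc (Suc ?J))) \<in> arc_orbit G \<phi> (v, w')"
      using x(2)[of ?J] x(2)[of "Suc ?J"] j by simp_all
    obtain h where h: "h \<in> carrier G" "x (Suc ?J) = \<phi> h v" "x ?J = \<phi> h u'"
      using mem(1) by (auto simp: arc_orbit_def)
    have "(\<phi> h v, \<phi> h w') \<in> arc_orbit G \<phi> (v, w')" using h(1) by (auto simp: arc_orbit_def)
    then have w': "x (Suc (Suc ?J)) = \<phi> h w'"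
      using mem(2) h(2) mem_arc_Q_unique[of "arc_orbit G \<phi> (v, w')"] arcs(2) by auto
    note A1 = src.branch_arcsD[OF arcs(1)] and A2 = src.branch_arcsD[OF arcs(2)]
    have in_M': "f u' \<in> M'" "f v \<in> M'" "f w' \<in> M'" using equivariantD(1)[OF f(1)] A1 A2 by auto
    have "tgt.btw (\<phi>' h (f u')) (\<phi>' h (f v)) (\<phi>' h (f w'))"
      using turn[of j] h w' equivariantD(2)[OF f(1) h(1)] A1 A2 by simp
    then have "tgt.btw (f u') (f v) (f w')" using tgt.act_btw_iff[OF in_M' h(1)] by simp
    moreover have "d' (f v) (f u') = d v u'"
      using arc_eq[of ?J] h equivariant_dist[OF f(1) h(1) A1(2,1)] src.act_dist[OF h(1) A1(5,4)]
        src.commute[of u' v] tgt.commute[of "f u'" "f v"] by simp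
    moreover have "d' (f v) (f w') = d v w'"
      using arc_eq[of "Suc ?J"] h w' equivariant_dist[OF f(1) h(1) A2(1,2)] src.act_dist[OF h(1) A2(4,5)]
      by simp
    ultimately show ?thesis by blast
  qed
  from p(3) show "tgt.btw (f u) (f v) (f w)" "d' (f v) (f u) = d v u"
    using use[OF vu vw] use[OF vw vu] tgt.btw_sym[of "f w" "f v" "f u"] by blast+
qed

text \<open>Arcs keep their lengths and consecutive arcs are not folded, so
  \<open>btw_overlap\<close> joins the image of the first arc to the image of the remaining
  segment.\<close>

lemma short_map_isometry:
  assumes f: "equivariant f" "lip 1 f" and v: "v \<in> V" and w: "w \<in> V"
  shows "d' (f v) (f w) = d v w"
  using v w
proof (rule segment_induct)
  show "d' (f v) (f v) = d v v" if "v \<in> V" for v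
    using that equivariantD(1)[OF f(1)] V_in by simp
  have arc_eq: "d' (f v) (f u) = d v u" if vu: "(v, u) \<in> A" for v u
  proof -
    obtain z where "(v, z) \<in> A" "z \<noteq> u" using src.arc_continue[OF src.branch_arcs_sym[OF vu]] by metis
    then show ?thesis using short_map_turn(2)[OF f vu] by metis
  qed
  fix v u w assume a: "(v, u) \<in> A" "src.btw v u w" "w \<in> V" and IH: "d' (f u) (f w) = d u w"
  note A = src.branch_arcsD[OF a(1)]
  show "d' (f v) (f w) = d v w"
  proof (cases "u = w")
    case True
    then show ?thesis using arc_eq[OF a(1)] by simp
  next
    case False
    obtain u' where u': "(u, u') \<in> A" "src.btw u u' w" by (rule src.first_arc[OF A(2) a(3) False])
    note A' = src.branch_arcsD[OF u'(1)]
    have "u' \<noteq> v"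
    proof
      assume "u' = v"
      then have "src.btw w v u" using u'(2) src.btw_sym by blast
      moreover have "src.btw w u v" using a(2) src.btw_sym by blast
      ultimately show False using src.btw_antisym A(3) by blast
    qed
    then have turn: "tgt.btw (f v) (f u) (f u')"
      using short_map_turn(1)[OF f src.branch_arcs_sym[OF a(1)] u'(1)] by blast
    have fM: "f v \<in> M'" "f u \<in> M'" "f u' \<in> M'" "f w \<in> M'"
      using equivariantD(1)[OF f(1)] A A' a(3) by auto
    have "d' (f u') (f w) \<le> d u' w" using lip_global[OF f A'(2) a(3)] by simp
    moreover have "d' (f u) (f w) \<le> d' (f u) (f u') + d' (f u') (f w)"
      by (rule tgt.triangle[OF fM(2,3,4)])
    \<comment> \<open>By the induction hypothesis the distance from \<open>f u\<close> to
      \<open>f w\<close> is already full, while the way through \<open>f u'\<close> is no longer,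
      since \<open>f\<close> is short; so the triangle inequality is sharp.\<close>
    ultimately have "tgt.btw (f u) (f u') (f w)"
      unfolding tgt.btw_def using fM IH arc_eq[OF u'(1)] src.btw_dist[OF u'(2)] by simp
    moreover have "f u \<noteq> f u'" using arc_eq[OF u'(1)] A'(7) fM by auto
    ultimately have "tgt.btw (f v) (f u) (f w)" by (rule tgt.btw_overlap(1)[OF turn])
    then show ?thesis
      using tgt.btw_dist[of "f v" "f u" "f w"] arc_eq[OF a(1)] IH src.btw_dist[OF a(2)] by simp
  qed
qed

text \<open>Each point is placed on an image segment at the same distance from its ends. By
  \<open>dist_to_segment_point\<close> its distances to all vertices are then preserved, and hence
  distances between arbitrary points. Positions on segments are unique, which gives equivariance and
  surjectivity.\<close>

theorem ex_equivariant_isometry: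
  assumes "V \<noteq> {}"
  shows "\<exists>h. bij_betw h M M' \<and> (\<forall>x \<in> M. \<forall>y \<in> M. d' (h x) (h y) = d x y) \<and>
    (\<forall>g \<in> carrier G. \<forall>x \<in> M. h (\<phi> g x) = \<phi>' g (h x))"
proof -
  obtain f where f: "equivariant f" "lip 1 f" using ex_short_map by blast
  note iso = short_map_isometry[OF f] and f_in = equivariantD(1)[OF f(1)] and f_eq = equivariantD(2)[OF f(1)]
  obtain v0 where v0: "v0 \<in> V" using assms by blast
  have v0M: "v0 \<in> M" using V_in[OF v0] .
  \<comment> \<open>The hull of a single orbit of vertices fills the tree, so every point lies on a
    segment from \<open>v0\<close> to another vertex.\<close>
  have "\<exists>b \<in> V. src.btw v0 x b" if "x \<in> M" for x
    using src.orbit_hull[OF v0M that] src.act_branch_point[OF v0] by blast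
  then obtain b where b: "\<And>x. x \<in> M \<Longrightarrow> b x \<in> V" "\<And>x. x \<in> M \<Longrightarrow> src.btw v0 x (b x)" by metis
  have "\<exists>p. tgt.btw (f v0) p (f (b x)) \<and> d' (f v0) p = d v0 x \<and> d' p (f (b x)) = d x (b x)" if x: "x \<in> M" for x
  proof -
    have len: "d' (f v0) (f (b x)) = d v0 x + d x (b x)"
      using iso[OF v0 b(1)[OF x]] src.btw_dist[OF b(2)[OF x]] by simp
    then have "d v0 x \<le> d' (f v0) (f (b x))" using src.nonneg[of x "b x"] by simp
    then obtain p where "tgt.btw (f v0) p (f (b x))" "d' (f v0) p = d v0 x"
      "d' p (f (b x)) = d' (f v0) (f (b x)) - d v0 x"
      using tgt.btw_point[OF f_in[OF v0] f_in[OF b(1)[OF x]] src.nonneg] by blast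
    then show ?thesis using len by auto
  qed
  then obtain h where h: "\<And>x. x \<in> M \<Longrightarrow> tgt.btw (f v0) (h x) (f (b x))"
    "\<And>x. x \<in> M \<Longrightarrow> d' (f v0) (h x) = d v0 x" "\<And>x. x \<in> M \<Longrightarrow> d' (h x) (f (b x)) = d x (b x)"
    by metis
  have h_in: "h x \<in> M'" if "x \<in> M" for x using tgt.btw_in(2)[OF h(1)[OF that]] .
  have h_vertex: "d' (f v) (h x) = d v x" if "v \<in> V" "x \<in> M" for v x
    using tgt.dist_to_segment_point[OF h(1)[OF that(2)] f_in[OF that(1)]]
      src.dist_to_segment_point[OF b(2)[OF that(2)] V_in[OF that(1)]]
      iso[OF that(1) v0] iso[OF that(1) b(1)[OF that(2)]] h(2,3)[OF that(2)] by simp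
  have h_iso: "d' (h x) (h y) = d x y" if x: "x \<in> M" and y: "y \<in> M" for x y
    using tgt.dist_to_segment_point[OF h(1)[OF y] h_in[OF x]] src.dist_to_segment_point[OF b(2)[OF y] x]
      h_vertex[OF v0 x] h_vertex[OF b(1)[OF y] x] h(2,3)[OF y]
      tgt.commute[of "h x"] src.commute[of x] by simp
  \<comment> \<open>The auxiliary vertex \<open>b x\<close> depends on a choice; this shows that any
    segment from \<open>v0\<close> through \<open>x\<close> to a vertex would give the same
    value.\<close>
  have unique: "h x = p"
    if x: "src.btw v0 x w" and w: "w \<in> V" and p: "p \<in> M'" "d' (f v0) p = d v0 x" "d' (f w) p = d w x" for x w p
  proof -
    have xM: "x \<in> M" using src.btw_in(2)[OF x] .
    have len: "d' (f v0) (f w) = d v0 x + d x w" using iso[OF v0 w] src.btw_dist[OF x] by simp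
    have "tgt.btw (f v0) (h x) (f w)"
      unfolding tgt.btw_def using f_in v0 w h_in[OF xM] len h_vertex[OF v0 xM] h_vertex[OF w xM]
        tgt.commute[of "h x" "f w"] src.commute[of w x] by simp
    moreover have "tgt.btw (f v0) p (f w)"
      unfolding tgt.btw_def using f_in v0 w p len tgt.commute[of p "f w"] src.commute[of w x] by simp
    ultimately show "h x = p" by (rule tgt.btw_unique) (use h_vertex[OF v0 xM] p(2) in simp)
  qed
  have "inj_on h M"
  proof (rule inj_onI)
    fix x y assume xy: "x \<in> M" "y \<in> M" "h x = h y"
    then have "d x y = 0" using h_iso[OF xy(1,2)] h_in[OF xy(2)] by simp
    then show "x = y" using xy by simp
  qed
  moreover have "h ` M = M'"
  proof (intro equalityI subsetI)
    fix y assume "y \<in> h ` M" then show "y \<in> M'" using h_in by blast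
  next
    fix y assume y: "y \<in> M'"
    obtain g where g: "g \<in> carrier G" "tgt.btw (f v0) y (\<phi>' g (f v0))"
      using tgt.orbit_hull[OF f_in[OF v0] y] by blast
    let ?w = "\<phi> g v0"
    have w: "?w \<in> V" "?w \<in> M" using src.act_branch_point[OF v0 g(1)] V_in by auto
    have yw: "tgt.btw (f v0) y (f ?w)" using g f_eq[OF g(1) v0] by simp
    have len: "d v0 ?w = d' (f v0) y + d' y (f ?w)" using iso[OF v0 w(1)] tgt.btw_dist[OF yw] by simp
    then have "d' (f v0) y \<le> d v0 ?w" using tgt.nonneg[of y "f ?w"] by simp
    then obtain x where x: "src.btw v0 x ?w" "d v0 x = d' (f v0) y" "d x ?w = d v0 ?w - d' (f v0) y"
      using src.btw_point[OF v0M w(2) tgt.nonneg] by blast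
    have "h x = y"
      by (rule unique[OF x(1) w(1) y]) (use x len tgt.commute[of y "f ?w"] src.commute[of x ?w] in simp_all)
    then show "y \<in> h ` M" using src.btw_in(2)[OF x(1)] by blast
  qed
  moreover have "h (\<phi> g x) = \<phi>' g (h x)" if g: "g \<in> carrier G" and x: "x \<in> M" for g x
  proof -
    have gx: "\<phi> g x \<in> M" using src.act_in g x by blast
    have "d' (f v) (\<phi>' g (h x)) = d v (\<phi> g x)" if v: "v \<in> V" for v
    proof -
      have v': "\<phi> (inv g) v \<in> V" using src.act_branch_point[OF v] g by simp
      have "\<phi>' g (f (\<phi> (inv g) v)) = f v" using f_eq[OF g v'] g V_in[OF v] by simp
      then have "d' (f v) (\<phi>' g (h x)) = d' (f (\<phi> (inv g) v)) (h x)"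
        using tgt.act_dist[OF g f_in[OF v'] h_in[OF x]] by simp
      also have "\<dots> = d (\<phi> (inv g) v) x" by (rule h_vertex[OF v' x])
      also have "\<dots> = d v (\<phi> g x)" using src.act_dist[OF g V_in[OF v'] x] g V_in[OF v] by simp
      finally show ?thesis .
    qed
    then show ?thesis
      by (intro unique[OF b(2)[OF gx] b(1)[OF gx]] tgt.act_in g h_in x) (use v0 b(1)[OF gx] in auto)
  qed
  ultimately show ?thesis using h_iso unfolding bij_betw_def by blast
qed

end

text \<open>Translation length is a conjugacy invariant, so agreement on the chosen representatives
  extends to all almost simple elements.\<close>

lemma almost_simple_translation_length:
  assumes src: "tree_action (mspace T) (mdist T) G \<phi>" and tgt: "tree_action (mspace T') (mdist T') G \<phi>'"
    and U: "almost_simple_set G T \<phi> U"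
    and eq: "\<And>g. g \<in> U \<Longrightarrow> translation_length T \<phi> g = translation_length T' \<phi>' g"
    and g: "g \<in> almost_simple_elements G T \<phi>"
  shows "translation_length T \<phi> g = translation_length T' \<phi>' g"
proof -
  interpret src: tree_action "mspace T" "mdist T" G \<phi> by (fact src)
  interpret tgt: tree_action "mspace T'" "mdist T'" G \<phi>' by (fact tgt)
  have len: "translation_length T \<phi> = src.tl_length" "translation_length T' \<phi>' = tgt.tl_length"
    by (simp_all add: fun_eq_iff translation_length_def src.tl_length_def tgt.tl_length_def)
  obtain u where u: "u \<in> U" "conjugate_in G g u"
    using U g unfolding almost_simple_set_def by blast
  then obtain k where k: "k \<in> carrier G" "u = k \<otimes>\<^bsub>G\<^esub> g \<otimes>\<^bsub>G\<^esub> inv\<^bsub>G\<^esub> k"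
    by (auto simp: conjugate_in_def)
  have "g \<in> carrier G" using g by (simp add: almost_simple_elements_def)
  then show ?thesis
    using eq[OF u(1)] src.tl_length_conj[of g k] tgt.tl_length_conj[of g k] k by (simp add: len)
qed

theorem theorem3p6:
  fixes G :: "('g, 'm) monoid_scheme" and N :: nat
    and T :: "'a metric" and \<phi> :: "'g \<Rightarrow> 'a \<Rightarrow> 'a"
    and T' :: "'b metric" and \<phi>' :: "'g \<Rightarrow> 'b \<Rightarrow> 'b"
    and U :: "'g set"
  assumes "N \<ge> 2"
    and "free_group_of_rank G N"
    and "outer_space_tree G T \<phi>"
    and "outer_space_tree G T' \<phi>'"
    and "almost_simple_set G T \<phi> U"
    and "\<And>g. g \<in> U \<Longrightarrow> translation_length T \<phi> g = translation_length T' \<phi>' g"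
  shows "equal_in_outer_space G T \<phi> T' \<phi>'"
proof -
  interpret group G using assms(2) by (simp add: free_group_of_rank_def)
  obtain X where X: "finite X" "card X = N" "free_basis G X"
    using assms(2) by (auto simp: free_group_of_rank_def)
  \<comment> \<open>Two distinct basis elements are what \<open>free_basis_centerless\<close>
    requires.\<close>
  have "1 < card X" using X(2) assms(1) by simp
  then obtain a b where ab: "a \<in> X" "b \<in> X" "a \<noteq> b"
    by (metis One_nat_def X(1) card_le_Suc0_iff_eq not_less)
  have X_in: "X \<subseteq> carrier G" and X_gen: "generate G X = carrier G" and X_ne: "X \<noteq> {}"
    using X(3) ab by (auto simp: free_basis_def)
  have center: "z = \<one>\<^bsub>G\<^esub>"
    if "z \<in> carrier G" "\<And>s. s \<in> X \<Longrightarrow> s \<otimes>\<^bsub>G\<^esub> z = z \<otimes>\<^bsub>G\<^esub> s" for z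
    by (rule free_basis_centerless[OF X(3) ab that])
  have tree: "real_tree T" using assms(3) by (simp add: outer_space_tree_def)
  have src: "tree_action (mspace T) (mdist T) G \<phi>" and tgt: "tree_action (mspace T') (mdist T') G \<phi>'"
    using tree_action_of_outer_space_tree assms(3,4) is_group by blast+
  interpret src: tree_action "mspace T" "mdist T" G \<phi> by (fact src)
  interpret tgt: tree_action "mspace T'" "mdist T'" G \<phi>' by (fact tgt)
  obtain x0 x1 where x: "x0 \<in> mspace T" "x1 \<in> mspace T'" using src.nonempty tgt.nonempty by blast
  interpret pair: action_pair "mspace T" "mdist T" G \<phi> X x0 "mspace T'" "mdist T'" \<phi>' x1
    by unfold_locales (use X(1) X_in X_gen X_ne x center in auto)
  have Q: "quotient_graph G T \<phi> = pair.Q"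
    by (simp add: quotient_graph_def pair.Q_def tree_vertices_eq[OF tree] tree_arcs_eq[OF tree])
  interpret equal_lengths "mspace T" "mdist T" G \<phi> X x0 "mspace T'" "mdist T'" \<phi>' x1
  proof
    fix g p assume "g \<in> carrier G" "almost_simple_curve pair.Q p" "represented_by \<phi> g p"
    then have "g \<in> almost_simple_elements G T \<phi>" unfolding almost_simple_elements_def Q by blast
    from almost_simple_translation_length[OF src tgt assms(5,6) this]
    show "src.tl_length g = tgt.tl_length g"
      by (simp add: translation_length_def src.tl_length_def tgt.tl_length_def)
  qed
  \<comment> \<open>Without branch points the group would be commutative, so the basis element
    \<open>a\<close> would be central and hence trivial, against freeness.\<close>
  have "src.branch_points \<noteq> {}"
  proof
    assume none: "src.branch_points = {}"
    have "a = \<one>\<^bsub>G\<^esub>"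
      by (rule center) (use src.commute_if_no_branch_points[OF none] X_in ab in auto)
    moreover have "word_value G [(a, True)] \<noteq> \<one>\<^bsub>G\<^esub>"
      using X(3) ab(1) unfolding free_basis_def reduced_word_def by (auto dest: spec[of _ "[(a, True)]"])
    ultimately show False by (simp add: word_value_Cons)
  qed
  from ex_equivariant_isometry[OF this] show ?thesis
    unfolding equal_in_outer_space_def by blast
qed

end
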